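(* Let $p\geq 2$ be an integer and let $v=(v_k)_{k\geq 1}$ be a real sequence with only finitely many, and at least one, non-zero terms. Put $k_v:=\min\{k:v_k\neq 0\}$ and $K_v:=\max\{k:v_k\neq 0\}$. Let $f$ be an angular function that is $q$ times differentiable at zero, where $q\geq K_v$ is an integer. Fix $\tau>0$. For a positive integer $k$, consider the conditions (a) $f^{(k)}(0)\neq 0$; (b) the set $\mathcal{V}_k:=\{\ell\in\{k_v,\ldots,k\}:\ \ell\sim k\text{ and }v_\ell\neq 0\}$ is non-empty. Then, as $n\to\infty$: (i) Assume that some $k\in\{k_v,\ldots,q\}$ satisfies (a)--(b), let $k_*$ be the smallest such $k$, let $k_\dagger:=\min\mathcal{V}_{k_*}$, and put, for $1\le k\le k_*$, $$ \xi_{p,k,k_*}(\tau):=\frac{m_{k,k_*}^2(f^{(k_* )}(0))^2\tau^{2k_*}}{(k_*!)^2t_{p,k}^2}=\frac{1}{(k_*!)^2}\,t_{p,k}^2\,(f^{(k_* )}(0))^2\,\tau^{2k_*}\Bigg(\sum_{j=0}^{\lfloor k/2\rfloor}(-1)^jc^{(p-2)/2}_{k,j}a_{k+k_*-2j}\Bigg)^2 . $$ Then, under $\mathrm{P}^{(n)}_{\kappa_n,f}$ with $\kappa_n=n^{-1/(2k_* )}\tau$, $S_v^{(n)}$ converges in distribution to $$\sum_{k=1}^{K_v}v_k^2\,\chi^2_{d_{p,k}}\big(\mathbb{I}[k_\dagger\leq k\leq k_*,\,k\sim k_*]\,\xi_{p,k,k_*}(\tau)\big).$$ (ii) If no $k\in\{1,\ldots,q\}$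 satisfies (a)--(b), then, under $\mathrm{P}^{(n)}_{\kappa_n,f}$ with $\kappa_n=n^{-1/(2q)}\tau$, $S_v^{(n)}$ converges in distribution to $\sum_{k=1}^{K_v}v_k^2\chi^2_{d_{p,k}}$.
   Context: $k\sim\ell$ means that the integers $k$ and $\ell$ have the same parity; $\mathbb{I}[A]$ equals one if $A$ holds and zero otherwise (when the indicator is zero the non-centrality parameter is zero). $\mathcal{S}^{p-1}$ is the unit sphere of $\mathbb{R}^p$ and $\theta_0:=(0,\ldots,0,1)'\in\mathbb{R}^p$. An angular function is a (Borel measurable) function $f:\mathbb{R}\to[0,\infty)$ with $f(0)=1$; $f^{(k)}$ denotes its $k$th derivative. For $\kappa_n>0$, $\mathrm{P}^{(n)}_{\kappa_n,f}$ is the hypothesis under which $U_1,\ldots,U_n$ are i.i.d. on $\mathcal{S}^{p-1}$ with density, with respect to the surface area measure, proportional to $u\mapsto f(\kappa_n u'\theta_0)$. (This is well defined as soon as the integral of this function is finite and positive, hence for all large $n$ when $\kappa_n\to0$ and $f$ is continuous at zero.) Polynomials: $C_q^{\lambda}(t)=\sum_{j=0}^{\lfloor q/2\rfloor}(-1)^jc^\lambda_{q,j}t^{q-2j}$, where for $\lambda>0$ (Gegenbauer) $c^\lambda_{q,j}:=\frac{2^{q-2j}\Gamma(q-j+\lambda)}{\Gamma(\lambda)j!(q-2j)!}$, and for $\lambda=0$ and $q\ge1$ (Chebyshev of the first kind, $C_q^0(\cos\theta)=\cos(q\theta)$) $c^0_{q,j}:=\frac{2^{q-2j-1}q\,\Gamma(q-j)}{j!(q-2j)!}$;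 $C_0^0:=1$. The real numbers $m_{k,i}$, $0\le k\le i$, are defined, for each positive integer $i$, by $t^i=\sum_{k=0}^im_{k,i}C_k^{(p-2)/2}(t)$. Constants: $a_m:=c_p\int_{-1}^1s^m(1-s^2)^{(p-3)/2}ds$ with $c_p:=1/\int_{-1}^1(1-s^2)^{(p-3)/2}ds$; $d_{p,k}=\binom{p+k-3}{p-2}+\binom{p+k-2}{p-2}$ for $k\ge1$ (so $d_{2,k}=2$); $t_{p,k}:=\sqrt2$ if $p=2$ and $t_{p,k}:=(1+2k/(p-2))/\sqrt{d_{p,k}}$ if $p\ge3$. Sobolev statistic: $S_v^{(n)}:=\frac1n\sum_{i,j=1}^n\sum_{k=1}^\infty v_k^2h_{p,k}(U_i'U_j)$, where $h_{p,k}(s):=2C_k^0(s)$ if $p=2$ and $h_{p,k}(s):=(1+\frac{2k}{p-2})C_k^{(p-2)/2}(s)$ if $p\geq3$. $\chi^2_d(\xi)$ is the non-central chi-square distribution with $d$ degrees of freedom and non-centrality parameter $\xi$ (law of $\|Z\|^2$ with $Z\sim N(\mu,I_d)$, $\|\mu\|^2=\xi$), $\chi^2_d:=\chi^2_d(0)$; $\sum_k w_k\chi^2_{d_k}(\xi_k)$ denotes the law of the weighted sum of mutually independent random variables with these distributions. *)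

theory Defs
  imports "HOL-Probability.Probability"
begin

definition same_parity :: "nat \<Rightarrow> nat \<Rightarrow> bool" where
  "same_parity k l \<longleftrightarrow> (even k \<longleftrightarrow> even l)"


section \<open>Gegenbauer and Chebyshev polynomials and the associated constants\<close>

text \<open>In the case \<open>lam = 0\<close> the exponent of 2 equals \<open>-1\<close> when \<open>q = 2 * j\<close>, hence the integer power.\<close>

definition gegen_coeff :: "real \<Rightarrow> nat \<Rightarrow> nat \<Rightarrow> real" where
  "gegen_coeff lam q j =
     (if lam = 0
      then 2 powi (int q - 2 * int j - 1) * real q * Gamma (real q - real j)
             / (fact j * fact (q - 2 * j))
      else 2 ^ (q - 2 * j) * Gamma (real q - real j + lam)
             / (Gamma lam * fact j * fact (q - 2 * j)))"

definition gegen_poly :: "real \<Rightarrow> nat \<Rightarrow> real \<Rightarrow> real" where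
  "gegen_poly lam q t =
     (if lam = 0 \<and> q = 0 then 1
      else (\<Sum>j = 0..q div 2. (-1) ^ j * gegen_coeff lam q j * t ^ (q - 2 * j)))"

definition gegen_index :: "nat \<Rightarrow> real" where
  "gegen_index p = (real p - 2) / 2"

text \<open>The coordinates of the monomial of degree \<open>i\<close> in the basis of the polynomials above;
  entries with \<open>k > i\<close> are set to zero so that the description is unique.\<close>

definition monomial_coeff :: "nat \<Rightarrow> nat \<Rightarrow> nat \<Rightarrow> real" where
  "monomial_coeff p k i =
     (THE m :: nat \<Rightarrow> real.
        (\<forall>t :: real. t ^ i = (\<Sum>l = 0..i. m l * gegen_poly (gegen_index p) l t)) \<and>
        (\<forall>l > i. m l = 0)) k"

definition moment_norm :: "nat \<Rightarrow> real" where
  "moment_norm p = 1 / (LINT s:{-1..1}|lborel. (1 - s\<^sup>2) powr ((real p - 3) / 2))"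

definition moment :: "nat \<Rightarrow> nat \<Rightarrow> real" where
  "moment p m =
     moment_norm p * (LINT s:{-1..1}|lborel. s ^ m * (1 - s\<^sup>2) powr ((real p - 3) / 2))"

text \<open>Meaningful for \<open>p \<ge> 2\<close> and \<open>k \<ge> 1\<close>, where the subtractions do not truncate.\<close>

definition harm_dim :: "nat \<Rightarrow> nat \<Rightarrow> nat" where
  "harm_dim p k = ((p + k - 3) choose (p - 2)) + ((p + k - 2) choose (p - 2))"

definition t_const :: "nat \<Rightarrow> nat \<Rightarrow> real" where
  "t_const p k =
     (if p = 2 then sqrt 2
      else (1 + 2 * real k / (real p - 2)) / sqrt (real (harm_dim p k)))"


section \<open>Angular functions and rotationally symmetric samples\<close>

definition angular_function :: "(real \<Rightarrow> real) \<Rightarrow> bool" where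
  "angular_function f \<longleftrightarrow> f \<in> borel_measurable borel \<and> (\<forall>x. 0 \<le> f x) \<and> f 0 = 1"

abbreviation nth_deriv :: "nat \<Rightarrow> (real \<Rightarrow> real) \<Rightarrow> real \<Rightarrow> real" where
  "nth_deriv k f \<equiv> (deriv ^^ k) f"

text \<open>Pointwise notion: derivatives of order below \<open>q\<close> exist in a neighbourhood of \<open>x\<close>, that of
  order \<open>q\<close> is only required to exist at \<open>x\<close> itself.\<close>

primrec times_differentiable_at :: "nat \<Rightarrow> (real \<Rightarrow> real) \<Rightarrow> real \<Rightarrow> bool" where
  "times_differentiable_at 0 f x \<longleftrightarrow> True"
| "times_differentiable_at (Suc q) f x \<longleftrightarrow>
     (\<forall>\<^sub>F y in nhds x. times_differentiable_at q f y) \<and>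
     nth_deriv q f differentiable (at x)"

definition theta0 :: "real ^ ('n :: {finite, linorder})" where
  "theta0 = axis (Max UNIV) 1"

text \<open>The surface area measure, obtained from Lebesgue measure through cones: the area of \<open>A\<close> is
  the dimension times the volume of the set of all \<open>r *\<^sub>R u\<close> with \<open>0 < r \<le> 1\<close> and \<open>u \<in> A\<close>.
  Note that \<open>sgn x\<close> is \<open>x /\<^sub>R norm x\<close>.\<close>

definition sphere_measure :: "(real ^ ('n :: finite)) measure" where
  "sphere_measure =
     scale_measure (of_nat CARD('n))
       (distr (restrict_space lborel (cball 0 1 - {0})) (restrict_space borel (sphere 0 1)) sgn)"

text \<open>If the normalising integral is zero, or infinite (in which case its value here is zero), the
  density vanishes and the predicate \<open>rotsym_sample\<close> below cannot hold for \<open>n \<ge> 1\<close>.\<close>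

definition rotsym_density :: "real \<Rightarrow> (real \<Rightarrow> real) \<Rightarrow> real ^ ('n :: {finite, linorder}) \<Rightarrow> real" where
  "rotsym_density \<kappa> f u =
     f (\<kappa> * (u \<bullet> theta0)) / (LINT w|sphere_measure. f (\<kappa> * (w \<bullet> (theta0 :: (real, 'n) vec))))"

definition rotsym_sample ::
  "nat \<Rightarrow> real \<Rightarrow> (real \<Rightarrow> real) \<Rightarrow> 'w measure \<Rightarrow>
   (nat \<Rightarrow> 'w \<Rightarrow> real ^ ('n :: {finite, linorder})) \<Rightarrow> bool" where
  "rotsym_sample n \<kappa> f M U \<longleftrightarrow>
     prob_space M \<and>
     prob_space.indep_vars M (\<lambda>_. restrict_space borel (sphere 0 1)) U {1..n} \<and>
     (\<forall>i \<in> {1..n}. distributed M sphere_measure (U i) (\<lambda>u. ennreal (rotsym_density \<kappa> f u)))"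


section \<open>Sobolev statistics\<close>

definition sobolev_kernel :: "nat \<Rightarrow> nat \<Rightarrow> real \<Rightarrow> real" where
  "sobolev_kernel p k s =
     (if p = 2 then 2 * gegen_poly 0 k s
      else (1 + 2 * real k / (real p - 2)) * gegen_poly (gegen_index p) k s)"

text \<open>Weights are indexed from 1; the value \<open>v 0\<close> is never used.\<close>

definition sobolev_stat :: "(nat \<Rightarrow> real) \<Rightarrow> nat \<Rightarrow> (nat \<Rightarrow> real ^ ('n :: finite)) \<Rightarrow> real" where
  "sobolev_stat v n u =
     1 / real n * (\<Sum>i = 1..n. \<Sum>j = 1..n.
       (\<Sum>k. (v (Suc k))\<^sup>2 * sobolev_kernel CARD('n) (Suc k) (u i \<bullet> u j)))"

definition weight_support :: "(nat \<Rightarrow> real) \<Rightarrow> nat set" where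
  "weight_support v = {k. 1 \<le> k \<and> v k \<noteq> 0}"

abbreviation min_order :: "(nat \<Rightarrow> real) \<Rightarrow> nat" where
  "min_order v \<equiv> Min (weight_support v)"

abbreviation max_order :: "(nat \<Rightarrow> real) \<Rightarrow> nat" where
  "max_order v \<equiv> Max (weight_support v)"

definition parity_orders :: "(nat \<Rightarrow> real) \<Rightarrow> nat \<Rightarrow> nat set" where
  "parity_orders v k = {l \<in> {min_order v..k}. same_parity l k \<and> v l \<noteq> 0}"

definition detecting_order :: "(nat \<Rightarrow> real) \<Rightarrow> (real \<Rightarrow> real) \<Rightarrow> nat \<Rightarrow> bool" where
  "detecting_order v f k \<longleftrightarrow> nth_deriv k f 0 \<noteq> 0 \<and> parity_orders v k \<noteq> {}"

definition noncentrality :: "nat \<Rightarrow> (real \<Rightarrow> real) \<Rightarrow> nat \<Rightarrow> nat \<Rightarrow> real \<Rightarrow> real" where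
  "noncentrality p f k i \<tau> =
     (monomial_coeff p k i)\<^sup>2 * (nth_deriv i f 0)\<^sup>2 * \<tau> ^ (2 * i)
       / ((fact i)\<^sup>2 * (t_const p k)\<^sup>2)"


section \<open>Weighted sums of non-central chi-square distributions\<close>

text \<open>The law of the squared norm of a Gaussian vector with identity covariance depends on the mean
  \<open>\<mu>\<close> only through its squared norm \<open>\<xi>\<close>, so any choice of \<open>\<mu>\<close> will do. Meaningful for \<open>d \<ge> 1\<close> and
  \<open>\<xi> \<ge> 0\<close>.\<close>

definition noncentral_chi_square :: "nat \<Rightarrow> real \<Rightarrow> real measure" where
  "noncentral_chi_square d \<xi> =
     (let \<mu> = (SOME \<mu> :: nat \<Rightarrow> real. (\<Sum>i<d. (\<mu> i)\<^sup>2) = \<xi>)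
      in distr (\<Pi>\<^sub>M i\<in>{..<d}. density lborel (\<lambda>x. ennreal (normal_density (\<mu> i) 1 x))) borel
           (\<lambda>z. \<Sum>i<d. (z i)\<^sup>2))"

abbreviation chi_square :: "nat \<Rightarrow> real measure" where
  "chi_square d \<equiv> noncentral_chi_square d 0"

text \<open>The law of \<open>\<Sum>k = 1..K. w k * X k\<close> for independent \<open>X k\<close> with laws \<open>L k\<close>.\<close>

definition weighted_sum_law :: "nat \<Rightarrow> (nat \<Rightarrow> real) \<Rightarrow> (nat \<Rightarrow> real measure) \<Rightarrow> real measure" where
  "weighted_sum_law K w L =
     distr (\<Pi>\<^sub>M k\<in>{1..K}. L k) borel (\<lambda>x. \<Sum>k = 1..K. w k * x k)"

end

theory Submission
  imports Defs "HOL-Computational_Algebra.Polynomial"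
begin

text \<open>
  Up to the factor \<open>harm_dim p k\<close> the kernel \<open>h\<^sub>k\<close> is the Gegenbauer polynomial normalised to \<open>1\<close> at \<open>1\<close>.
  These polynomials are orthogonal for the law of one coordinate of a uniform point on the sphere.
  Convolution of zonal polynomials over the sphere is symmetric and does not raise degrees, hence it is
  diagonal in the orthogonal polynomials: the kernels \<open>h\<^sub>k\<close> are mutually orthogonal and reproducing.
  A reproducing kernel with integer trace \<open>d\<close> is the sum of \<open>d\<close> products of orthonormal
  functions (spherical harmonics), obtained by splitting off one function at a time. So the Sobolev
  statistic is a weighted sum of squares of normalised sums \<open>Z\<close> of bounded i.i.d. variables.

  A Taylor expansion of \<open>f\<close> at zero shows that their covariances tend to the identity and that their
  means converge; in the limit only the term of order \<open>k\<^sub>*\<close> survives, the lower ones being killed by the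
  orthogonality relations, by parity, or by a vanishing derivative. This gives the limit of the
  characteristic function of every linear combination of the \<open>Z\<close>. The Laplace transform of a sum of
  squares is a Gaussian average of such characteristic functions, so the Laplace transforms of the
  statistic converge, and for laws on the half line this implies weak convergence.
\<close>

section \<open>Normalised Gegenbauer polynomials and their moment functional\<close>

text \<open>The rate is calibrated so that \<open>sqrt n * \<kappa> ^ i = \<tau> ^ i\<close>. A
  Taylor term of lower order is then multiplied by a diverging factor, so it has to vanish
  identically; being small would not do. This is why the smallest detecting order governs the limit.
  Both parts are instances of one limit statement: in part (ii) it is applied at order
  \<open>q\<close>, where the term of order \<open>q\<close> vanishes as well.

  The surface measure is given by cones, and the density of one coordinate is never computed. The
  bridge to the constants \<open>moment\<close> is the recursion of \<open>zmom\<close>, which is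
  verified twice: on the sphere by rotation invariance and \<open>norm w = 1\<close>, on the
  interval by integration by parts.

  No spherical harmonic is written down. The limiting means are multiples of the values of the
  harmonics at \<open>theta0\<close>, and the squares of these values add up to the kernel on the
  diagonal, \<open>harm_dim p k\<close>. This yields the non-centrality parameter for any choice of
  basis. Linearising the squares stands in for a multivariate limit theorem with continuous
  mapping.\<close>

text \<open>The Legendre polynomials in dimension \<open>p\<close>: Gegenbauer (Chebyshev for \<open>p = 2\<close>) polynomials divided by
  their value at \<open>1\<close>. Their recurrence, unlike that of \<open>gegen_poly\<close>, needs no case distinction on \<open>p\<close>.\<close>

fun leg :: "nat \<Rightarrow> nat \<Rightarrow> real poly" where
  "leg p 0 = 1"
| "leg p (Suc 0) = [:0, 1:]"
| "leg p (Suc (Suc k)) = smult (1 / (real p + real k - 1))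
     (smult (2 * real k + real p) ([:0, 1:] * leg p (Suc k)) - smult (real k + 1) (leg p k))"

text \<open>The moments of one coordinate of a uniform point on the sphere of \<open>\<real>\<^sup>p\<close>.\<close>

fun zmom :: "nat \<Rightarrow> nat \<Rightarrow> real" where
  "zmom p 0 = 1"
| "zmom p (Suc 0) = 0"
| "zmom p (Suc (Suc m)) = (real m + 1) / (real m + real p) * zmom p m"

text \<open>The functional is kept purely algebraic, so that the orthogonality relations are derived
  without integrals; \<open>integral_usphere_poly\<close> later identifies it with an integral over
  the sphere.\<close>

definition zmean :: "nat \<Rightarrow> real poly \<Rightarrow> real" where
  "zmean p P = (\<Sum>i\<le>degree P. coeff P i * zmom p i)"

lemma zmean_altdef: "degree P \<le> n \<Longrightarrow> zmean p P = (\<Sum>i\<le>n. coeff P i * zmom p i)"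
  unfolding zmean_def by (rule sum.mono_neutral_left) (auto simp: coeff_eq_0)

lemma zmean_add: "zmean p (P + Q) = zmean p P + zmean p Q"
proof -
  let ?n = "max (degree P) (degree Q)"
  have "degree (P + Q) \<le> ?n" by (rule degree_add_le_max)
  then show ?thesis
    by (simp add: zmean_altdef[of _ ?n] sum.distrib algebra_simps)
qed

lemma zmean_smult: "zmean p (smult c P) = c * zmean p P"
  by (subst zmean_altdef[OF degree_smult_le]) (simp add: zmean_def sum_distrib_left mult.assoc)

lemma zmean_0 [simp]: "zmean p 0 = 0"
  by (simp add: zmean_def)

lemma zmean_1 [simp]: "zmean p 1 = 1"
  by (simp add: zmean_def)

lemma zmean_diff: "zmean p (P - Q) = zmean p P - zmean p Q"
  using zmean_add[of p P "smult (-1) Q"] zmean_smult[of p "-1" Q] by simp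

lemma zmean_sum: "zmean p (sum F A) = (\<Sum>i\<in>A. zmean p (F i))"
  by (induction A rule: infinite_finite_induct) (auto simp: zmean_add)

lemma zmean_monom: "zmean p (monom c m) = c * zmom p m"
proof -
  have "zmean p (monom c m) = (\<Sum>i\<le>m. if m = i then c * zmom p i else 0)"
    by (subst zmean_altdef[OF degree_monom_le]) (rule sum.cong, simp_all)
  then show ?thesis by simp
qed

text \<open>This is integration by parts for the weight \<open>(1 - t^2) powr ((p - 3) / 2)\<close>:
  its product with \<open>1 - t^2\<close> has the derivative \<open>- (p - 1) * t\<close> times the
  weight. On monomials the identity is the recursion of \<open>zmom\<close>.\<close>

lemma zmean_ibp:
  assumes "p \<ge> 2"
  shows "zmean p ((1 - monom 1 2) * pderiv g) = (real p - 1) * zmean p ([:0, 1:] * g)"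
proof -
  note [simp del] = mult_pCons_left
  have mon: "zmean p ((1 - monom 1 2) * pderiv (monom c m)) = (real p - 1) * zmean p ([:0, 1:] * monom c m)"
    for c :: real and m
  proof (cases m)
    case 0
    then show ?thesis by (simp add: pderiv_monom monom_0 zmean_def pderiv_pCons)
  next
    case (Suc j)
    have "(1 - monom 1 2) * pderiv (monom c m) = monom (real m * c) j - monom (real m * c) (Suc (Suc j))"
      by (simp add: pderiv_monom Suc left_diff_distrib mult_monom)
    then have 1: "zmean p ((1 - monom 1 2) * pderiv (monom c m)) =
        real m * c * zmom p j - real m * c * zmom p (Suc (Suc j))"
      by (simp only: zmean_diff zmean_monom)
    have "[:0, 1:] * monom c m = monom c (Suc (Suc j))"
      by (simp add: Suc monom_Suc mult_pCons_left)
    then have 2: "zmean p ([:0, 1:] * monom c m) = c * zmom p (Suc (Suc j))"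
      by (simp only: zmean_monom)
    have "real j + real p \<noteq> 0" using assms by simp
    then show ?thesis
      unfolding 1 2 by (simp add: Suc divide_simps) (simp add: algebra_simps)
  qed
  have "g = (\<Sum>i\<le>degree g. monom (coeff g i) i)"
    by (simp add: poly_as_sum_of_monoms)
  moreover have "zmean p ((1 - monom 1 2) * pderiv (\<Sum>i\<le>degree g. monom (coeff g i) i)) =
    (real p - 1) * zmean p ([:0, 1:] * (\<Sum>i\<le>degree g. monom (coeff g i) i))"
    unfolding higher_pderiv_sum[of 1, simplified] sum_distrib_left zmean_sum mon ..
  ultimately show ?thesis by simp
qed

section \<open>Recurrence and structure relation\<close>

lemma leg_rec:
  assumes "p \<ge> 2"
  shows "smult (real p + real k - 1) (leg p (Suc (Suc k))) =
     smult (2 * real k + real p) ([:0, 1:] * leg p (Suc k)) - smult (real k + 1) (leg p k)"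
  using assms by simp

lemma x_leg:
  assumes "p \<ge> 2"
  shows "smult (2 * real k + real p) ([:0, 1:] * leg p (Suc k)) =
     smult (real p + real k - 1) (leg p (Suc (Suc k))) + smult (real k + 1) (leg p k)"
  using leg_rec[OF assms, of k] by (simp del: leg.simps)

lemma poly_leg_rec:
  assumes "p \<ge> 2"
  shows "(real p + real k - 1) * poly (leg p (Suc (Suc k))) t =
     (2 * real k + real p) * (t * poly (leg p (Suc k)) t) - (real k + 1) * poly (leg p k) t"
  using arg_cong[OF leg_rec[OF assms, of k], of "\<lambda>P. poly P t"] by (simp del: leg.simps)

lemma poly_pderiv_leg_rec:
  assumes "p \<ge> 2"
  shows "(real p + real k - 1) * poly (pderiv (leg p (Suc (Suc k)))) t =
     (2 * real k + real p) * (t * poly (pderiv (leg p (Suc k))) t + poly (leg p (Suc k)) t)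
       - (real k + 1) * poly (pderiv (leg p k)) t"
  using arg_cong[OF leg_rec[OF assms, of k], of "\<lambda>P. poly (pderiv P) t"]
  by (simp del: leg.simps add: pderiv_smult pderiv_mult pderiv_diff pderiv_pCons algebra_simps)

text \<open>The structure relation expresses a derivative through the polynomials themselves, which
  makes \<open>zmean_ibp\<close> applicable to them. It follows by multiplying the differentiated
  recurrence by \<open>1 - t^2\<close> and inserting the relation for the two previous
  degrees.\<close>

lemma poly_leg_structure:
  assumes "p \<ge> 2"
  shows "(1 - t\<^sup>2) * poly (pderiv (leg p (Suc k))) t =
    (real k + 1) * (poly (leg p k) t - t * poly (leg p (Suc k)) t)"
proof (induction k rule: less_induct)
  case (less n)
  show ?case
  proof (cases n)
    case 0
    then show ?thesis by (simp add: pderiv_pCons power2_eq_square)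
  next
    case (Suc k)
    define A where "A = poly (leg p (Suc (Suc k))) t"
    define B where "B = poly (leg p (Suc k)) t"
    define C where "C = poly (leg p k) t"
    define A' where "A' = (1 - t\<^sup>2) * poly (pderiv (leg p (Suc (Suc k)))) t"
    define B' where "B' = (1 - t\<^sup>2) * poly (pderiv (leg p (Suc k))) t"
    define C' where "C' = (1 - t\<^sup>2) * poly (pderiv (leg p k)) t"
    have B': "B' = (real k + 1) * (C - t * B)"
      using less.IH[of k] Suc by (simp add: B'_def B_def C_def)
    have A: "(real p + real k - 1) * A = (2 * real k + real p) * (t * B) - (real k + 1) * C"
      using poly_leg_rec[OF assms] by (simp add: A_def B_def C_def)
    have A': "(real p + real k - 1) * A' = (2 * real k + real p) * (t * B' + (1 - t\<^sup>2) * B) - (real k + 1) * C'"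
      using arg_cong[OF poly_pderiv_leg_rec[OF assms, of k t], of "\<lambda>y. (1 - t\<^sup>2) * y"]
      by (simp del: leg.simps add: A'_def B'_def C'_def B_def algebra_simps)
    \<comment> \<open>The companion relation, in terms of the next polynomial instead of the
      previous one. It comes from the induction hypothesis by eliminating the polynomial of degree
      \<open>k - 1\<close> with the recurrence.\<close>
    have C': "C' = (real k + real p - 2) * (t * C - B)"
    proof (cases k)
      case 0
      then show ?thesis by (simp add: C'_def C_def B_def)
    next
      case (Suc j)
      define D where "D = poly (leg p j) t"
      have "(real p + real j - 1) * B = (2 * real j + real p) * (t * C) - (real j + 1) * D"
        using poly_leg_rec[OF assms, of j t] by (simp add: B_def C_def D_def Suc)
      moreover have "C' = (real j + 1) * (D - t * C)"
        using less.IH[of j] Suc \<open>n = Suc k\<close> by (simp add: C'_def C_def D_def)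
      ultimately show ?thesis by (simp add: Suc algebra_simps)
    qed
    have "real p + real k - 1 \<noteq> 0" using assms by simp
    moreover have "(real p + real k - 1) * A' = (real p + real k - 1) * ((real k + 2) * (B - t * A))"
    proof -
      have "(real p + real k - 1) * ((real k + 2) * (B - t * A)) =
         (real k + 2) * ((real p + real k - 1) * B - t * ((real p + real k - 1) * A))"
        by (simp add: algebra_simps)
      then show ?thesis
        unfolding A' A B' C' by (simp add: algebra_simps power2_eq_square)
    qed
    ultimately have "A' = (real k + 2) * (B - t * A)" by simp
    then show ?thesis by (simp del: leg.simps add: A'_def A_def B_def Suc)
  qed
qed

lemma leg_structure:
  assumes "p \<ge> 2"
  shows "(1 - monom 1 2) * pderiv (leg p (Suc k)) =
    smult (real k + 1) (leg p k - [:0, 1:] * leg p (Suc k))"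
  using poly_leg_structure[OF assms, of _ k]
  by (simp flip: poly_eq_poly_eq_iff add: fun_eq_iff poly_monom)

section \<open>Leading coefficients and orthogonality\<close>

lemma degree_leg_le: "degree (leg p k) \<le> k"
proof (induction p k rule: leg.induct)
  case (3 p k)
  show ?case
    using 3 by (auto intro!: degree_diff_le order.trans[OF degree_smult_le]
      order.trans[OF degree_mult_le] simp del: mult_pCons_left)
qed auto

lemma coeff_leg_pos:
  assumes "p \<ge> 2"
  shows "coeff (leg p k) k > 0"
  using assms
proof (induction p k rule: leg.induct)
  case (3 p k)
  then have "coeff (leg p k) (Suc (Suc k)) = 0"
    by (intro coeff_eq_0) (use degree_leg_le[of p k] in linarith)
  with 3 show ?case by (auto intro!: divide_pos_pos mult_pos_pos)
qed auto

text \<open>Integration by parts and the structure relation give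
  \<open>(p + k) * zmean (x * leg (k + 1)) = (k + 1) * zmean (leg k)\<close>. In the recurrence for
  \<open>leg (k + 2)\<close> both means then vanish by induction if \<open>k > 0\<close>, and the
  two contributions cancel if \<open>k = 0\<close>.\<close>

lemma zmean_leg:
  assumes "p \<ge> 2"
  shows "zmean p (leg p (Suc k)) = 0"
proof (induction k rule: less_induct)
  case (less n)
  show ?case
  proof (cases n)
    case 0
    then show ?thesis by (simp add: zmean_def)
  next
    case (Suc k)
    have *: "(real p + real k) * zmean p ([:0, 1:] * leg p (Suc k)) = (real k + 1) * zmean p (leg p k)"
      using zmean_ibp[OF assms, of "leg p (Suc k)"]
      unfolding leg_structure[OF assms] zmean_smult zmean_diff by (simp add: algebra_simps)
    have "(real p + real k - 1) * zmean p (leg p (Suc (Suc k))) =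
      (2 * real k + real p) * zmean p ([:0, 1:] * leg p (Suc k)) - (real k + 1) * zmean p (leg p k)"
      using arg_cong[OF leg_rec[OF assms, of k], of "zmean p"] by (simp only: zmean_smult zmean_diff)
    also have "\<dots> = 0"
    proof (cases k)
      case 0
      then show ?thesis using * by simp
    next
      case (Suc j)
      then have "zmean p (leg p k) = 0"
        using less.IH[of j] \<open>n = Suc k\<close> by simp
      moreover have "real p + real k \<noteq> 0" using assms by simp
      ultimately have "zmean p ([:0, 1:] * leg p (Suc k)) = 0" using * by simp
      with \<open>zmean p (leg p k) = 0\<close> show ?thesis by simp
    qed
    finally show ?thesis using assms by (simp del: leg.simps add: Suc)
  qed
qed

text \<open>The recurrence moves one factor of the variable from the monomial onto
  \<open>leg p k\<close>. The degree \<open>k\<close> changes by one in either direction while the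
  exponent drops by one, so the induction hypothesis covers both terms.\<close>

lemma zmean_monom_leg:
  assumes "p \<ge> 2" "m < k"
  shows "zmean p (monom 1 m * leg p k) = 0"
  using assms(2)
proof (induction m arbitrary: k)
  case 0
  then obtain j where "k = Suc j" by (cases k) auto
  then show ?case using zmean_leg[OF assms(1)] by (simp add: monom_0 one_pCons[symmetric])
next
  case (Suc m)
  then obtain j where k: "k = Suc j" and "m < j" by (cases k) auto
  have "(2 * real j + real p) * zmean p (monom 1 (Suc m) * leg p k) =
      zmean p (monom 1 m * smult (2 * real j + real p) ([:0, 1:] * leg p (Suc j)))"
    by (simp del: leg.simps add: k monom_Suc flip: zmean_smult)
  also have "\<dots> = 0"
    unfolding x_leg[OF assms(1)] distrib_left zmean_add mult_smult_right zmean_smult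
    using \<open>m < j\<close> by (simp del: leg.simps add: Suc.IH)
  finally show ?case using assms by simp
qed

lemma zmean_orthogonal:
  assumes "p \<ge> 2" "degree g < k"
  shows "zmean p (g * leg p k) = 0"
proof -
  have "zmean p (g * leg p k) = zmean p (\<Sum>i\<le>degree g. smult (coeff g i) (monom 1 i * leg p k))"
    by (subst poly_as_sum_of_monoms[of g, symmetric])
      (simp add: sum_distrib_right smult_monom flip: mult_smult_left)
  also have "\<dots> = 0"
    using assms by (auto simp: zmean_sum zmean_smult zmean_monom_leg intro!: sum.neutral)
  finally show ?thesis .
qed

lemma zmean_leg_leg:
  assumes "p \<ge> 2" "k \<noteq> l"
  shows "zmean p (leg p k * leg p l) = 0"
proof (cases "k < l")
  case True
  then show ?thesis using degree_leg_le[of p k] by (intro zmean_orthogonal assms) auto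
next
  case False
  then show ?thesis
    using degree_leg_le[of p l] assms by (subst mult.commute) (intro zmean_orthogonal, auto)
qed

lemma poly_eq_sum_leg:
  assumes "p \<ge> 2" "degree g \<le> n"
  obtains c where "g = (\<Sum>k\<le>n. smult (c k) (leg p k))"
proof -
  have "\<exists>c. g = (\<Sum>k\<le>n. smult (c k) (leg p k))"
    using assms(2)
  proof (induction n arbitrary: g)
    case 0
    then obtain a where "g = [:a:]" by (auto dest: degree0_coeffs)
    then show ?case by (intro exI[of _ "\<lambda>_. a"]) simp
  next
    case (Suc n)
    define a where "a = coeff g (Suc n) / coeff (leg p (Suc n)) (Suc n)"
    have "coeff (leg p (Suc n)) (Suc n) \<noteq> 0" using coeff_leg_pos[OF assms(1), of "Suc n"] by simp
    then have "coeff (g - smult a (leg p (Suc n))) (Suc n) = 0" by (simp add: a_def)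
    moreover have "degree (g - smult a (leg p (Suc n))) \<le> Suc n"
      using Suc.prems degree_leg_le[of p "Suc n"] by (intro degree_diff_le) (auto intro: order.trans[OF degree_smult_le])
    ultimately have "degree (g - smult a (leg p (Suc n))) \<le> n"
      by (metis degree_0 eq_zero_or_degree_less le_SucE le_antisym less_Suc_eq_le zero_le leading_coeff_0_iff)
    from Suc.IH[OF this] obtain c where c: "g - smult a (leg p (Suc n)) = (\<Sum>k\<le>n. smult (c k) (leg p k))" ..
    have "g = (\<Sum>k\<le>Suc n. smult ((c(Suc n := a)) k) (leg p k))"
      using c by (simp add: algebra_simps)
    then show ?case by blast
  qed
  then show thesis using that by blast
qed

section \<open>Dimensions and squared norms\<close>

lemma harm_dim_Suc:
  assumes "p \<ge> 2"
  shows "real (harm_dim p (Suc k)) = real ((p + k - 2) choose (p - 2)) * (2 * real k + real p) / (real k + 1)"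
    and "(real k + 1) * real ((p + k - 1) choose (p - 2)) = (real p + real k - 1) * real ((p + k - 2) choose (p - 2))"
proof -
  obtain r where p: "p = r + 2" using assms by (metis add.commute le_Suc_ex)
  have "Suc k * ((r + Suc k) choose r) = (r + Suc k) * ((r + k) choose r)"
    using binomial_absorb_comp[of "r + Suc k" r] by simp
  then have *: "(real k + 1) * real ((r + Suc k) choose r) = (real r + real k + 1) * real ((r + k) choose r)"
    by (metis (mono_tags, lifting) add.assoc add.commute of_nat_Suc of_nat_add of_nat_mult)
  then show "(real k + 1) * real ((p + k - 1) choose (p - 2)) = (real p + real k - 1) * real ((p + k - 2) choose (p - 2))"
    by (simp add: p algebra_simps)
  show "real (harm_dim p (Suc k)) = real ((p + k - 2) choose (p - 2)) * (2 * real k + real p) / (real k + 1)"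
    using * by (simp add: harm_dim_def p field_simps)
qed

text \<open>The ratio of consecutive dimensions, with denominators cleared; in
  \<open>zmean_leg_square\<close> it is matched against the ratio of consecutive squared
  norms.\<close>

lemma harm_dim_rec:
  assumes "p \<ge> 2"
  shows "(real k + 2) * (2 * real k + real p) * real (harm_dim p (Suc (Suc k))) =
    (real k + real p - 1) * (2 * real k + real p + 2) * real (harm_dim p (Suc k))"
proof -
  have *: "real ((p + Suc k - 2) choose (p - 2)) = (real p + real k - 1) * real ((p + k - 2) choose (p - 2)) / (real k + 1)"
    using harm_dim_Suc(2)[OF assms, of k] by (simp add: field_simps)
  show ?thesis
    unfolding harm_dim_Suc(1)[OF assms] * by (simp add: divide_simps) (simp add: algebra_simps)
qed

lemma harm_dim_pos: "p \<ge> 2 \<Longrightarrow> k \<ge> 1 \<Longrightarrow> harm_dim p k > 0"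
  unfolding harm_dim_def by (intro add_nonneg_pos zero_less_binomial) auto

text \<open>The mean of \<open>x * leg (k + 1) * leg (k + 2)\<close> is computed in two ways, by
  expanding \<open>x\<close> times either factor. Orthogonality leaves one squared norm in each
  expansion, and the resulting ratio is the inverse of the one in
  \<open>harm_dim_rec\<close>.\<close>

lemma zmean_leg_square:
  assumes "p \<ge> 2"
  shows "zmean p (leg p (Suc k) * leg p (Suc k)) = 1 / real (harm_dim p (Suc k))"
proof (induction k)
  case 0
  have "leg p (Suc 0) * leg p (Suc 0) = monom 1 2"
    by (simp add: monom_altdef power2_eq_square)
  then have "zmean p (leg p (Suc 0) * leg p (Suc 0)) = zmom p (Suc (Suc 0))"
    by (simp only: zmean_monom numeral_2_eq_2 mult_1)
  then show ?case using assms by (simp add: harm_dim_Suc(1))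
next
  case (Suc k)
  define N where "N j = zmean p (leg p j * leg p j)" for j
  define Z where "Z = zmean p ([:0, 1:] * leg p (Suc k) * leg p (Suc (Suc k)))"
  have "zmean p (smult (real p + real k - 1) (leg p (Suc (Suc k))) * leg p (Suc (Suc k))) =
    (2 * real k + real p) * Z - (real k + 1) * zmean p (leg p k * leg p (Suc (Suc k)))"
    unfolding leg_rec[OF assms] left_diff_distrib zmean_diff mult_smult_left zmean_smult Z_def by simp
  then have 1: "(real p + real k - 1) * N (Suc (Suc k)) = (2 * real k + real p) * Z"
    using zmean_leg_leg[OF assms, of k "Suc (Suc k)"] by (simp del: leg.simps add: N_def zmean_smult)
  have "zmean p (smult (2 * real (Suc k) + real p) ([:0, 1:] * leg p (Suc (Suc k))) * leg p (Suc k)) =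
    (real p + real (Suc k) - 1) * zmean p (leg p (Suc (Suc (Suc k))) * leg p (Suc k)) + (real (Suc k) + 1) * N (Suc k)"
    unfolding x_leg[OF assms] distrib_right zmean_add mult_smult_left zmean_smult N_def by simp
  also have "[:0, 1:] * leg p (Suc (Suc k)) = leg p (Suc (Suc k)) * [:0, 1:]" by (rule mult.commute)
  also have "zmean p (smult (2 * real (Suc k) + real p) (leg p (Suc (Suc k)) * [:0, 1:]) * leg p (Suc k)) =
     (2 * real (Suc k) + real p) * Z"
    unfolding Z_def mult_smult_left zmean_smult by (simp only: ac_simps)
  finally have 2: "(2 * real k + real p + 2) * Z = (real k + 2) * N (Suc k)"
    using zmean_leg_leg[OF assms, of "Suc (Suc (Suc k))" "Suc k"] by (simp del: leg.simps add: algebra_simps)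
  have pos: "real (harm_dim p (Suc k)) > 0" "real (harm_dim p (Suc (Suc k))) > 0"
    using harm_dim_pos[OF assms] by auto
  have N: "N (Suc k) = 1 / real (harm_dim p (Suc k))" using Suc by (simp only: N_def)
  have "real p + real k - 1 > 0" "2 * real k + real p + 2 > 0" "2 * real k + real p > 0" using assms by auto
  then have "N (Suc (Suc k)) = (2 * real k + real p) * Z / (real p + real k - 1)"
    and Z: "Z = (real k + 2) * N (Suc k) / (2 * real k + real p + 2)"
    using 1 2 by (simp_all add: eq_divide_eq mult.commute)
  then have "N (Suc (Suc k)) = (2 * real k + real p) * ((real k + 2) * (1 / real (harm_dim p (Suc k))) / (2 * real k + real p + 2)) / (real p + real k - 1)"
    by (simp only: N)
  also have "\<dots> = 1 / real (harm_dim p (Suc (Suc k)))"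
    using harm_dim_rec[OF assms, of k] pos \<open>real p + real k - 1 > 0\<close> \<open>2 * real k + real p + 2 > 0\<close>
    by (simp add: divide_simps) (simp add: algebra_simps)
  finally show ?case by (simp only: N_def)
qed

lemma poly_leg_1: 
  assumes "p \<ge> 2"
  shows "poly (leg p k) 1 = 1"
  using assms by (induction p k rule: leg.induct) (auto simp: field_simps)

section \<open>Relation to the Gegenbauer coefficients\<close>

definition gegen_term :: "real \<Rightarrow> nat \<Rightarrow> nat \<Rightarrow> real" where
  "gegen_term lam q j = (if 2 * j \<le> q then (-1) ^ j * gegen_coeff lam q j else 0)"

text \<open>Padding with zeros gives the three degrees of a recurrence a common summation range. The
  pair \<open>lam = 0\<close>, \<open>q = 0\<close> is excluded because the coefficient formula
  gives 0 there, whereas the polynomial is 1 by convention.\<close>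

lemma gegen_poly_altdef:
  assumes "q div 2 < N" "lam \<noteq> 0 \<or> q \<noteq> 0"
  shows "gegen_poly lam q t = (\<Sum>j<N. gegen_term lam q j * t ^ (q - 2 * j))"
proof -
  have "gegen_poly lam q t = (\<Sum>j = 0..q div 2. gegen_term lam q j * t ^ (q - 2 * j))"
    unfolding gegen_poly_def using assms(2) by (auto simp: gegen_term_def intro!: sum.cong)
  also have "\<dots> = (\<Sum>j<N. gegen_term lam q j * t ^ (q - 2 * j))"
    using assms(1) by (intro sum.mono_neutral_left) (auto simp: gegen_term_def)
  finally show ?thesis .
qed

text \<open>The part of the coefficients that obeys the same recurrence for \<open>lam = 0\<close> and \<open>lam > 0\<close>.\<close>

definition gegen_core :: "real \<Rightarrow> nat \<Rightarrow> nat \<Rightarrow> real" where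
  "gegen_core lam q j = (if 2 * j \<le> q
     then (-1) ^ j * 2 ^ (q - 2 * j) * Gamma (real q - real j + lam) / (fact j * fact (q - 2 * j)) else 0)"

lemma gegen_term_eq_gegen_core:
  "gegen_term lam q j = (if lam = 0 then real q / 2 else 1 / Gamma lam) * gegen_core lam q j"
proof (cases "2 * j \<le> q")
  case True
  then obtain r where "q = r + 2 * j" by (metis add.commute le_Suc_ex)
  then show ?thesis
    by (simp add: gegen_term_def gegen_core_def gegen_coeff_def power_int_diff)
qed (simp add: gegen_term_def gegen_core_def)

text \<open>The three coefficients are multiples of one quantity: those of degrees
  \<open>k + 1\<close> and \<open>k\<close> contain \<open>Gamma X\<close> with the same
  \<open>X\<close>, that of degree \<open>k + 2\<close> contains \<open>Gamma (X + 1)\<close>. For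
  \<open>lam = 0\<close> and \<open>k = 0\<close> the argument \<open>X\<close> can be 0, a pole of
  \<open>Gamma\<close>; the second assumption excludes this.\<close>

lemma gegen_core_rec:
  assumes "lam \<ge> 0" "lam > 0 \<or> k > 0"
  shows "(real k + 2) * gegen_core lam (Suc (Suc k)) j =
    2 * (real k + 1 + lam) * gegen_core lam (Suc k) j
      - (real k + 2 * lam) * (case j of 0 \<Rightarrow> 0 | Suc i \<Rightarrow> gegen_core lam k i)"
proof (cases "2 * j \<le> Suc (Suc k)")
  case False
  then show ?thesis by (auto simp: gegen_core_def split: nat.splits)
next
  case True
  then obtain r where r: "Suc (Suc k) = r + 2 * j" by (metis add.commute le_Suc_ex)
  then have k: "real k = real r + 2 * real j - 2" by linarith
  define X where "X = real r + real j - 1 + lam"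
  have X: "X > 0"
  proof (cases "k = 0")
    case True
    moreover have "r + j \<ge> 1" using r by (cases r; cases j; simp)
    ultimately show ?thesis using assms unfolding X_def by linarith
  next
    case False
    then have "real r + real j > 1" using r by (cases r; cases j; simp)
    then show ?thesis using assms unfolding X_def by linarith
  qed
  then have "X \<notin> \<int>\<^sub>\<le>\<^sub>0" by (auto elim!: nonpos_Ints_cases)
  then have G: "Gamma (real j + real r + lam) = X * Gamma X"
    using Gamma_plus1[of X] by (simp add: X_def add_ac)
  define A where "A = (-1) ^ j * 2 ^ r * Gamma X / (fact j * fact r)"
  have 1: "gegen_core lam (Suc (Suc k)) j = A * X"
    unfolding r by (simp add: gegen_core_def G A_def)
  have 2: "2 * gegen_core lam (Suc k) j = A * real r"
  proof (cases r)
    case 0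
    then show ?thesis using r by (simp add: gegen_core_def)
  next
    case (Suc s)
    then have "Suc k = s + 2 * j" using r by simp
    moreover have "real j + real s + lam = X" by (simp add: X_def Suc)
    ultimately show ?thesis
      by (simp add: gegen_core_def A_def Suc divide_simps)
  qed
  have 3: "(case j of 0 \<Rightarrow> 0 | Suc i \<Rightarrow> gegen_core lam k i) = - A * real j"
  proof (cases j)
    case 0
    then show ?thesis by simp
  next
    case (Suc i)
    then have "k = r + 2 * i" using r by simp
    moreover have "real i + real r + lam = X" by (simp add: X_def Suc)
    ultimately show ?thesis
      by (simp add: gegen_core_def A_def Suc divide_simps)
  qed
  have "(real k + 2) * X = (real k + 1 + lam) * real r + (real k + 2 * lam) * real j"
    by (simp add: k X_def algebra_simps)
  then have "A * ((real k + 2) * X) = A * ((real k + 1 + lam) * real r + (real k + 2 * lam) * real j)"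
    by simp
  moreover have "2 * (real k + 1 + lam) * gegen_core lam (Suc k) j = (real k + 1 + lam) * (A * real r)"
    unfolding 2[symmetric] by simp
  ultimately show ?thesis
    unfolding 1 3 by (simp add: algebra_simps)
qed

lemma gegen_term_rec:
  assumes "lam > 0"
  shows "(real k + 2) * gegen_term lam (Suc (Suc k)) j =
    2 * (real k + 1 + lam) * gegen_term lam (Suc k) j
      - (real k + 2 * lam) * (case j of 0 \<Rightarrow> 0 | Suc i \<Rightarrow> gegen_term lam k i)"
  using arg_cong[OF gegen_core_rec[of lam k j], of "\<lambda>x. x / Gamma lam"] assms
  by (simp add: gegen_term_eq_gegen_core diff_divide_distrib split: nat.splits)

lemma gegen_term_0_rec:
  assumes "k > 0"
  shows "gegen_term 0 (Suc (Suc k)) j =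
    2 * gegen_term 0 (Suc k) j - (case j of 0 \<Rightarrow> 0 | Suc i \<Rightarrow> gegen_term 0 k i)"
  using arg_cong[OF gegen_core_rec[of 0 k j], of "\<lambda>x. x / 2"] assms
  by (simp add: gegen_term_eq_gegen_core diff_divide_distrib add.commute[of 2] add.commute[of 1] split: nat.splits)

lemma gegen_poly_rec_aux:
  assumes "\<And>j. a * gegen_term lam (Suc (Suc k)) j =
    b * gegen_term lam (Suc k) j - c * (case j of 0 \<Rightarrow> 0 | Suc i \<Rightarrow> gegen_term lam k i)"
    and "lam \<noteq> 0 \<or> k \<noteq> 0"
  shows "a * gegen_poly lam (Suc (Suc k)) t = b * (t * gegen_poly lam (Suc k) t) - c * gegen_poly lam k t"
proof -
  define N where "N = k + 2"
  define h where "h j = (case j of 0 \<Rightarrow> 0 | Suc i \<Rightarrow> gegen_term lam k i)" for j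
  have "a * gegen_poly lam (Suc (Suc k)) t =
    (\<Sum>j<Suc N. (a * gegen_term lam (Suc (Suc k)) j) * t ^ (Suc (Suc k) - 2 * j))"
    by (subst gegen_poly_altdef[of _ "Suc N"]) (auto simp: N_def sum_distrib_left mult.assoc simp del: sum.lessThan_Suc)
  also have "\<dots> = b * (\<Sum>j<Suc N. gegen_term lam (Suc k) j * t ^ (Suc (Suc k) - 2 * j)) -
      c * (\<Sum>j<Suc N. h j * t ^ (Suc (Suc k) - 2 * j))"
    unfolding assms(1) h_def[symmetric] sum_distrib_left sum_subtractf[symmetric]
    by (rule sum.cong) (auto simp: algebra_simps)
  \<comment> \<open>Where the truncated subtraction would break the exponent law,
    \<open>gegen_term\<close> is zero.\<close>
  also have "(\<Sum>j<Suc N. gegen_term lam (Suc k) j * t ^ (Suc (Suc k) - 2 * j)) =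
      (\<Sum>j<Suc N. t * (gegen_term lam (Suc k) j * t ^ (Suc k - 2 * j)))"
    by (rule sum.cong) (auto simp: gegen_term_def Suc_diff_le)
  also have "\<dots> = t * gegen_poly lam (Suc k) t"
    unfolding sum_distrib_left[symmetric]
    by (subst gegen_poly_altdef[of _ "Suc N"]) (auto simp: N_def simp del: sum.lessThan_Suc)
  \<comment> \<open>The shift of \<open>j\<close> by one absorbs two powers of \<open>t\<close> and
    so brings the degree down from \<open>k + 2\<close> to \<open>k\<close>.\<close>
  also have "(\<Sum>j<Suc N. h j * t ^ (Suc (Suc k) - 2 * j)) = (\<Sum>j<N. gegen_term lam k j * t ^ (k - 2 * j))"
    by (subst sum.lessThan_Suc_shift) (simp add: h_def)
  also have "\<dots> = gegen_poly lam k t"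
    by (subst gegen_poly_altdef[of _ "N"]) (use assms(2) in \<open>auto simp: N_def simp del: sum.lessThan_Suc\<close>)
  finally show ?thesis .
qed

lemma gegen_poly_rec:
  assumes "lam > 0"
  shows "(real k + 2) * gegen_poly lam (Suc (Suc k)) t =
    2 * (real k + 1 + lam) * (t * gegen_poly lam (Suc k) t) - (real k + 2 * lam) * gegen_poly lam k t"
  by (rule gegen_poly_rec_aux[OF gegen_term_rec]) (use assms in auto)

lemma gegen_poly_0_rec:
  assumes "k > 0"
  shows "gegen_poly 0 (Suc (Suc k)) t = 2 * (t * gegen_poly 0 (Suc k) t) - gegen_poly 0 k t"
  using gegen_poly_rec_aux[of 1 0 k 2 1 t] gegen_term_0_rec[OF assms] assms by simp

text \<open>This is the value of the Gegenbauer polynomial at 1, as \<open>gegen_poly_eq_leg\<close>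
  and \<open>poly_leg_1\<close> show. Writing it through \<open>harm_dim\<close> builds in the
  normalisation of the kernel: the prefactor of \<open>sobolev_kernel\<close> times this value is
  the dimension.\<close>

definition gegen_at_1 :: "nat \<Rightarrow> nat \<Rightarrow> real" where
  "gegen_at_1 p k = (if k = 0 then 1 else real (harm_dim p k) / (if p = 2 then 2 else 1 + 2 * real k / (real p - 2)))"

lemma gegen_at_1_pos: "p \<ge> 2 \<Longrightarrow> gegen_at_1 p k > 0"
  using harm_dim_pos[of p k] by (auto simp: gegen_at_1_def intro!: divide_pos_pos add_pos_nonneg)

lemma harm_dim_2: "harm_dim 2 (Suc k) = 2"
  by (simp add: harm_dim_def)

lemma gegen_at_1_Suc:
  assumes "p \<ge> 3"
  shows "(real k + 1) * gegen_at_1 p (Suc k) = (real k + (real p - 2)) * gegen_at_1 p k"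
proof (cases k)
  case 0
  have "harm_dim p 1 = p" using harm_dim_Suc(1)[of p 0] assms by simp
  then show ?thesis using assms 0 by (simp add: gegen_at_1_def field_simps)
next
  case (Suc j)
  have ne: "real p - 2 > 0" using assms by simp
  have g: "gegen_at_1 p (Suc i) = (real p - 2) * real (harm_dim p (Suc i)) / (2 * real i + real p)" for i
    using assms ne by (simp add: gegen_at_1_def field_simps)
  have "2 * real j + real p > 0" using assms by simp
  moreover have "2 * real j + real p + 2 > 0" using assms by simp
  moreover have "(real j + 2) * (2 * real j + real p) * real (harm_dim p (Suc (Suc j))) =
    (real j + real p - 1) * (2 * real j + real p + 2) * real (harm_dim p (Suc j))"
    using harm_dim_rec[of p j] assms by simp
  ultimately show ?thesis
    unfolding Suc g using ne by (simp add: divide_simps) (simp add: algebra_simps)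
qed

text \<open>Up to the rescaling by \<open>gegen_at_1\<close>, both sides obey the same three-term
  recurrence. For \<open>p = 2\<close> the recurrence of \<open>gegen_poly\<close> starts only at
  degree 3, because the value in degree 0 is a convention, and degree 2 is computed by hand.\<close>

lemma gegen_poly_eq_leg:
  assumes "p \<ge> 2"
  shows "gegen_poly (gegen_index p) k t = gegen_at_1 p k * poly (leg p k) t"
proof (cases "p = 2")
  case True
  have "gegen_poly 0 k t = poly (leg 2 k) t"
  proof (induction k rule: less_induct)
    case (less n)
    consider "n = 0" | "n = 1" | "n = 2" | k where "n = Suc (Suc k)" "k > 0"
      by (metis One_nat_def gr0I not0_implies_Suc numeral_2_eq_2)
    then show ?case
    proof cases
      case 4
      have "(real k + 1) * poly (leg 2 n) t = (real k + 1) * (2 * t * poly (leg 2 (Suc k)) t - poly (leg 2 k) t)"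
        using poly_leg_rec[of 2 k t] by (simp add: 4 algebra_simps del: leg.simps)
      then have "poly (leg 2 n) t = 2 * t * poly (leg 2 (Suc k)) t - poly (leg 2 k) t"
        by simp
      then show ?thesis
        using less.IH[of k] less.IH[of "Suc k"] gegen_poly_0_rec[of k t] 4
        by (simp del: leg.simps)
    next
      case 3
      have "gegen_poly 0 2 t = 2 * t\<^sup>2 - 1"
        by (simp add: gegen_poly_def gegen_coeff_def Gamma_numeral)
      moreover have "poly (leg 2 (Suc (Suc 0))) t = 2 * t\<^sup>2 - 1"
        by (simp add: power2_eq_square)
      ultimately show ?thesis by (simp only: 3 numeral_2_eq_2)
    qed (simp_all add: gegen_poly_def gegen_coeff_def)
  qed
  moreover have "gegen_at_1 2 k = 1" by (cases k) (auto simp: gegen_at_1_def harm_dim_2)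
  ultimately show ?thesis using True by (simp add: gegen_index_def)
next
  case False
  define lam where "lam = gegen_index p"
  have lam: "lam > 0" "2 * lam = real p - 2" and p: "p \<ge> 3" "real p > 2"
    using False assms by (auto simp: lam_def gegen_index_def)
  have "gegen_poly lam k t = gegen_at_1 p k * poly (leg p k) t"
  proof (induction k rule: less_induct)
    case (less n)
    consider "n = 0" | "n = 1" | k where "n = Suc (Suc k)"
      by (metis One_nat_def not0_implies_Suc)
    then show ?case
    proof cases
      case 1
      have "Gamma lam \<noteq> 0" using Gamma_real_pos[OF lam(1)] by linarith
      then show ?thesis using 1 lam(1)
        by (simp add: less_imp_neq[symmetric] gegen_poly_def gegen_coeff_def gegen_at_1_def)
    next
      case 2
      have "Gamma lam \<noteq> 0" using Gamma_real_pos[OF lam(1)] by linarith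
      moreover have "lam \<notin> \<int>\<^sub>\<le>\<^sub>0" using lam by (auto elim!: nonpos_Ints_cases)
      ultimately have "gegen_poly lam 1 t = 2 * lam * t" using lam Gamma_plus1[of lam]
        by (simp add: gegen_poly_def gegen_coeff_def add.commute)
      then show ?thesis using 2 gegen_at_1_Suc[OF p(1), of 0] lam by (simp add: gegen_at_1_def)
    next
      case 3
      have s2: "(real k + 2) * gegen_at_1 p n = (real k + 1 + (real p - 2)) * gegen_at_1 p (Suc k)"
        using gegen_at_1_Suc[OF p(1), of "Suc k"] 3 by (simp add: algebra_simps)
      have s1: "(real k + 1) * gegen_at_1 p (Suc k) = (real k + (real p - 2)) * gegen_at_1 p k"
        using gegen_at_1_Suc[OF p(1), of "k"] 3 by (simp add: algebra_simps)
      have "(real k + 2) * gegen_poly lam n t =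
        (2 * real k + real p) * (t * (gegen_at_1 p (Suc k) * poly (leg p (Suc k)) t)) - (real k + (real p - 2)) * (gegen_at_1 p k * poly (leg p k) t)"
      proof -
        have c: "2 * (real k + 1 + lam) = 2 * real k + real p" "real k + 2 * lam = real k + (real p - 2)"
          using lam(2) by auto
        show ?thesis
          using gegen_poly_rec[OF lam(1), of k t] less.IH[of k] less.IH[of "Suc k"]
          unfolding c 3 by simp
      qed
      also have "\<dots> = gegen_at_1 p (Suc k) * ((2 * real k + real p) * (t * poly (leg p (Suc k)) t) - (real k + 1) * poly (leg p k) t)"
        unfolding mult.assoc[symmetric] s1[symmetric] by (simp del: leg.simps add: algebra_simps)
      also have "\<dots> = gegen_at_1 p (Suc k) * ((real p + real k - 1) * poly (leg p n) t)"
        unfolding 3 poly_leg_rec[OF assms] ..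
      also have "\<dots> = (real k + 2) * gegen_at_1 p n * poly (leg p n) t"
        unfolding s2 by (simp del: leg.simps add: algebra_simps)
      finally show ?thesis by (simp del: leg.simps)
    qed
  qed
  then show ?thesis by (simp add: lam_def)
qed

lemma sobolev_kernel_eq_leg:
  assumes "p \<ge> 2" "k \<ge> 1"
  shows "sobolev_kernel p k s = real (harm_dim p k) * poly (leg p k) s"
proof (cases "p = 2")
  case True
  obtain j where "k = Suc j" using assms(2) by (cases k) auto
  then show ?thesis
    using gegen_poly_eq_leg[of 2 k s] assms True
    by (simp add: sobolev_kernel_def gegen_at_1_def harm_dim_2 gegen_index_def del: leg.simps)
next
  case False
  then have "1 + 2 * real k / (real p - 2) > 0" using assms by (intro add_pos_nonneg) auto
  then show ?thesis
    using gegen_poly_eq_leg[OF assms(1), of k s] assms False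
    by (simp add: sobolev_kernel_def gegen_at_1_def)
qed

section \<open>The constants of the statement in terms of \<open>zmean\<close>\<close>

lemma t_const_sq:
  assumes "p \<ge> 2" "k \<ge> 1"
  shows "(t_const p k)\<^sup>2 = real (harm_dim p k) / (gegen_at_1 p k)\<^sup>2"
proof -
  obtain j where "k = Suc j" using assms(2) by (cases k) auto
  moreover have "real (harm_dim p k) > 0" using harm_dim_pos[OF assms] by simp
  ultimately show ?thesis
    using assms by (auto simp: t_const_def gegen_at_1_def harm_dim_2 power2_eq_square divide_simps)
qed

lemma zmean_leg_square_pos:
  assumes "p \<ge> 2"
  shows "zmean p (leg p k * leg p k) > 0"
  using zmean_leg_square[OF assms] harm_dim_pos[OF assms] by (cases k) (auto simp del: leg.simps(2,3))

text \<open>Pairing an expansion with \<open>leg p k\<close> isolates its coordinate of index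
  \<open>k\<close>. This proves uniqueness, which resolves the definite description, and computes
  the coordinate at once; existence comes from \<open>poly_eq_sum_leg\<close>.\<close>

lemma monomial_coeff_eq:
  assumes "p \<ge> 2" "k \<le> i"
  shows "monomial_coeff p k i * gegen_at_1 p k = zmean p (monom 1 i * leg p k) / zmean p (leg p k * leg p k)"
proof -
  define Q where "Q m \<longleftrightarrow> (\<forall>t :: real. t ^ i = (\<Sum>l = 0..i. m l * gegen_poly (gegen_index p) l t)) \<and> (\<forall>l > i. m l = 0)"
    for m :: "nat \<Rightarrow> real"
  have coeff: "m k * gegen_at_1 p k = zmean p (monom 1 i * leg p k) / zmean p (leg p k * leg p k)"
    if "Q m" "k \<le> i" for m k
  proof -
    have "monom 1 i = (\<Sum>l\<le>i. smult (m l * gegen_at_1 p l) (leg p l))"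
      using that(1) unfolding Q_def gegen_poly_eq_leg[OF assms(1)]
      by (simp flip: poly_eq_poly_eq_iff add: fun_eq_iff poly_monom poly_sum atLeast0AtMost mult.assoc)
    then have "zmean p (monom 1 i * leg p k) = (\<Sum>l\<le>i. m l * gegen_at_1 p l * zmean p (leg p l * leg p k))"
      by (simp add: sum_distrib_right zmean_sum zmean_smult)
    also have "\<dots> = (\<Sum>l\<le>i. if l = k then m k * gegen_at_1 p k * zmean p (leg p k * leg p k) else 0)"
      using zmean_leg_leg[OF assms(1)] by (intro sum.cong) auto
    also have "\<dots> = m k * gegen_at_1 p k * zmean p (leg p k * leg p k)" using that by simp
    finally show ?thesis using zmean_leg_square_pos[OF assms(1), of k] by (simp add: field_simps)
  qed
  obtain c where c: "monom 1 i = (\<Sum>k\<le>i. smult (c k) (leg p k))"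
    using poly_eq_sum_leg[OF assms(1) degree_monom_le] by blast
  have "Q (\<lambda>l. if l \<le> i then c l / gegen_at_1 p l else 0)"
    unfolding Q_def
  proof (intro conjI allI impI)
    fix t :: real
    have "gegen_at_1 p l \<noteq> 0" for l using gegen_at_1_pos[OF assms(1), of l] by simp
    then show "t ^ i = (\<Sum>l = 0..i. (if l \<le> i then c l / gegen_at_1 p l else 0) * gegen_poly (gegen_index p) l t)"
      using arg_cong[OF c, of "\<lambda>P. poly P t"]
      by (simp add: poly_monom poly_sum gegen_poly_eq_leg[OF assms(1)] atLeast0AtMost)
  qed auto
  moreover have "m = m'" if "Q m" "Q m'" for m m'
  proof
    fix l show "m l = m' l"
    proof (cases "l \<le> i")
      case True
      then have "m l * gegen_at_1 p l = m' l * gegen_at_1 p l"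
        using coeff[OF that(1)] coeff[OF that(2)] by simp
      then show ?thesis using gegen_at_1_pos[OF assms(1), of l] by simp
    qed (use that in \<open>auto simp: Q_def\<close>)
  qed
  ultimately have "Q (THE m. Q m)" by (metis theI)
  from coeff[OF this assms(2)] show ?thesis
    unfolding monomial_coeff_def Q_def .
qed

text \<open>The working form of the parameter: \<open>zmean p (monom 1 i * leg p k)\<close> is the
  factor that appears in the limiting means of the harmonics of degree \<open>k\<close>.\<close>

lemma noncentrality_eq:
  assumes "p \<ge> 2" "1 \<le> k" "k \<le> i"
  shows "noncentrality p f k i \<tau> =
    real (harm_dim p k) * (zmean p (monom 1 i * leg p k))\<^sup>2 * (nth_deriv i f 0 / fact i)\<^sup>2 * \<tau> ^ (2 * i)"
proof -
  define d where "d = real (harm_dim p k)"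
  have d: "d > 0" using harm_dim_pos assms by (simp add: d_def)
  obtain j where "k = Suc j" using assms by (cases k) auto
  then have "zmean p (leg p k * leg p k) = 1 / d" using zmean_leg_square[OF assms(1)] by (simp only: d_def)
  then have m: "monomial_coeff p k i = zmean p (monom 1 i * leg p k) * d / gegen_at_1 p k"
    using monomial_coeff_eq[OF assms(1,3)] gegen_at_1_pos[OF assms(1), of k] by (simp add: field_simps)
  have t: "(t_const p k)\<^sup>2 = d / (gegen_at_1 p k)\<^sup>2" using t_const_sq assms by (simp add: d_def)
  show ?thesis
    unfolding noncentrality_def d_def[symmetric] m t
    using gegen_at_1_pos[OF assms(1), of k] d by (simp add: power_divide power_mult_distrib) (simp add: power2_eq_square)
qed

text \<open>With \<open>zmom\<close> identified with \<open>moment\<close>, the left-hand side is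
  the sum in the second formula for the non-centrality parameter.\<close>

lemma zmean_gegen_poly:
  assumes "p \<ge> 2" "k \<ge> 1"
  shows "(\<Sum>j = 0..k div 2. (-1) ^ j * gegen_coeff (gegen_index p) k j * zmom p (k + i - 2 * j)) =
    gegen_at_1 p k * zmean p (monom 1 i * leg p k)"
proof -
  have "smult (gegen_at_1 p k) (leg p k) = (\<Sum>j = 0..k div 2. monom ((-1) ^ j * gegen_coeff (gegen_index p) k j) (k - 2 * j))"
    using gegen_poly_eq_leg[OF assms(1), of k, symmetric] assms(2)
    by (simp flip: poly_eq_poly_eq_iff add: fun_eq_iff poly_monom poly_sum gegen_poly_def)
  then have "zmean p (monom 1 i * smult (gegen_at_1 p k) (leg p k)) =
     (\<Sum>j = 0..k div 2. (-1) ^ j * gegen_coeff (gegen_index p) k j * zmom p (i + (k - 2 * j)))"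
    by (simp add: sum_distrib_left mult_monom zmean_sum zmean_monom)
  also have "\<dots> = (\<Sum>j = 0..k div 2. (-1) ^ j * gegen_coeff (gegen_index p) k j * zmom p (k + i - 2 * j))"
    by (intro sum.cong refl arg_cong2[of _ _ _ _ "(*)"] arg_cong[of _ _ "zmom p"]) auto
  finally show ?thesis by (simp add: zmean_smult)
qed

lemma noncentrality_eq_moments:
  assumes "p \<ge> 2" "1 \<le> k" "k \<le> i"
  shows "noncentrality p f k i \<tau> =
    1 / (fact i)\<^sup>2 * (t_const p k)\<^sup>2 * (nth_deriv i f 0)\<^sup>2 * \<tau> ^ (2 * i) *
      (\<Sum>j = 0..k div 2. (-1) ^ j * gegen_coeff (gegen_index p) k j * zmom p (k + i - 2 * j))\<^sup>2"
  unfolding noncentrality_eq[OF assms] zmean_gegen_poly[OF assms(1,2)] t_const_sq[OF assms(1,2)]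
  using gegen_at_1_pos[OF assms(1), of k] by (simp add: power2_eq_square divide_simps)

section \<open>Finite-rank reproducing kernels\<close>

text \<open>On the sphere, boundedness serves as the criterion of integrability: the class is closed
  under sums and products, so the side conditions for linearity of the integral are
  structural.\<close>

definition bdd_meas :: "'a measure \<Rightarrow> ('a \<Rightarrow> real) \<Rightarrow> bool" where
  "bdd_meas N g \<longleftrightarrow> g \<in> borel_measurable N \<and> (\<exists>C. \<forall>x\<in>space N. \<bar>g x\<bar> \<le> C)"

lemma bdd_measI:
  "g \<in> borel_measurable N \<Longrightarrow> (\<And>x. x \<in> space N \<Longrightarrow> \<bar>g x\<bar> \<le> C) \<Longrightarrow> bdd_meas N g"
  by (auto simp: bdd_meas_def)

lemma bdd_meas_measurable: "bdd_meas N g \<Longrightarrow> g \<in> borel_measurable N"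
  by (simp add: bdd_meas_def)

lemma bdd_meas_const [intro, simp]: "bdd_meas N (\<lambda>_. c)"
  by (auto simp: bdd_meas_def)

lemma bdd_meas_mult [intro]:
  assumes "bdd_meas N g" "bdd_meas N h"
  shows "bdd_meas N (\<lambda>x. g x * h x)"
proof -
  from assms obtain C D where CD: "\<And>x. x \<in> space N \<Longrightarrow> \<bar>g x\<bar> \<le> C" "\<And>x. x \<in> space N \<Longrightarrow> \<bar>h x\<bar> \<le> D"
    unfolding bdd_meas_def by blast
  show ?thesis
  proof (rule bdd_measI)
    show "\<bar>g x * h x\<bar> \<le> C * D" if "x \<in> space N" for x
      using CD[OF that] by (simp add: abs_mult mult_mono')
  qed (use assms in \<open>auto simp: bdd_meas_def\<close>)
qed

lemma bdd_meas_add [intro]: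
  assumes "bdd_meas N g" "bdd_meas N h"
  shows "bdd_meas N (\<lambda>x. g x + h x)"
proof -
  from assms obtain C D where CD: "\<And>x. x \<in> space N \<Longrightarrow> \<bar>g x\<bar> \<le> C" "\<And>x. x \<in> space N \<Longrightarrow> \<bar>h x\<bar> \<le> D"
    unfolding bdd_meas_def by blast
  show ?thesis
  proof (rule bdd_measI)
    show "\<bar>g x + h x\<bar> \<le> C + D" if "x \<in> space N" for x
      using CD[OF that] by linarith
  qed (use assms in \<open>auto simp: bdd_meas_def\<close>)
qed

lemma bdd_meas_diff [intro]:
  assumes "bdd_meas N g" "bdd_meas N h"
  shows "bdd_meas N (\<lambda>x. g x - h x)"
  using bdd_meas_add[OF assms(1) bdd_meas_mult[OF bdd_meas_const[of _ "-1"] assms(2)]] by simp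

lemma bdd_meas_sum [intro]:
  "(\<And>i. i \<in> A \<Longrightarrow> bdd_meas N (g i)) \<Longrightarrow> bdd_meas N (\<lambda>x. \<Sum>i\<in>A. g i x)"
  by (induction A rule: infinite_finite_induct) auto

lemma bdd_meas_power [intro]: "bdd_meas N g \<Longrightarrow> bdd_meas N (\<lambda>x. g x ^ k)"
  by (induction k) auto

lemma (in finite_measure) integrable_bdd_meas: "bdd_meas M g \<Longrightarrow> integrable M g"
  unfolding bdd_meas_def by (metis AE_I2 integrable_const_bound real_norm_def)

text \<open>The last clause of the definition says that the \<open>g r\<close> lie in the range of the kernel operator.\<close>

definition kernel_features :: "'a measure \<Rightarrow> nat \<Rightarrow> ('a \<Rightarrow> 'a \<Rightarrow> real) \<Rightarrow> (nat \<Rightarrow> 'a \<Rightarrow> real) \<Rightarrow> bool" where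
  "kernel_features N d K g \<longleftrightarrow> (\<forall>r<d. bdd_meas N (g r)) \<and>
    (\<forall>r<d. \<forall>s<d. (LINT x|N. g r x * g s x) = of_bool (r = s)) \<and>
    (\<forall>x\<in>space N. \<forall>y\<in>space N. K x y = (\<Sum>r<d. g r x * g r y)) \<and>
    (\<forall>\<phi>. bdd_meas N \<phi> \<and> (\<forall>x\<in>space N. (LINT z|N. K x z * \<phi> z) = 0) \<longrightarrow>
       (\<forall>r<d. (LINT z|N. g r z * \<phi> z) = 0))"

text \<open>If \<open>K a a > 0\<close>, subtracting \<open>K x a * K a y / K a a\<close> leaves a reproducing kernel with trace smaller by
  one.\<close>

lemma (in prob_space) reproducing_kernel_decomposition:
  fixes K :: "'a \<Rightarrow> 'a \<Rightarrow> real"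
  assumes "(\<lambda>(x, y). K x y) \<in> borel_measurable (M \<Otimes>\<^sub>M M)"
    and "\<And>x y. x \<in> space M \<Longrightarrow> y \<in> space M \<Longrightarrow> \<bar>K x y\<bar> \<le> B"
    and "\<And>x y. x \<in> space M \<Longrightarrow> y \<in> space M \<Longrightarrow> K x y = K y x"
    and "\<And>x y. x \<in> space M \<Longrightarrow> y \<in> space M \<Longrightarrow> (LINT z|M. K x z * K z y) = K x y"
    and "(LINT x|M. K x x) = real d"
  shows "\<exists>g. kernel_features M d K g"
  using assms
proof (induction d arbitrary: K B)
  case (0 K B)
  note [measurable] = 0(1)
  have Kx: "bdd_meas M (K x)" if "x \<in> space M" for x
    using measurable_compose[OF measurable_Pair1'[OF that] 0(1)] 0(2)[OF that] by (auto intro: bdd_measI)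
  have diag: "(\<lambda>z. (z, z)) \<in> M \<rightarrow>\<^sub>M M \<Otimes>\<^sub>M M" by simp
  have Kd: "bdd_meas M (\<lambda>z. K z z)"
    using measurable_compose[OF diag 0(1)] 0(2) by (intro bdd_measI[where C = B]) auto
  have sq: "K x x = (LINT z|M. K x z * K x z)" if "x \<in> space M" for x
    unfolding 0(4)[OF that that, symmetric] by (rule Bochner_Integration.integral_cong) (use 0(3) that in auto)
  have nn: "K x x \<ge> 0" if "x \<in> space M" for x
    unfolding sq[OF that] by (intro integral_nonneg_AE) auto
  \<comment> \<open>A vanishing diagonal entry kills its whole row, because \<open>K x x\<close> is
    the squared norm of \<open>K x\<close>.\<close>
  have zero: "K x y = 0" if xy: "x \<in> space M" "y \<in> space M" "K x x = 0" for x y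
  proof -
    have "AE z in M. K x z * K x z = 0"
      using integral_nonneg_eq_0_iff_AE[of M "\<lambda>z. K x z * K x z"] sq[OF xy(1)] xy(3)
      by (simp add: integrable_bdd_meas bdd_meas_mult Kx xy(1))
    then have "AE z in M. K x z * K z y = 0" by eventually_elim simp
    then have "(LINT z|M. K x z * K z y) = 0"
      by (rule integral_eq_zero_AE)
    then show ?thesis using 0(4)[OF xy(1,2)] by simp
  qed
  have "AE x in M. K x x = 0"
    using integral_nonneg_eq_0_iff_AE[of M "\<lambda>z. K z z"] 0(5) nn integrable_bdd_meas[OF Kd] by simp
  \<comment> \<open>Almost every row vanishes, and the reproducing property turns this into a
    statement for all \<open>x\<close> and \<open>y\<close>, since \<open>K x y\<close> is an
    integral of products with those rows.\<close>
  then have "K x y = 0" if "x \<in> space M" "y \<in> space M" for x y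
  proof -
    have "AE z in M. K x z * K z y = 0"
      using \<open>AE x in M. K x x = 0\<close> AE_space by eventually_elim (use zero that in auto)
    then have "(LINT z|M. K x z * K z y) = 0"
      by (rule integral_eq_zero_AE)
    then show ?thesis using 0(4)[OF that] by simp
  qed
  then show ?case by (auto simp: kernel_features_def)
next
  case (Suc d K B)
  note [measurable] = Suc.prems(1)
  note sym = Suc.prems(3) and rep = Suc.prems(4)
  have Kx: "bdd_meas M (K x)" if "x \<in> space M" for x
    using measurable_compose[OF measurable_Pair1'[OF that] Suc.prems(1)] Suc.prems(2)[OF that]
    by (auto intro: bdd_measI)
  have Ky: "bdd_meas M (\<lambda>z. K z y)" if "y \<in> space M" for y
    using measurable_compose[OF measurable_Pair2'[OF that] Suc.prems(1)] Suc.prems(2)[OF _ that]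
    by (auto intro: bdd_measI)
  have diag: "(\<lambda>z. (z, z)) \<in> M \<rightarrow>\<^sub>M M \<Otimes>\<^sub>M M" by simp
  have Kd: "bdd_meas M (\<lambda>z. K z z)"
    using measurable_compose[OF diag Suc.prems(1)] Suc.prems(2)
    by (intro bdd_measI[where C = B]) auto
  obtain a where a: "a \<in> space M" "K a a \<noteq> 0"
  proof (rule ccontr)
    assume "\<not> thesis"
    then have "(LINT x|M. K x x) = (LINT x|M. 0)"
      using that by (intro Bochner_Integration.integral_cong) auto
    with Suc.prems(5) show False by simp
  qed
  have "K a a = (LINT z|M. K a z * K a z)"
    unfolding rep[OF a(1) a(1), symmetric] by (rule Bochner_Integration.integral_cong) (use sym a in auto)
  also have "\<dots> \<ge> 0" by (intro integral_nonneg_AE) auto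
  finally have pos: "K a a > 0" using a by simp
  define c where "c = sqrt (K a a)"
  have c: "c > 0" "c * c = K a a" using pos by (auto simp: c_def)
  \<comment> \<open>The feature that is split off is the section of the kernel at \<open>a\<close>.
    It has unit norm because the squared norm of that section is \<open>K a a\<close>.\<close>
  define g where "g x = K x a / c" for x
  have g: "bdd_meas M g" unfolding g_def divide_inverse using Ky[OF a(1)] by auto
  note [measurable] = bdd_meas_measurable[OF g]
  have Kg: "(LINT z|M. K x z * g z) = g x" if "x \<in> space M" for x
    using rep[OF that a(1)] by (simp add: g_def)
  have gK: "(LINT z|M. g z * K z x) = g x" if "x \<in> space M" for x
  proof -
    have "(LINT z|M. g z * K z x) = (LINT z|M. K x z * g z)"
      by (rule Bochner_Integration.integral_cong) (use sym that in auto)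
    then show ?thesis using Kg[OF that] by simp
  qed
  have gg: "(LINT z|M. g z * g z) = 1"
  proof -
    have "(LINT z|M. g z * g z) = (LINT z|M. K a z * g z / c)"
      by (rule Bochner_Integration.integral_cong) (use sym a in \<open>auto simp: g_def\<close>)
    also have "\<dots> = g a / c" using Kg[OF a(1)] by simp
    finally show ?thesis using c pos by (simp add: g_def)
  qed
  define K' where "K' x y = K x y - g x * g y" for x y
  from g obtain C where C: "\<And>x. x \<in> space M \<Longrightarrow> \<bar>g x\<bar> \<le> C" unfolding bdd_meas_def by blast
  note int = integrable_bdd_meas
  have "\<exists>h. kernel_features M d K' h"
  proof (rule Suc.IH[of K' "B + C * C"])
    show "(\<lambda>(x, y). K' x y) \<in> borel_measurable (M \<Otimes>\<^sub>M M)"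
      unfolding K'_def by measurable
    show "\<bar>K' x y\<bar> \<le> B + C * C" if "x \<in> space M" "y \<in> space M" for x y
    proof -
      have "\<bar>g x * g y\<bar> \<le> C * C" using C that by (simp add: abs_mult mult_mono')
      then show ?thesis using Suc.prems(2)[OF that] unfolding K'_def by linarith
    qed
    show "K' x y = K' y x" if "x \<in> space M" "y \<in> space M" for x y
      using sym[OF that] by (simp add: K'_def mult.commute)
    show "(LINT z|M. K' x z * K' z y) = K' x y" if "x \<in> space M" "y \<in> space M" for x y
    proof -
      have "(LINT z|M. K' x z * K' z y) =
        (LINT z|M. K x z * K z y - g y * (K x z * g z) - g x * (g z * K z y) + (g x * g y) * (g z * g z))"
        by (rule Bochner_Integration.integral_cong) (auto simp: K'_def algebra_simps)
      also have "\<dots> = K x y - g y * g x - g x * g y + g x * g y * 1"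
        using Kx[OF that(1)] Ky[OF that(2)] g
        by (simp add: int bdd_meas_mult bdd_meas_diff Kg gK gg rep that)
      finally show ?thesis by (simp add: K'_def)
    qed
    show "(LINT x|M. K' x x) = real d"
      unfolding K'_def using Suc.prems(5) g Kd by (simp add: int bdd_meas_mult gg)
  qed
  then obtain h where kf: "kernel_features M d K' h" ..
  have h: "\<And>r. r < d \<Longrightarrow> bdd_meas M (h r)"
    "\<And>r s. r < d \<Longrightarrow> s < d \<Longrightarrow> (LINT x|M. h r x * h s x) = of_bool (r = s)"
    "\<And>x y. x \<in> space M \<Longrightarrow> y \<in> space M \<Longrightarrow> K' x y = (\<Sum>r<d. h r x * h r y)"
    using kf by (simp_all add: kernel_features_def)
  have h4: "\<forall>\<phi>. bdd_meas M \<phi> \<and> (\<forall>x\<in>space M. (LINT z|M. K' x z * \<phi> z) = 0) \<longrightarrow>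
       (\<forall>r<d. (LINT z|M. h r z * \<phi> z) = 0)"
    using kf unfolding kernel_features_def by (elim conjE)
  have K'\<phi>: "(LINT z|M. K' x z * \<phi> z) = (LINT z|M. K x z * \<phi> z) - g x * (LINT z|M. g z * \<phi> z)"
    if "bdd_meas M \<phi>" "x \<in> space M" for \<phi> x
  proof -
    have "(LINT z|M. K' x z * \<phi> z) = (LINT z|M. K x z * \<phi> z - g x * (g z * \<phi> z))"
      by (rule Bochner_Integration.integral_cong) (auto simp: K'_def algebra_simps)
    then show ?thesis using that Kx[OF that(2)] g by (simp add: int bdd_meas_mult)
  qed
  \<comment> \<open>\<open>K'\<close> annihilates \<open>g\<close> by construction, so the range
    clause makes the features of \<open>K'\<close> orthogonal to \<open>g\<close>.\<close>
  have hg: "(LINT z|M. h r z * g z) = 0" if "r < d" for r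
    using h4[rule_format, of g r] that g by (simp add: K'\<phi> Kg gg)
  define G where "G = h(d := g)"
  show ?case
    unfolding kernel_features_def
  proof (intro exI[of _ G] conjI allI ballI impI)
    show "bdd_meas M (G r)" if "r < Suc d" for r
      using that h(1) g by (auto simp: G_def less_Suc_eq)
    show "(LINT x|M. G r x * G s x) = of_bool (r = s)" if "r < Suc d" "s < Suc d" for r s
      using that h(2) gg hg by (auto simp: G_def less_Suc_eq mult.commute)
    show "K x y = (\<Sum>r<Suc d. G r x * G r y)" if "x \<in> space M" "y \<in> space M" for x y
      using h(3)[OF that] by (simp add: G_def K'_def)
    fix \<phi> r
    assume \<phi>: "bdd_meas M \<phi> \<and> (\<forall>x\<in>space M. (LINT z|M. K x z * \<phi> z) = 0)" and r: "r < Suc d"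
    have "(LINT z|M. g z * \<phi> z) = (LINT z|M. K a z * \<phi> z / c)"
      by (rule Bochner_Integration.integral_cong) (use sym a in \<open>auto simp: g_def\<close>)
    also have "\<dots> = 0" using \<phi> a by simp
    finally have g0: "(LINT z|M. g z * \<phi> z) = 0" .
    then have "(LINT z|M. K' x z * \<phi> z) = 0" if "x \<in> space M" for x
      using K'\<phi>[OF conjunct1[OF \<phi>] that] \<phi> that by simp
    then show "(LINT z|M. G r z * \<phi> z) = 0"
      using h4[rule_format, of \<phi> r] \<phi> g0 r by (auto simp: G_def less_Suc_eq)
  qed
qed

section \<open>Taylor expansion with Peano remainder\<close>

lemma times_differentiable_at_mono:
  "times_differentiable_at q f x \<Longrightarrow> m \<le> q \<Longrightarrow> times_differentiable_at m f x"
proof (induction q)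
  case (Suc q)
  then have "times_differentiable_at q f x"
    by (auto dest: eventually_nhds_x_imp_x)
  with Suc show ?case by (cases "m = Suc q") auto
qed simp

lemma times_differentiable_at_deriv:
  assumes "times_differentiable_at (Suc q) f x" "m \<le> q"
  shows "nth_deriv m f differentiable (at x)"
proof -
  have "times_differentiable_at (Suc m) f x"
    using assms by (intro times_differentiable_at_mono[of "Suc q" f x "Suc m"]) simp_all
  then show ?thesis by (simp only: times_differentiable_at.simps)
qed

text \<open>Taylor's formula with Lagrange remainder of order \<open>q\<close> leaves only
  \<open>D q t\<close> at an intermediate point, as the lower coefficients vanish. Near 0 this is at
  most \<open>e * \<bar>t\<bar>\<close>, because \<open>D q\<close> and its derivative vanish at 0.
  The derivative of \<open>D q\<close> is taken at 0 only, in accordance with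
  \<open>times_differentiable_at\<close>.\<close>

lemma taylor_peano_zero:
  fixes g :: "real \<Rightarrow> real" and D :: "nat \<Rightarrow> real \<Rightarrow> real"
  assumes "D 0 = g"
    and "\<forall>\<^sub>F y in nhds 0. \<forall>m<q. (D m has_real_derivative D (Suc m) y) (at y)"
    and "(D q has_real_derivative 0) (at 0)"
    and "\<And>m. m \<le> q \<Longrightarrow> D m 0 = 0"
    and "e > 0"
  shows "\<forall>\<^sub>F x in nhds 0. \<bar>g x\<bar> \<le> e * \<bar>x\<bar> ^ Suc q"
proof -
  have "((\<lambda>h. (D q (0 + h) - D q 0) / h) \<longlongrightarrow> 0) (at 0)"
    using assms(3) unfolding DERIV_def .
  then have "\<forall>\<^sub>F h in at 0. \<bar>D q h / h\<bar> < e"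
    using \<open>e > 0\<close> assms(4)[of q] by (auto simp: tendsto_iff dist_real_def)
  then obtain d1 where d1: "d1 > 0" "\<And>y. y \<noteq> 0 \<Longrightarrow> \<bar>y\<bar> < d1 \<Longrightarrow> \<bar>D q y / y\<bar> < e"
    unfolding eventually_at by (auto simp: dist_real_def)
  obtain d2 where d2: "d2 > 0" "\<And>y m. \<bar>y\<bar> < d2 \<Longrightarrow> m < q \<Longrightarrow> (D m has_real_derivative D (Suc m) y) (at y)"
    using assms(2) unfolding eventually_nhds_metric by (auto simp: dist_real_def)
  have *: "\<bar>D q y\<bar> \<le> e * \<bar>y\<bar>" if "\<bar>y\<bar> < d1" for y
    using d1(2)[of y] that assms(4)[of q] by (cases "y = 0") (auto simp: field_simps abs_mult)
  have "\<bar>g x\<bar> \<le> e * \<bar>x\<bar> ^ Suc q" if x: "\<bar>x\<bar> < min d1 d2" for x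
  proof (cases "q = 0 \<or> x = 0")
    case True
    then show ?thesis using *[of x] x assms(1) assms(4)[of 0] by auto
  next
    case False
    then have "\<exists>t. \<bar>t\<bar> \<le> \<bar>x\<bar> \<and> g x = (\<Sum>m<q. D m 0 / fact m * x ^ m) + D q t / fact q * x ^ q"
      using d2 x assms(1) by (intro Maclaurin_bi_le) auto
    then obtain t where t: "\<bar>t\<bar> \<le> \<bar>x\<bar>" "g x = D q t / fact q * x ^ q"
      using assms(4) by auto
    have "\<bar>D q t / fact q\<bar> \<le> \<bar>D q t\<bar>"
      using fact_ge_1[of q, where ?'a = real] by (simp add: divide_le_eq mult_right_mono abs_mult mult_le_cancel_left1)
    also have "\<dots> \<le> e * \<bar>x\<bar>" using *[of t] t(1) x mult_left_mono[OF t(1), of e] \<open>e > 0\<close> by linarith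
    finally have "\<bar>D q t / fact q\<bar> * \<bar>x\<bar> ^ q \<le> e * \<bar>x\<bar> * \<bar>x\<bar> ^ q"
      by (intro mult_right_mono) auto
    then show ?thesis by (simp add: t(2) abs_mult power_abs mult.assoc)
  qed
  then show ?thesis
    unfolding eventually_nhds_metric using d1 d2
    by (intro exI[of _ "min d1 d2"]) (auto simp: dist_real_def)
qed

lemma taylor_peano:
  fixes f :: "real \<Rightarrow> real"
  assumes "times_differentiable_at q f 0" "q \<ge> 1" "e > 0"
  shows "\<forall>\<^sub>F x in nhds 0. \<bar>f x - (\<Sum>j\<le>q. nth_deriv j f 0 / fact j * x ^ j)\<bar> \<le> e * \<bar>x\<bar> ^ q"
proof -
  have DERIV_pow2: "((\<lambda>x. x ^ j) has_real_derivative real j * x ^ (j - 1)) (at x)" for x :: real and j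
    using DERIV_pow[of j x] by simp
  define r where "r = q - 1"
  have r: "q = Suc r" using assms(2) by (simp add: r_def)
  define c where "c j = nth_deriv j f 0" for j
  \<comment> \<open>\<open>T m\<close> is the derivative of order \<open>m\<close> of the Taylor
    polynomial, so the differences \<open>D m\<close> below form a chain of derivatives that vanish
    at 0.\<close>
  define T where "T m x = (\<Sum>j\<le>q - m. c (j + m) / fact j * x ^ j)" for m and x :: real
  have T': "(T m has_real_derivative T (Suc m) x) (at x)" if "m < q" for m x
  proof -
    obtain n where n: "q - m = Suc n" using \<open>m < q\<close> by (cases "q - m") auto
    have "(T m has_real_derivative (\<Sum>j\<le>Suc n. c (j + m) / fact j * (real j * x ^ (j - 1)))) (at x)"
      unfolding T_def n by (rule DERIV_sum[OF DERIV_cmult[OF DERIV_pow2]])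
    also have "(\<Sum>j\<le>Suc n. c (j + m) / fact j * (real j * x ^ (j - 1))) = T (Suc m) x"
    proof -
      have "q - Suc m = n" using n by simp
      then show ?thesis unfolding T_def
        by (subst sum.atMost_Suc_shift) (auto intro!: sum.cong simp: divide_simps add.commute)
    qed
    finally show ?thesis .
  qed
  define D where "D m x = nth_deriv m f x - T m x" for m x
  have "\<forall>\<^sub>F x in nhds 0. \<bar>D 0 x\<bar> \<le> e * \<bar>x\<bar> ^ Suc r"
  proof (rule taylor_peano_zero[where D = D])
    have "\<forall>\<^sub>F y in nhds 0. times_differentiable_at r f y" using assms(1) by (simp add: r)
    then show "\<forall>\<^sub>F y in nhds 0. \<forall>m<r. (D m has_real_derivative D (Suc m) y) (at y)"
    proof eventually_elim
      case (elim y)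
      show ?case
      proof (intro allI impI)
        fix m assume m: "m < r"
        then obtain r' where "r = Suc r'" by (cases r) auto
        then have "nth_deriv m f differentiable (at y)"
          using times_differentiable_at_deriv[of r' f y m] elim m by simp
        then have "(nth_deriv m f has_real_derivative nth_deriv (Suc m) f y) (at y)"
          by (simp add: DERIV_deriv_iff_real_differentiable)
        then show "(D m has_real_derivative D (Suc m) y) (at y)"
          unfolding D_def using T'[of m y] m r by (auto intro!: derivative_intros)
      qed
    qed
    have "nth_deriv r f differentiable (at 0)" using assms(1) by (simp add: r)
    then have "(nth_deriv r f has_real_derivative nth_deriv (Suc r) f 0) (at 0)"
      by (simp add: DERIV_deriv_iff_real_differentiable)
    from DERIV_diff[OF this T'[of r 0]] have "(D r has_real_derivative nth_deriv (Suc r) f 0 - T (Suc r) 0) (at 0)"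
      unfolding D_def[abs_def] by (simp add: r)
    moreover have "T (Suc r) 0 = nth_deriv (Suc r) f 0" by (simp add: T_def r c_def)
    ultimately show "(D r has_real_derivative 0) (at 0)" by simp
    show "D m 0 = 0" if "m \<le> r" for m
      by (simp add: D_def T_def c_def power_0_left if_distrib cong: if_cong)
  qed (use assms in auto)
  then show ?thesis
    by (simp add: r D_def T_def c_def)
qed

section \<open>The uniform distribution on the sphere\<close>

lemma nn_integral_lborel_reflect:
  fixes f :: "'a::euclidean_space \<Rightarrow> ennreal"
  assumes [measurable]: "f \<in> borel_measurable borel"
  shows "(\<integral>\<^sup>+x. f (t - x) \<partial>lborel) = (\<integral>\<^sup>+x. f x \<partial>lborel)"
proof -
  have "(lborel :: 'a measure) = density (distr lborel borel (\<lambda>x. t - x)) (\<lambda>_. 1)"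
    using lborel_affine[of "-1" t] by simp
  then have "(lborel :: 'a measure) = distr lborel borel (\<lambda>x. t - x)"
    by (simp only: density_1)
  from arg_cong[OF this, of "\<lambda>M. nn_integral M f"] show ?thesis
    by (simp add: nn_integral_distr)
qed

text \<open>A substitute for determinants: Fubini's theorem and reflections of the integration variable turn
  \<open>vol (T -` A) * vol B\<close> into \<open>vol A * vol (T -` B)\<close>, and \<open>T -` B = B\<close> for the unit ball \<open>B\<close>.\<close>

lemma lborel_distr_orthogonal_transformation:
  fixes T :: "'a::euclidean_space \<Rightarrow> 'a"
  assumes T: "orthogonal_transformation T"
  shows "distr lborel borel T = lborel"
proof (rule measure_eqI)
  fix A assume "A \<in> sets (distr lborel borel T)"
  then have [measurable]: "A \<in> sets borel" by simp
  interpret T: linear T using T by (rule orthogonal_transformation_linear)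
  have [measurable]: "T \<in> borel_measurable borel"
    by (intro borel_measurable_continuous_onI linear_continuous_on linear_conv_bounded_linear[THEN iffD1] T.linear_axioms)
  obtain S where TS: "T (S y) = y" for y
    using orthogonal_transformation_surj[OF T] by (metis surj_def)
  define B :: "'a set" where "B = ball 0 1"
  have B [measurable]: "B \<in> sets borel" by (simp add: B_def)
  have BT: "indicator B (T x) = (indicator B x :: ennreal)" for x
    using orthogonal_transformation_norm[OF T] by (simp add: B_def indicator_def)
  have fin: "emeasure lborel B \<noteq> 0" "emeasure lborel B \<noteq> \<infinity>"
    using emeasure_lborel_ball_finite[of "0::'a" 1] content_ball_pos[of 1 "0::'a"]
    by (auto simp: B_def measure_def)
  have "emeasure (distr lborel borel T) A * emeasure lborel B =
      (\<integral>\<^sup>+x. (\<integral>\<^sup>+y. indicator A (T x) * indicator B y \<partial>lborel) \<partial>lborel)"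
  proof -
    have "T -` A \<in> sets lborel" using measurable_sets_borel[of T borel A] by simp
    then have "emeasure (distr lborel borel T) A = (\<integral>\<^sup>+x. indicator (T -` A) x \<partial>lborel)"
      by (simp add: emeasure_distr)
    then show ?thesis
      by (simp add: nn_integral_cmult nn_integral_multc indicator_vimage[abs_def])
  qed
  also have "\<dots> = (\<integral>\<^sup>+x. (\<integral>\<^sup>+y. indicator A (T x) * indicator B (T x - y) \<partial>lborel) \<partial>lborel)"
    by (intro nn_integral_cong nn_integral_lborel_reflect[symmetric]) simp
  also have "\<dots> = (\<integral>\<^sup>+y. (\<integral>\<^sup>+x. indicator A (T x) * indicator B (T x - y) \<partial>lborel) \<partial>lborel)"
    by (subst lborel_pair.Fubini') simp_all
  also have "\<dots> = (\<integral>\<^sup>+y. (\<integral>\<^sup>+x. indicator A (T (S y - x)) * indicator B (T (S y - x) - y) \<partial>lborel) \<partial>lborel)"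
    by (intro nn_integral_cong nn_integral_lborel_reflect[symmetric]) simp
  \<comment> \<open>Here \<open>T (S y - x) = y - T x\<close>, so the second indicator is evaluated
    at \<open>- T x\<close>, and the ball is symmetric.\<close>
  also have "\<dots> = (\<integral>\<^sup>+y. (\<integral>\<^sup>+x. indicator A (y - T x) * indicator B (T x) \<partial>lborel) \<partial>lborel)"
    by (simp add: T.diff TS B_def indicator_def)
  also have "\<dots> = (\<integral>\<^sup>+x. (\<integral>\<^sup>+y. indicator A (y - T x) * indicator B (T x) \<partial>lborel) \<partial>lborel)"
    by (subst lborel_pair.Fubini') simp_all
  also have "\<dots> = (\<integral>\<^sup>+x. (\<integral>\<^sup>+y. indicator A (y - T x) \<partial>lborel) * indicator B x \<partial>lborel)"
    by (simp add: nn_integral_multc BT)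
  also have "\<dots> = (\<integral>\<^sup>+x. emeasure lborel A * indicator B x \<partial>lborel)"
  proof (intro nn_integral_cong)
    fix x :: 'a
    have "(\<integral>\<^sup>+y. indicator A (y - T x) \<partial>lborel) = (\<integral>\<^sup>+y. indicator A y \<partial>distr lborel borel ((+) (- T x)))"
      by (subst nn_integral_distr) simp_all
    also have "\<dots> = emeasure lborel A"
      unfolding lborel_distr_plus by simp
    finally show "(\<integral>\<^sup>+y. indicator A (y - T x) \<partial>lborel) * indicator B x = emeasure lborel A * (indicator B x :: ennreal)"
      by simp
  qed
  also have "\<dots> = emeasure lborel A * emeasure lborel B"
    by (simp add: nn_integral_cmult)
  finally show "emeasure (distr lborel borel T) A = emeasure lborel A"
    using fin by (auto simp: mult.commute[of _ "emeasure lborel B"] ennreal_mult_cancel_left)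
qed simp

section \<open>Cone description and rotation invariance of the surface measure\<close>

lemma space_sphere_measure [simp]: "space (sphere_measure :: (real ^ 'n::finite) measure) = sphere 0 1"
  by (simp add: sphere_measure_def space_restrict_space space_scale_measure)

lemma sets_sphere_measure [measurable_cong]:
  "sets (sphere_measure :: (real ^ 'n::finite) measure) = sets (restrict_space borel (sphere 0 1))"
  by (simp add: sphere_measure_def)

lemma sgn_measurable_cball:
  "sgn \<in> restrict_space lborel (cball 0 1 - {0}) \<rightarrow>\<^sub>M restrict_space borel (sphere 0 1 :: (real ^ 'n::finite) set)"
proof (rule measurable_restrict_space2)
  have sgn_eq: "(sgn :: real ^ 'n \<Rightarrow> _) = (\<lambda>x. inverse (norm x) *\<^sub>R x)"
    by (simp add: fun_eq_iff sgn_div_norm)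
  have "(sgn :: real ^ 'n \<Rightarrow> _) \<in> borel_measurable lborel" unfolding sgn_eq by measurable
  then show "(sgn :: real ^ 'n \<Rightarrow> _) \<in> borel_measurable (restrict_space lborel (cball 0 1 - {0}))"
    by (rule measurable_restrict_space1)
qed (auto simp: space_restrict_space norm_sgn)

lemma emeasure_sphere_measure:
  fixes A :: "(real ^ 'n::finite) set"
  assumes "A \<in> sets sphere_measure"
  shows "emeasure sphere_measure A = of_nat CARD('n) * emeasure lborel {x \<in> cball 0 1 - {0}. sgn x \<in> A}"
proof -
  have "emeasure (distr (restrict_space lborel (cball 0 1 - {0})) (restrict_space borel (sphere 0 1)) sgn) A =
    emeasure (restrict_space lborel (cball 0 1 - {0})) (sgn -` A \<inter> (cball 0 1 - {0}))"
    using assms by (subst emeasure_distr[OF sgn_measurable_cball]) (simp_all add: space_restrict_space sets_sphere_measure)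
  also have "\<dots> = emeasure lborel (sgn -` A \<inter> (cball 0 1 - {0}))"
    by (subst emeasure_restrict_space) auto
  also have "sgn -` A \<inter> (cball 0 1 - {0}) = {x \<in> cball 0 1 - {0}. sgn x \<in> A}" by auto
  finally show ?thesis by (simp add: sphere_measure_def)
qed

lemma emeasure_sphere_measure_UNIV:
  "emeasure (sphere_measure :: (real ^ 'n::finite) measure) (sphere 0 1) \<noteq> 0"
  "emeasure (sphere_measure :: (real ^ 'n::finite) measure) (sphere 0 1) \<noteq> \<infinity>"
proof -
  have *: "emeasure (sphere_measure :: (real ^ 'n::finite) measure) (sphere 0 1) =
      of_nat CARD('n) * emeasure lborel (cball 0 1 - {0 :: real ^ 'n})"
  proof (subst emeasure_sphere_measure)
    show "(sphere 0 1 :: (real ^ 'n) set) \<in> sets sphere_measure"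
      by (metis sets.top space_sphere_measure)
    have "{x \<in> cball 0 1 - {0 :: real ^ 'n}. sgn x \<in> sphere 0 1} = cball 0 1 - {0}"
      by (auto simp: norm_sgn)
    then show "of_nat CARD('n) * emeasure lborel {x \<in> cball 0 1 - {0 :: real ^ 'n}. sgn x \<in> sphere 0 1} =
      of_nat CARD('n) * emeasure lborel (cball 0 1 - {0 :: real ^ 'n})" by simp
  qed
  also have "emeasure lborel (cball 0 1 - {0 :: real ^ 'n}) = emeasure lborel (cball 0 1 :: (real ^ 'n) set)"
    by (subst emeasure_Diff) (auto simp: emeasure_lborel_cball_finite)
  finally have eq: "emeasure (sphere_measure :: (real ^ 'n::finite) measure) (sphere 0 1) =
      of_nat CARD('n) * emeasure lborel (cball 0 1 :: (real ^ 'n) set)" .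
  have "emeasure lborel (cball 0 1 :: (real ^ 'n) set) \<noteq> 0"
    using content_cball_pos[of 1 "0 :: real ^ 'n"] by (auto simp: measure_def)
  then show "emeasure (sphere_measure :: (real ^ 'n::finite) measure) (sphere 0 1) \<noteq> 0"
    by (simp add: eq)
  have "emeasure lborel (cball 0 1 :: (real ^ 'n) set) \<noteq> \<infinity>"
    using emeasure_lborel_cball_finite[of "0 :: real ^ 'n" 1] by simp
  then show "emeasure (sphere_measure :: (real ^ 'n::finite) measure) (sphere 0 1) \<noteq> \<infinity>"
    unfolding eq by (simp add: ennreal_mult_eq_top_iff)
qed

definition usphere :: "(real ^ 'n::finite) measure" where
  "usphere = density sphere_measure (\<lambda>_. ennreal (1 / measure sphere_measure (sphere 0 1 :: (real ^ 'n) set)))"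

lemma space_usphere [simp]: "space (usphere :: (real ^ 'n::finite) measure) = sphere 0 1"
  by (simp add: usphere_def)

lemma sets_usphere [measurable_cong]:
  "sets (usphere :: (real ^ 'n::finite) measure) = sets (restrict_space borel (sphere 0 1))"
  by (simp add: usphere_def sets_sphere_measure)

lemma measure_sphere_pos: "measure sphere_measure (sphere 0 1 :: (real ^ 'n::finite) set) > 0"
  using emeasure_sphere_measure_UNIV[where 'n = 'n]
  by (simp add: measure_def enn2real_positive_iff zero_less_iff_neq_zero top.not_eq_extremum)

lemma prob_space_usphere: "prob_space (usphere :: (real ^ 'n::finite) measure)"
proof
  have s: "(sphere 0 1 :: (real ^ 'n) set) \<in> sets sphere_measure"
    by (metis sets.top space_sphere_measure)
  let ?c = "measure sphere_measure (sphere 0 1 :: (real ^ 'n) set)"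
  have "emeasure sphere_measure (sphere 0 1 :: (real ^ 'n) set) = ennreal ?c"
    using emeasure_sphere_measure_UNIV(2)[where 'n = 'n] by (simp add: emeasure_eq_ennreal_measure top.not_eq_extremum)
  then show "emeasure usphere (space (usphere :: (real ^ 'n::finite) measure)) = 1"
    unfolding space_usphere unfolding usphere_def
    using s measure_sphere_pos[where 'n = 'n]
    by (subst emeasure_density_const) (auto simp: ennreal_mult[symmetric])
qed

lemma integral_usphere:
  fixes f :: "real ^ 'n::finite \<Rightarrow> real"
  assumes "f \<in> borel_measurable sphere_measure"
  shows "integral\<^sup>L usphere f = integral\<^sup>L sphere_measure f / measure sphere_measure (sphere 0 1 :: (real ^ 'n) set)"
  unfolding usphere_def using assms measure_sphere_pos[where 'n = 'n]
  by (subst integral_density) auto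

lemma id_usphere_borel: "(\<lambda>w. w) \<in> borel_measurable (usphere :: (real ^ 'n::finite) measure)"
  using measurable_restrict_space1[OF measurable_ident, of borel "sphere 0 1 :: (real ^ 'n) set"]
  by (simp add: measurable_cong_sets[OF sets_usphere refl] id_def)

text \<open>An orthogonal map preserves norms and commutes with \<open>sgn\<close>, so the cone over
  a preimage is the preimage of the cone. Invariance is thus inherited from Lebesgue
  measure.\<close>

lemma orthogonal_transformation_usphere:
  fixes T :: "real ^ 'n::finite \<Rightarrow> real ^ 'n"
  assumes T: "orthogonal_transformation T"
  shows "T \<in> usphere \<rightarrow>\<^sub>M usphere" "distr usphere usphere T = usphere"
proof -
  interpret T: linear T using T by (rule orthogonal_transformation_linear)
  have Tb [measurable]: "T \<in> borel_measurable borel"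
    by (intro borel_measurable_continuous_onI linear_continuous_on linear_conv_bounded_linear[THEN iffD1] T.linear_axioms)
  have "T \<in> restrict_space borel (sphere 0 1) \<rightarrow>\<^sub>M restrict_space borel (sphere 0 1)"
    by (rule measurable_restrict_space2[OF _ measurable_restrict_space1[OF Tb]])
      (auto simp: space_restrict_space orthogonal_transformation_norm[OF T])
  then show meas: "T \<in> usphere \<rightarrow>\<^sub>M usphere"
    by (simp add: measurable_cong_sets[OF sets_usphere sets_usphere])
  show "distr usphere usphere T = usphere"
  proof (rule measure_eqI)
    fix A :: "(real ^ 'n) set" assume "A \<in> sets (distr usphere usphere T)"
    then have A: "A \<in> sets usphere" by simp
    then have A': "A \<in> sets sphere_measure" by (simp add: usphere_def)
    have "T -` A \<inter> sphere 0 1 \<in> sets usphere"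
      using measurable_sets[OF meas A] by simp
    then have TA': "T -` A \<inter> sphere 0 1 \<in> sets sphere_measure" by (simp add: usphere_def)
    have sgnT: "sgn (T x) = T (sgn x)" for x
      by (simp add: sgn_div_norm orthogonal_transformation_norm[OF T] T.scaleR)
    have T0: "T x = 0 \<longleftrightarrow> x = 0" for x
      using orthogonal_transformation_norm[OF T, of x] by (metis norm_eq_zero)
    define X where "X = {x \<in> cball 0 1 - {0}. sgn x \<in> A}"
    have "X \<in> sets (restrict_space lborel (cball 0 1 - {0}))"
      using measurable_sets[OF sgn_measurable_cball, of A] A' unfolding sets_sphere_measure
      by (simp add: X_def space_restrict_space vimage_def Int_def conj_commute)
    then have X: "X \<in> sets borel" by (subst (asm) sets_restrict_space_iff) auto
    have "{x \<in> cball 0 1 - {0}. sgn x \<in> T -` A \<inter> sphere 0 1} = T -` X"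
      by (auto simp: X_def sgnT norm_sgn orthogonal_transformation_norm[OF T] T0)
    then have "emeasure sphere_measure (T -` A \<inter> sphere 0 1) = of_nat CARD('n) * emeasure lborel (T -` X)"
      using emeasure_sphere_measure[OF TA'] by simp
    also have "emeasure lborel (T -` X) = emeasure (distr lborel borel T) X"
      using X by (subst emeasure_distr) auto
    also have "of_nat CARD('n) * \<dots> = emeasure sphere_measure A"
      using emeasure_sphere_measure[OF A'] by (simp add: lborel_distr_orthogonal_transformation[OF T] X_def)
    finally have "emeasure usphere (T -` A \<inter> sphere 0 1) = emeasure usphere A"
      using A' TA' by (simp add: usphere_def emeasure_density_const)
    then show "emeasure (distr usphere usphere T) A = emeasure usphere A"
      using A by (simp add: emeasure_distr[OF meas])
  qed simp
qed

section \<open>Zonal integrals\<close>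

lemma usphere_inner_measurable [measurable]:
  fixes a :: "real ^ 'n::finite"
  shows "(\<lambda>w. w \<bullet> a) \<in> borel_measurable usphere"
  by (rule borel_measurable_inner[OF id_usphere_borel borel_measurable_const])

lemma usphere_prod_inner_measurable [measurable]:
  "(\<lambda>x. fst x \<bullet> snd x) \<in> borel_measurable (usphere \<Otimes>\<^sub>M (usphere :: (real ^ 'n::finite) measure))"
  by (rule borel_measurable_inner[OF measurable_compose[OF measurable_fst id_usphere_borel]
        measurable_compose[OF measurable_snd id_usphere_borel]])

lemma borel_measurable_poly [measurable (raw)]:
  fixes P :: "real poly"
  shows "f \<in> borel_measurable M \<Longrightarrow> (\<lambda>x. poly P (f x)) \<in> borel_measurable M"
  by (rule measurable_compose[of f M borel], assumption)
    (intro borel_measurable_continuous_onI continuous_intros)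

lemma poly_bounded_interval:
  fixes P :: "real poly"
  obtains C where "\<And>s. \<bar>s\<bar> \<le> 1 \<Longrightarrow> \<bar>poly P s\<bar> \<le> C"
proof -
  have "compact (poly P ` {-1..1})"
    by (intro compact_continuous_image continuous_intros) auto
  then obtain C where "\<forall>x\<in>poly P ` {-1..1}. norm x \<le> C"
    using compact_imp_bounded bounded_iff by metis
  then show thesis by (intro that[of C]) (auto simp: abs_le_iff)
qed

lemma abs_inner_unit_le:
  assumes "norm w = 1" "norm a = 1"
  shows "\<bar>w \<bullet> a\<bar> \<le> 1"
  using Cauchy_Schwarz_ineq2[of w a] assms by simp

lemma bdd_meas_poly_inner [intro]:
  fixes a :: "real ^ 'n::finite"
  assumes "norm a = 1"
  shows "bdd_meas usphere (\<lambda>w. poly P (w \<bullet> a))"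
proof -
  obtain C where "\<And>s. \<bar>s\<bar> \<le> 1 \<Longrightarrow> \<bar>poly P s\<bar> \<le> C" by (rule poly_bounded_interval[of P]) blast
  then show ?thesis
    by (intro bdd_measI[where C = C]) (auto simp: abs_inner_unit_le assms)
qed

lemma bdd_meas_inner [intro]:
  fixes a :: "real ^ 'n::finite"
  shows "bdd_meas usphere (\<lambda>w. w \<bullet> a)"
proof (intro bdd_measI[where C = "norm a"])
  fix w :: "real ^ 'n" assume "w \<in> space usphere"
  then show "\<bar>w \<bullet> a\<bar> \<le> norm a" using Cauchy_Schwarz_ineq2[of w a] by simp
qed auto

interpretation usphere: prob_space "usphere :: (real ^ 'n::finite) measure"
  by (rule prob_space_usphere)

text \<open>A rotation takes \<open>norm x *\<^sub>R e\<close> to \<open>x\<close>. The vector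
  \<open>x\<close> is arbitrary because the identity is later applied to
  \<open>a + t *\<^sub>R b\<close> for all \<open>t\<close>.\<close>

lemma integral_usphere_power_inner:
  fixes x e :: "real ^ 'n::finite"
  assumes e: "norm e = 1"
  shows "(LINT w|usphere. (w \<bullet> x) ^ m) = norm x ^ m * (LINT w|usphere. (w \<bullet> e) ^ m)"
proof -
  have "norm (norm x *\<^sub>R e) = norm x" using e by simp
  from orthogonal_transformation_exists[OF this]
  obtain T where T: "orthogonal_transformation T" "T (norm x *\<^sub>R e) = x" .
  have "(LINT w|usphere. (w \<bullet> x) ^ m) = (LINT w|distr usphere usphere T. (w \<bullet> x) ^ m)"
    by (simp add: orthogonal_transformation_usphere[OF T(1)])
  also have "\<dots> = (LINT w|usphere. (T w \<bullet> T (norm x *\<^sub>R e)) ^ m)"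
    by (subst integral_distr[OF orthogonal_transformation_usphere(1)[OF T(1)]]) (simp_all add: T(2))
  also have "\<dots> = (LINT w|usphere. norm x ^ m * (w \<bullet> e) ^ m)"
    using T(1) by (simp add: orthogonal_transformation_def power_mult_distrib)
  finally show ?thesis by simp
qed

text \<open>Comparison of the coefficients of \<open>t ^ j\<close> in the integral of \<open>(w \<bullet> (a + t *\<^sub>R b)) ^ (2 * r)\<close>.\<close>

lemma integral_usphere_mixed_power:
  fixes a b e :: "real ^ 'n::finite"
  assumes ab: "norm a = 1" "norm b = 1" and e: "norm e = 1" and j: "j \<le> 2 * r"
  shows "real ((2 * r) choose j) * (LINT w|usphere. (w \<bullet> a) ^ (2 * r - j) * (w \<bullet> b) ^ j) =
    coeff ([:1, 2 * (a \<bullet> b), 1:] ^ r) j * (LINT w|usphere. (w \<bullet> e) ^ (2 * r))"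
proof -
  define c where "c j = (LINT w|usphere. (w \<bullet> a) ^ (2 * r - j) * (w \<bullet> b) ^ j)" for j
  define I where "I = (LINT w|usphere. (w \<bullet> e) ^ (2 * r))"
  have "poly (\<Sum>j\<le>2 * r. monom (real ((2 * r) choose j) * c j) j) t = poly (smult I ([:1, 2 * (a \<bullet> b), 1:] ^ r)) t" for t
  proof -
    have "(LINT w|usphere. (w \<bullet> (a + t *\<^sub>R b)) ^ (2 * r)) =
      (LINT w|usphere. (\<Sum>j\<le>2 * r. real ((2 * r) choose j) * t ^ j * ((w \<bullet> a) ^ (2 * r - j) * (w \<bullet> b) ^ j)))"
    proof (rule Bochner_Integration.integral_cong[OF refl])
      fix w :: "real ^ 'n"
      have "(w \<bullet> (a + t *\<^sub>R b)) ^ (2 * r) = (t * (w \<bullet> b) + w \<bullet> a) ^ (2 * r)"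
        by (simp add: inner_add_right add.commute)
      then show "(w \<bullet> (a + t *\<^sub>R b)) ^ (2 * r) =
        (\<Sum>j\<le>2 * r. real ((2 * r) choose j) * t ^ j * ((w \<bullet> a) ^ (2 * r - j) * (w \<bullet> b) ^ j))"
        unfolding binomial_ring[of "t * (w \<bullet> b)"] by (simp add: power_mult_distrib algebra_simps)
    qed
    also have "\<dots> = (\<Sum>j\<le>2 * r. real ((2 * r) choose j) * t ^ j * c j)"
      unfolding c_def
      by (subst Bochner_Integration.integral_sum) (auto intro!: usphere.integrable_bdd_meas bdd_meas_mult bdd_meas_power)
    finally have 1: "(LINT w|usphere. (w \<bullet> (a + t *\<^sub>R b)) ^ (2 * r)) =
      (\<Sum>j\<le>2 * r. real ((2 * r) choose j) * t ^ j * c j)" .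
    have "norm (a + t *\<^sub>R b) ^ (2 * r) = ((a + t *\<^sub>R b) \<bullet> (a + t *\<^sub>R b)) ^ r"
      by (simp add: power_mult power2_norm_eq_inner)
    also have "(a + t *\<^sub>R b) \<bullet> (a + t *\<^sub>R b) = 1 + 2 * (a \<bullet> b) * t + t\<^sup>2"
    proof -
      have "a \<bullet> a = 1" "b \<bullet> b = 1" using ab by (simp_all add: norm_eq_1)
      then show ?thesis
        by (simp add: inner_add_left inner_add_right inner_commute[of b a] power2_eq_square algebra_simps)
    qed
    finally have "(LINT w|usphere. (w \<bullet> (a + t *\<^sub>R b)) ^ (2 * r)) = (1 + 2 * (a \<bullet> b) * t + t\<^sup>2) ^ r * I"
      unfolding I_def by (subst integral_usphere_power_inner[OF e]) simp
    then show ?thesis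
      using 1 by (simp add: poly_sum poly_monom poly_power power2_eq_square algebra_simps)
  qed
  then have eq: "(\<Sum>j\<le>2 * r. monom (real ((2 * r) choose j) * c j) j) = smult I ([:1, 2 * (a \<bullet> b), 1:] ^ r)"
    by (simp flip: poly_eq_poly_eq_iff add: fun_eq_iff del: poly_smult)
  show ?thesis
    using arg_cong[OF eq, of "\<lambda>P. coeff P j"] j
    by (simp add: coeff_sum coeff_monom c_def I_def mult.commute)
qed

text \<open>The antipodal map preserves \<open>usphere\<close> and changes the sign of the
  integrand.\<close>

lemma integral_usphere_odd:
  fixes a b :: "real ^ 'n::finite"
  assumes "odd (i + j)"
  shows "(LINT w|usphere. (w \<bullet> a) ^ i * (w \<bullet> b) ^ j) = 0"
proof -
  have T: "orthogonal_transformation (uminus :: real ^ 'n \<Rightarrow> _)"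
    by (simp add: orthogonal_transformation_def linear_uminus)
  have "(LINT w|usphere. (w \<bullet> a) ^ i * (w \<bullet> b) ^ j) = (LINT w|distr usphere usphere uminus. (w \<bullet> a) ^ i * (w \<bullet> b) ^ j)"
    by (simp add: orthogonal_transformation_usphere[OF T])
  also have "\<dots> = (LINT w|usphere. (- (w \<bullet> a)) ^ i * (- (w \<bullet> b)) ^ j)"
    by (subst integral_distr[OF orthogonal_transformation_usphere(1)[OF T]]) simp_all
  also have "\<dots> = (LINT w|usphere. - ((w \<bullet> a) ^ i * (w \<bullet> b) ^ j))"
  proof (rule Bochner_Integration.integral_cong[OF refl])
    fix w :: "real ^ 'n"
    have "(- (w \<bullet> a)) ^ i * (- (w \<bullet> b)) ^ j = (-1) ^ (i + j) * ((w \<bullet> a) ^ i * (w \<bullet> b) ^ j)"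
      by (subst (1 2) power_minus) (simp add: power_add)
    then show "(- (w \<bullet> a)) ^ i * (- (w \<bullet> b)) ^ j = - ((w \<bullet> a) ^ i * (w \<bullet> b) ^ j)"
      using assms by simp
  qed
  finally show ?thesis by simp
qed

text \<open>For \<open>a \<bullet> b = 0\<close> the generating quadratic is \<open>1 + t^2\<close>;
  its coefficient at \<open>t^2\<close> is what the recursion of the moments uses.\<close>

lemma coeff_quadratic_power_2: "coeff ([:1, 0, 1::real:] ^ r) 0 = 1 \<and> coeff ([:1, 0, 1::real:] ^ r) 2 = real r"
  by (induction r) (auto simp: coeff_pCons numeral_2_eq_2)

text \<open>The source of the degree bound for zonal convolutions: in the expansion every factor
  \<open>s\<close> comes with a factor of the variable.\<close>

lemma coeff_quadratic_power_poly:
  "\<exists>R :: real poly. degree R \<le> j \<and> (\<forall>s. coeff ([:1, 2 * s, 1:] ^ r) j = poly R s)"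
proof (induction r arbitrary: j)
  case 0
  show ?case by (intro exI[of _ "[:of_bool (j = 0):]"]) auto
next
  case (Suc r)
  obtain R :: "nat \<Rightarrow> real poly" where R: "\<And>j. degree (R j) \<le> j" "\<And>j s. coeff ([:1, 2 * s, 1:] ^ r) j = poly (R j) s"
    using Suc by metis
  consider "j = 0" | "j = 1" | i where "j = Suc (Suc i)" by (metis One_nat_def not0_implies_Suc)
  then show ?case
  proof cases
    case 1
    then show ?thesis using R by (intro exI[of _ "R 0"]) auto
  next
    case 2
    have "degree (R 1 + [:0, 2:] * R 0) \<le> 1"
      using R(1)[of 1] R(1)[of 0] by (intro degree_add_le order.trans[OF degree_mult_le]) auto
    then show ?thesis using R 2
      by (intro exI[of _ "R 1 + [:0, 2:] * R 0"]) (auto simp: coeff_pCons)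
  next
    case 3
    have "degree (R j + [:0, 2:] * R (Suc i) + R i) \<le> j"
      using R(1)[of j] R(1)[of "Suc i"] R(1)[of i] 3
      by (intro degree_add_le order.trans[OF degree_mult_le]) auto
    then show ?thesis using R 3
      by (intro exI[of _ "R j + [:0, 2:] * R (Suc i) + R i"]) (auto simp: coeff_pCons)
  qed
qed

text \<open>Inserting \<open>norm w ^ 2 = 1\<close> and summing over the axes relates
  \<open>I (2 * r)\<close> to \<open>I (2 * r + 2)\<close> and to mixed moments along orthogonal
  axes. Each of the latter equals \<open>I (2 * r + 2) / (2 * r + 1)\<close> by
  \<open>integral_usphere_mixed_power\<close>, and the result is the recursion of
  \<open>zmom\<close>.\<close>

lemma integral_usphere_power:
  fixes e :: "real ^ 'n::finite"
  assumes e: "norm e = 1" and p: "CARD('n) \<ge> 2"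
  shows "(LINT w|usphere. (w \<bullet> e) ^ m) = zmom CARD('n) m"
proof -
  fix k :: 'n
  define a :: "real ^ 'n" where "a = axis k 1"
  define I where "I m = (LINT w|usphere. (w \<bullet> a) ^ m)" for m
  have a: "norm a = 1" by (simp add: a_def)
  have rec: "(2 * real r + 1) * I (2 * r) = (2 * real r + real CARD('n)) * I (2 * r + 2)" for r
  proof -
    have J: "(2 * real r + 1) * (LINT w|usphere. (w \<bullet> a) ^ (2 * r) * (w \<bullet> axis i 1)\<^sup>2) = I (2 * r + 2)" if "i \<noteq> k" for i
    proof -
      have i: "norm (axis i 1 :: real ^ 'n) = 1" "a \<bullet> axis i 1 = 0"
        using that by (auto simp: a_def inner_axis_axis)
      have "real ((2 * Suc r) choose 2) * (LINT w|usphere. (w \<bullet> a) ^ (2 * r) * (w \<bullet> axis i 1)\<^sup>2) =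
         (real r + 1) * I (2 * r + 2)"
        using integral_usphere_mixed_power[OF a i(1) a, of 2 "Suc r"] coeff_quadratic_power_2[of "Suc r"]
        by (simp add: i(2) I_def add.commute)
      moreover have "real ((2 * Suc r) choose 2) = (real r + 1) * (2 * real r + 1)"
        by (simp add: choose_two field_simps real_of_nat_div)
      ultimately show ?thesis by simp
    qed
    have "I (2 * r) = (LINT w|usphere. (\<Sum>i\<in>UNIV. (w \<bullet> a) ^ (2 * r) * (w \<bullet> axis i 1)\<^sup>2))"
      unfolding I_def
    proof (rule Bochner_Integration.integral_cong[OF refl])
      fix w :: "real ^ 'n" assume "w \<in> space usphere"
      then have "w \<bullet> w = 1" by (simp add: norm_eq_1)
      then have "(\<Sum>i\<in>UNIV. (w $ i)\<^sup>2) = 1" by (simp add: inner_vec_def power2_eq_square)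
      then show "(w \<bullet> a) ^ (2 * r) = (\<Sum>i\<in>UNIV. (w \<bullet> a) ^ (2 * r) * (w \<bullet> axis i 1)\<^sup>2)"
        by (simp add: inner_axis flip: sum_distrib_left)
    qed
    also have "\<dots> = (\<Sum>i\<in>UNIV. LINT w|usphere. (w \<bullet> a) ^ (2 * r) * (w \<bullet> axis i 1)\<^sup>2)"
      by (subst Bochner_Integration.integral_sum) (auto intro!: usphere.integrable_bdd_meas bdd_meas_mult bdd_meas_power)
    also have "\<dots> = (LINT w|usphere. (w \<bullet> a) ^ (2 * r) * (w \<bullet> axis k 1)\<^sup>2) +
        (\<Sum>i\<in>UNIV - {k}. LINT w|usphere. (w \<bullet> a) ^ (2 * r) * (w \<bullet> axis i 1)\<^sup>2)"
      by (rule sum.remove) auto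
    also have "(LINT w|usphere. (w \<bullet> a) ^ (2 * r) * (w \<bullet> axis k 1)\<^sup>2) = I (2 * r + 2)"
      by (simp add: I_def a_def power_add power2_eq_square mult_ac)
    also have "(\<Sum>i\<in>UNIV - {k}. LINT w|usphere. (w \<bullet> a) ^ (2 * r) * (w \<bullet> axis i 1)\<^sup>2) =
       (\<Sum>i\<in>UNIV - {k}. I (2 * r + 2) / (2 * real r + 1))"
    proof (rule sum.cong[OF refl])
      fix i assume "i \<in> UNIV - {k}"
      then show "(LINT w|usphere. (w \<bullet> a) ^ (2 * r) * (w \<bullet> axis i 1)\<^sup>2) = I (2 * r + 2) / (2 * real r + 1)"
        using J[of i] by (simp add: field_simps)
    qed
    also have "\<dots> = (real CARD('n) - 1) * I (2 * r + 2) / (2 * real r + 1)"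
      using p by (simp add: of_nat_diff)
    finally show ?thesis by (simp add: field_simps)
  qed
  have I: "I m = zmom CARD('n) m"
  proof (induction "CARD('n)" m rule: zmom.induct)
    case 1
    show ?case using usphere.prob_space by (simp add: I_def)
  next
    case 2
    show ?case using integral_usphere_odd[of 1 0 a 0] by (simp add: I_def)
  next
    case (3 m)
    show ?case
    proof (cases "even m")
      case True
      then obtain r where "m = 2 * r" by blast
      then show ?thesis using 3 rec[of r] p by (simp add: field_simps)
    next
      case False
      then have "I m = 0" "I (Suc (Suc m)) = 0"
        using integral_usphere_odd[of m 0 a 0] integral_usphere_odd[of "Suc (Suc m)" 0 a 0] by (auto simp: I_def)
      then show ?thesis using 3 by simp
    qed
  qed
  have "(LINT w|usphere. (w \<bullet> e) ^ m) = I m"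
    unfolding I_def by (subst integral_usphere_power_inner[OF a]) (simp add: e)
  then show ?thesis by (simp add: I)
qed

lemma integral_usphere_poly:
  fixes e :: "real ^ 'n::finite"
  assumes e: "norm e = 1" and p: "CARD('n) \<ge> 2"
  shows "(LINT w|usphere. poly P (w \<bullet> e)) = zmean CARD('n) P"
proof -
  have "(LINT w|usphere. poly P (w \<bullet> e)) = (LINT w|usphere. (\<Sum>i\<le>degree P. coeff P i * (w \<bullet> e) ^ i))"
    by (simp add: poly_altdef)
  also have "\<dots> = (\<Sum>i\<le>degree P. coeff P i * zmom CARD('n) i)"
    by (subst Bochner_Integration.integral_sum)
      (auto intro!: usphere.integrable_bdd_meas bdd_meas_mult bdd_meas_power simp: integral_usphere_power[OF e p])
  finally show ?thesis by (simp add: zmean_def)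
qed

section \<open>Zonal convolution\<close>

text \<open>For \<open>j \<le> i\<close>, \<open>integral_usphere_mixed_power\<close> gives a
  multiple of the coefficient at \<open>t ^ j\<close>, which is a polynomial in
  \<open>a \<bullet> b\<close> of degree at most \<open>j\<close>. Exchanging \<open>a\<close> and
  \<open>b\<close> covers the other case.\<close>

lemma zonal_convolution_power:
  assumes p: "CARD('n::finite) \<ge> 2"
  shows "\<exists>R. degree R \<le> min i j \<and> (\<forall>a b :: real ^ 'n. norm a = 1 \<longrightarrow> norm b = 1 \<longrightarrow>
     (LINT w|usphere. (w \<bullet> a) ^ i * (w \<bullet> b) ^ j) = poly R (a \<bullet> b))"
proof -
  have *: "\<exists>R. degree R \<le> min i j \<and> (\<forall>a b :: real ^ 'n. norm a = 1 \<longrightarrow> norm b = 1 \<longrightarrow>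
     (LINT w|usphere. (w \<bullet> a) ^ i * (w \<bullet> b) ^ j) = poly R (a \<bullet> b))" if "j \<le> i" for i j
  proof (cases "even (i + j)")
    case False
    then show ?thesis by (intro exI[of _ 0]) (simp add: integral_usphere_odd)
  next
    case True
    then obtain r where r: "i + j = 2 * r" by blast
    then have i: "i = 2 * r - j" "j \<le> 2 * r" by auto
    obtain Q :: "real poly" where Q: "degree Q \<le> j" "\<And>s. coeff ([:1, 2 * s, 1:] ^ r) j = poly Q s"
      using coeff_quadratic_power_poly[of j r] by auto
    define B where "B = real ((2 * r) choose j)"
    have B: "B \<noteq> 0" using i by (simp add: B_def)
    show ?thesis
    proof (intro exI[of _ "smult (zmom CARD('n) (2 * r) / B) Q"] conjI allI impI)
      show "degree (smult (zmom CARD('n) (2 * r) / B) Q) \<le> min i j"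
        using Q(1) that by (auto intro: order.trans[OF degree_smult_le])
      fix a b :: "real ^ 'n" assume ab: "norm a = 1" "norm b = 1"
      have "B * (LINT w|usphere. (w \<bullet> a) ^ i * (w \<bullet> b) ^ j) = poly Q (a \<bullet> b) * zmom CARD('n) (2 * r)"
        using integral_usphere_mixed_power[OF ab ab(1) i(2)] integral_usphere_power[OF ab(1) p]
        by (simp add: B_def i(1) Q(2))
      then show "(LINT w|usphere. (w \<bullet> a) ^ i * (w \<bullet> b) ^ j) = poly (smult (zmom CARD('n) (2 * r) / B) Q) (a \<bullet> b)"
        using B by (simp add: field_simps)
    qed
  qed
  show ?thesis
  proof (cases "j \<le> i")
    case True
    then show ?thesis by (rule *)
  next
    case False
    then obtain R where R: "degree R \<le> min j i" "\<And>a b :: real ^ 'n. norm a = 1 \<Longrightarrow> norm b = 1 \<Longrightarrow>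
     (LINT w|usphere. (w \<bullet> a) ^ j * (w \<bullet> b) ^ i) = poly R (a \<bullet> b)"
      using *[of i j] by auto
    show ?thesis
    proof (intro exI[of _ R] conjI allI impI)
      fix a b :: "real ^ 'n" assume ab: "norm a = 1" "norm b = 1"
      show "(LINT w|usphere. (w \<bullet> a) ^ i * (w \<bullet> b) ^ j) = poly R (a \<bullet> b)"
        using R(2)[OF ab(2,1)] by (simp only: mult.commute inner_commute[of b a])
    qed (use R(1) in auto)
  qed
qed

lemma zonal_convolution:
  assumes p: "CARD('n::finite) \<ge> 2"
  obtains R where "degree R \<le> min (degree P) (degree Q)"
    "\<And>a b :: real ^ 'n. norm a = 1 \<Longrightarrow> norm b = 1 \<Longrightarrow>
       (LINT w|usphere. poly P (w \<bullet> a) * poly Q (w \<bullet> b)) = poly R (a \<bullet> b)"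
proof -
  define rep where "rep i j R \<longleftrightarrow> degree R \<le> min i j \<and>
    (\<forall>a b :: real ^ 'n. norm a = 1 \<longrightarrow> norm b = 1 \<longrightarrow>
      (LINT w|usphere. (w \<bullet> a) ^ i * (w \<bullet> b) ^ j) = poly R (a \<bullet> b))" for i j and R :: "real poly"
  define R where "R i j = (SOME R. rep i j R)" for i j
  have "rep i j (R i j)" for i j
  proof -
    have "\<exists>R. rep i j R" using zonal_convolution_power[OF p, of i j] by (simp only: rep_def)
    then show ?thesis unfolding R_def by (rule someI_ex)
  qed
  then have R: "\<And>i j. degree (R i j) \<le> min i j" "\<And>i j. \<And>a b :: real ^ 'n. norm a = 1 \<Longrightarrow> norm b = 1 \<Longrightarrow>
     (LINT w|usphere. (w \<bullet> a) ^ i * (w \<bullet> b) ^ j) = poly (R i j) (a \<bullet> b)"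
    by (simp_all add: rep_def)
  define S where "S = (\<Sum>i\<le>degree P. \<Sum>j\<le>degree Q. smult (coeff P i * coeff Q j) (R i j))"
  show thesis
  proof
    have "degree (smult (coeff P i * coeff Q j) (R i j)) \<le> min (degree P) (degree Q)"
      if "i \<le> degree P" "j \<le> degree Q" for i j
      using R(1)[of i j] that by (intro order.trans[OF degree_smult_le]) linarith
    then show "degree S \<le> min (degree P) (degree Q)"
      unfolding S_def by (intro degree_sum_le) auto
    fix a b :: "real ^ 'n" assume ab: "norm a = 1" "norm b = 1"
    have "(LINT w|usphere. poly P (w \<bullet> a) * poly Q (w \<bullet> b)) =
      (LINT w|usphere. (\<Sum>i\<le>degree P. \<Sum>j\<le>degree Q. coeff P i * coeff Q j * ((w \<bullet> a) ^ i * (w \<bullet> b) ^ j)))"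
      by (simp add: poly_altdef sum_product mult_ac)
    also have "\<dots> = (\<Sum>i\<le>degree P. \<Sum>j\<le>degree Q. coeff P i * coeff Q j * poly (R i j) (a \<bullet> b))"
      using R(2)[OF ab]
      by (simp add: Bochner_Integration.integral_sum usphere.integrable_bdd_meas bdd_meas_mult bdd_meas_power bdd_meas_sum bdd_meas_inner)
    also have "\<dots> = poly S (a \<bullet> b)" by (simp add: S_def poly_sum)
    finally show "(LINT w|usphere. poly P (w \<bullet> a) * poly Q (w \<bullet> b)) = poly S (a \<bullet> b)" .
  qed
qed

text \<open>By Fubini, \<open>R * Q\<close> has the same integral as \<open>leg k\<close> times the convolution of \<open>P\<close> and \<open>Q\<close>, whose
  degree is at most that of \<open>Q\<close>.\<close>

lemma zonal_convolution_leg_aux: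
  fixes P :: "real poly"
  assumes p: "CARD('n::finite) \<ge> 2"
    and R: "\<And>a b :: real ^ 'n. norm a = 1 \<Longrightarrow> norm b = 1 \<Longrightarrow>
       (LINT w|usphere. poly (leg CARD('n) k) (w \<bullet> a) * poly P (w \<bullet> b)) = poly R (a \<bullet> b)"
    and j: "degree Q < k"
  shows "zmean CARD('n) (R * Q) = 0"
proof -
  obtain a :: "real ^ 'n" where a: "norm a = 1" by (rule vector_choose_size[of 1]) auto
  obtain S where S: "degree S \<le> min (degree P) (degree Q)"
    "\<And>a b :: real ^ 'n. norm a = 1 \<Longrightarrow> norm b = 1 \<Longrightarrow>
       (LINT w|usphere. poly P (w \<bullet> a) * poly Q (w \<bullet> b)) = poly S (a \<bullet> b)"
    by (rule zonal_convolution[OF p, of P Q]) (rule that)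
  define F where "F w b = poly (leg CARD('n) k) (w \<bullet> a) * poly P (w \<bullet> b) * poly Q (b \<bullet> a)" for w b :: "real ^ 'n"
  interpret pair: pair_prob_space "usphere :: (real ^ 'n) measure" "usphere :: (real ^ 'n) measure" ..
  have int: "integrable (usphere \<Otimes>\<^sub>M usphere) (\<lambda>(w, b). F w b)"
  proof -
    obtain A B C where "\<And>s. \<bar>s\<bar> \<le> 1 \<Longrightarrow> \<bar>poly (leg CARD('n) k) s\<bar> \<le> A"
       "\<And>s. \<bar>s\<bar> \<le> 1 \<Longrightarrow> \<bar>poly P s\<bar> \<le> B" "\<And>s. \<bar>s\<bar> \<le> 1 \<Longrightarrow> \<bar>poly Q s\<bar> \<le> C"
      by (metis poly_bounded_interval)
    then have "\<bar>F w b\<bar> \<le> A * B * C" if "norm w = 1" "norm b = 1" for w b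
      unfolding F_def abs_mult using abs_inner_unit_le[OF that(1) a] abs_inner_unit_le[OF that]
        abs_inner_unit_le[OF that(2) a]
      by (intro mult_mono') auto
    moreover have "(\<lambda>(w, b). F w b) \<in> borel_measurable (usphere \<Otimes>\<^sub>M usphere)"
      unfolding F_def split_beta' by measurable
    ultimately show ?thesis
      by (intro pair.integrable_const_bound[where B = "A * B * C"]) (auto simp: space_pair_measure intro!: AE_I2)
  qed
  have "zmean CARD('n) (R * Q) = (LINT b|usphere. poly R (a \<bullet> b) * poly Q (b \<bullet> a))"
    by (subst integral_usphere_poly[OF a p, symmetric]) (simp add: inner_commute)
  also have "\<dots> = (LINT b|usphere. LINT w|usphere. F w b)"
    by (rule Bochner_Integration.integral_cong) (auto simp: F_def R a)
  also have "\<dots> = (LINT w|usphere. LINT b|usphere. F w b)"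
    by (rule pair.Fubini_integral[OF int])
  also have "\<dots> = (LINT w|usphere. poly (leg CARD('n) k) (w \<bullet> a) * poly S (w \<bullet> a))"
  proof (rule Bochner_Integration.integral_cong[OF refl])
    fix w :: "real ^ 'n" assume "w \<in> space usphere"
    then have w: "norm w = 1" by simp
    have "(LINT b|usphere. F w b) = (LINT b|usphere. poly (leg CARD('n) k) (w \<bullet> a) * (poly P (b \<bullet> w) * poly Q (b \<bullet> a)))"
      by (simp add: F_def mult.assoc inner_commute)
    then show "(LINT b|usphere. F w b) = poly (leg CARD('n) k) (w \<bullet> a) * poly S (w \<bullet> a)"
      using S(2)[OF w a] by simp
  qed
  also have "\<dots> = zmean CARD('n) (S * leg CARD('n) k)"
    by (subst integral_usphere_poly[OF a p, symmetric]) (simp add: mult.commute)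
  also have "\<dots> = 0" by (rule zmean_orthogonal[OF p]) (use S(1) j in linarith)
  finally show ?thesis .
qed

text \<open>The convolution is a combination of \<open>leg j\<close> with
  \<open>j \<le> min k l\<close>. Applied to either factor, \<open>zonal_convolution_leg_aux\<close>
  makes it orthogonal to \<open>leg j\<close> for \<open>j < k\<close> and for \<open>j < l\<close>,
  so only \<open>j = k = l\<close> can remain.\<close>

lemma zonal_convolution_leg:
  fixes a b :: "real ^ 'n::finite"
  assumes p: "CARD('n) \<ge> 2" and a: "norm a = 1" and b: "norm b = 1"
  shows "(LINT w|usphere. poly (leg CARD('n) k) (w \<bullet> a) * poly (leg CARD('n) l) (w \<bullet> b)) =
    of_bool (k = l) * zmean CARD('n) (leg CARD('n) k * leg CARD('n) k) * poly (leg CARD('n) k) (a \<bullet> b)"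
proof -
  let ?p = "CARD('n)"
  obtain R where R0: "degree R \<le> min (degree (leg ?p k)) (degree (leg ?p l))"
    and R: "\<And>a b :: real ^ 'n. norm a = 1 \<Longrightarrow> norm b = 1 \<Longrightarrow>
       (LINT w|usphere. poly (leg ?p k) (w \<bullet> a) * poly (leg ?p l) (w \<bullet> b)) = poly R (a \<bullet> b)"
    by (rule zonal_convolution[OF p, of "leg ?p k" "leg ?p l"]) (rule that)
  have "degree R \<le> min k l" using R0 degree_leg_le[of ?p k] degree_leg_le[of ?p l] by linarith
  then obtain c where c: "R = (\<Sum>j\<le>min k l. smult (c j) (leg ?p j))"
    using poly_eq_sum_leg[OF p] by blast
  have cj: "c j * zmean ?p (leg ?p j * leg ?p j) = zmean ?p (R * leg ?p j)" if "j \<le> min k l" for j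
  proof -
    have "zmean ?p (R * leg ?p j) = (\<Sum>i\<le>min k l. c i * zmean ?p (leg ?p i * leg ?p j))"
      unfolding c by (simp add: sum_distrib_right zmean_sum zmean_smult)
    also have "\<dots> = (\<Sum>i\<le>min k l. if i = j then c j * zmean ?p (leg ?p j * leg ?p j) else 0)"
      by (rule sum.cong) (use zmean_leg_leg[OF p] in auto)
    finally show ?thesis using that by simp
  qed
  have R': "(LINT w|usphere. poly (leg ?p l) (w \<bullet> a) * poly (leg ?p k) (w \<bullet> b)) = poly R (a \<bullet> b)"
    if "norm a = 1" "norm b = 1" for a b :: "real ^ 'n"
    using R[OF that(2,1)] by (simp add: mult.commute inner_commute)
  have c0: "c j = 0" if "j \<le> min k l" "j < max k l" for j
  proof -
    have "zmean ?p (R * leg ?p j) = 0"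
    proof (cases "j < k")
      case True
      then show ?thesis
        using degree_leg_le[of ?p j] by (intro zonal_convolution_leg_aux[OF p R]) auto
    next
      case False
      then show ?thesis
        using degree_leg_le[of ?p j] that by (intro zonal_convolution_leg_aux[OF p R']) auto
    qed
    then show ?thesis using cj[OF that(1)] zmean_leg_square_pos[OF p, of j] by simp
  qed
  show ?thesis
  proof (cases "k = l")
    case False
    then have "R = 0" unfolding c using c0 by (intro sum.neutral) auto
    then show ?thesis using R[OF a b] False by simp
  next
    case True
    have "R = (\<Sum>j\<le>k. if j = k then smult (c k) (leg ?p k) else 0)"
      unfolding c True min.idem by (rule sum.cong) (use c0 True in auto)
    then have R_eq: "R = smult (c k) (leg ?p k)" by simp
    \<comment> \<open>The remaining coefficient is read off at \<open>b = a\<close>, where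
      \<open>leg\<close> has the value 1.\<close>
    have "c k = poly R (a \<bullet> a)" using a poly_leg_1[OF p, of k] by (simp add: R_eq dot_square_norm)
    also have "\<dots> = (LINT w|usphere. poly (leg ?p k * leg ?p k) (w \<bullet> a))"
      using R[OF a a] True by simp
    also have "\<dots> = zmean ?p (leg ?p k * leg ?p k)" by (rule integral_usphere_poly[OF a p])
    finally show ?thesis using R[OF a b] True by (simp add: R_eq)
  qed
qed

section \<open>Limit theorems for characteristic functions and Laplace transforms\<close>

text \<open>Compare \<open>z n ^ n\<close> with \<open>exp (z n - 1) ^ n\<close>, whose limit is
  known by assumption. In the unit disc the powers differ by at most \<open>n\<close> times the
  difference of the bases, and that difference is of second order in \<open>z n - 1\<close>, hence
  of order \<open>1 / n ^ 2\<close>.\<close>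

lemma exp_power_tendsto:
  fixes z :: "nat \<Rightarrow> complex"
  assumes z: "\<forall>\<^sub>F n in sequentially. norm (z n) \<le> 1"
    and lim: "(\<lambda>n. of_nat n * (z n - 1)) \<longlonglongrightarrow> c"
  shows "(\<lambda>n. z n ^ n) \<longlonglongrightarrow> exp c"
proof -
  define u where "u n = z n - 1" for n
  have exp_lim: "(\<lambda>n. exp (u n) ^ n) \<longlonglongrightarrow> exp c"
    using tendsto_exp[OF lim] by (simp add: u_def exp_of_nat_mult)
  have "(\<lambda>n. exp 2 * norm (of_nat n * u n) ^ 2 * inverse (real n)) \<longlonglongrightarrow> exp 2 * norm c ^ 2 * 0"
    using lim unfolding u_def[symmetric] by (intro tendsto_intros lim_inverse_n)
  then have bound0: "(\<lambda>n. exp 2 * norm (of_nat n * u n) ^ 2 * inverse (real n)) \<longlonglongrightarrow> 0" by simp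
  have "\<forall>\<^sub>F n in sequentially. norm (z n ^ n - exp (u n) ^ n) \<le> exp 2 * norm (of_nat n * u n) ^ 2 * inverse (real n)"
    using z eventually_gt_at_top[of 0]
  proof eventually_elim
    case (elim n)
    have "Re (z n) \<le> norm (z n)" "- Re (z n) \<le> norm (z n)"
      using abs_Re_le_cmod[of "z n"] by linarith+
    then have Re: "Re (u n) \<le> 0" "\<bar>Re (u n)\<bar> \<le> 2" using elim by (simp_all add: u_def)
    then have e1: "norm (exp (u n)) \<le> 1" by simp
    have "norm (exp (u n) - (\<Sum>k\<le>1. u n ^ k / fact k)) \<le> exp \<bar>Re (u n)\<bar> * norm (u n) ^ Suc 1 / fact 1"
      by (rule Taylor_exp)
    also have "\<dots> \<le> exp 2 * norm (u n) ^ 2"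
      using Re(2) by (simp add: power2_eq_square mult_right_mono)
    finally have "norm (z n - exp (u n)) \<le> exp 2 * norm (u n) ^ 2"
      by (simp add: u_def norm_minus_commute)
    then have "real n * norm (z n - exp (u n)) \<le> real n * (exp 2 * norm (u n) ^ 2)"
      by (intro mult_left_mono) auto
    also have "\<dots> = exp 2 * norm (of_nat n * u n) ^ 2 * inverse (real n)"
      using elim by (simp add: norm_mult power_mult_distrib power2_eq_square field_simps)
    finally show ?case
      using norm_power_diff[OF _ e1, of "z n" n] elim by linarith
  qed
  from Lim_null_comparison[OF this bound0] have "(\<lambda>n. z n ^ n - exp (u n) ^ n) \<longlonglongrightarrow> 0" .
  from tendsto_add[OF this exp_lim] show ?thesis by simp
qed

text \<open>A central limit theorem for rows of uniformly bounded i.i.d. variables, by expansion of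
  the characteristic function to second order. The second moments are not centred: the means are of
  order \<open>1 / sqrt n\<close>, so their squares do not influence the limit.\<close>

lemma char_triangular_tendsto:
  fixes D :: "nat \<Rightarrow> real measure"
  assumes D: "\<forall>\<^sub>F n in sequentially. real_distribution (D n) \<and> (AE x in D n. \<bar>x\<bar> \<le> B)"
    and m1: "(\<lambda>n. sqrt (real n) * (LINT x|D n. x)) \<longlonglongrightarrow> m"
    and m2: "(\<lambda>n. LINT x|D n. x\<^sup>2) \<longlonglongrightarrow> v"
  shows "(\<lambda>n. char (D n) (1 / sqrt (real n)) ^ n) \<longlonglongrightarrow> exp (\<i> * of_real m - of_real v / 2)"
proof (rule exp_power_tendsto)
  show "\<forall>\<^sub>F n in sequentially. norm (char (D n) (1 / sqrt (real n))) \<le> 1"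
    using D by eventually_elim (auto intro: real_distribution.cmod_char_le_1)
  define B' where "B' = max B 0"
  define A where "A n = \<i> * of_real (sqrt (real n) * (LINT x|D n. x)) - of_real (LINT x|D n. x\<^sup>2) / 2" for n
  have "(\<lambda>n. B' ^ 3 * inverse (sqrt (real n))) \<longlonglongrightarrow> B' ^ 3 * 0"
    by (intro tendsto_intros tendsto_inverse_0_at_top filterlim_compose[OF sqrt_at_top filterlim_real_sequentially])
  then have bound0: "(\<lambda>n. B' ^ 3 * inverse (sqrt (real n))) \<longlonglongrightarrow> 0" by simp
  have "\<forall>\<^sub>F n in sequentially. norm (of_nat n * (char (D n) (1 / sqrt (real n)) - 1) - A n) \<le> B' ^ 3 * inverse (sqrt (real n))"
    using D eventually_gt_at_top[of 0]
  proof eventually_elim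
    case (elim n)
    then interpret real_distribution "D n" by simp
    have bd: "AE x in D n. \<bar>x\<bar> \<le> B'" using elim by (auto simp: B'_def)
    have int: "integrable (D n) (\<lambda>x. x ^ k)" for k
    proof (rule integrable_const_bound)
      show "AE x in D n. norm (x ^ k) \<le> B' ^ k"
        using bd by eventually_elim (simp add: power_abs power_mono)
    qed simp
    define t where "t = 1 / sqrt (real n)"
    have t: "t > 0" "real n * t\<^sup>2 = 1" "real n * t = sqrt (real n)"
      using elim by (auto simp: t_def power_divide real_div_sqrt)
    have "norm (char (D n) t - (\<Sum>k\<le>2. ((\<i> * t) ^ k / fact k) * expectation (\<lambda>x. x ^ k))) \<le>
      (\<bar>t\<bar>\<^sup>2 / fact (Suc 2)) * expectation (\<lambda>x. min (2 * \<bar>x\<bar>\<^sup>2 * real (Suc 2)) (\<bar>t\<bar> * \<bar>x\<bar> ^ Suc 2))"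
      by (rule char_approx2) (rule int)
    also have "\<dots> \<le> \<bar>t\<bar>\<^sup>2 / fact (Suc 2) * (t * B' ^ 3)"
    proof (intro mult_left_mono)
      have "AE x in D n. min (2 * \<bar>x\<bar>\<^sup>2 * real (Suc 2)) (\<bar>t\<bar> * \<bar>x\<bar> ^ Suc 2) \<le> t * B' ^ 3"
        using bd
      proof eventually_elim
        case (elim x)
        have "\<bar>t\<bar> * \<bar>x\<bar> ^ Suc 2 \<le> t * B' ^ 3"
            using power_mono[OF elim, of 3] t by simp
        then show ?case by linarith
      qed
      moreover have "integrable (D n) (\<lambda>x. min (2 * \<bar>x\<bar>\<^sup>2 * real (Suc 2)) (\<bar>t\<bar> * \<bar>x\<bar> ^ Suc 2))"
      proof (rule Bochner_Integration.integrable_bound)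
        show "integrable (D n) (\<lambda>x. 6 * x\<^sup>2)" using int[of 2] by simp
      qed auto
      ultimately have "expectation (\<lambda>x. min (2 * \<bar>x\<bar>\<^sup>2 * real (Suc 2)) (\<bar>t\<bar> * \<bar>x\<bar> ^ Suc 2)) \<le> expectation (\<lambda>_. t * B' ^ 3)"
        by (intro integral_mono_AE) auto
      then show "expectation (\<lambda>x. min (2 * \<bar>x\<bar>\<^sup>2 * real (Suc 2)) (\<bar>t\<bar> * \<bar>x\<bar> ^ Suc 2)) \<le> t * B' ^ 3"
        using prob_space by simp
    qed simp
    also have "\<dots> \<le> t\<^sup>2 * (t * B' ^ 3)"
      using t by (intro mult_right_mono) (auto simp: B'_def divide_le_eq)
    finally have *: "norm (char (D n) t - (\<Sum>k\<le>2. ((\<i> * t) ^ k / fact k) * expectation (\<lambda>x. x ^ k))) \<le> t\<^sup>2 * (t * B' ^ 3)" .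
    define T where "T = (\<Sum>k\<le>2. ((\<i> * t) ^ k / fact k) * expectation (\<lambda>x. x ^ k))"
    have T: "T =
       1 + \<i> * t * expectation (\<lambda>x. x) - t\<^sup>2 * expectation (\<lambda>x. x\<^sup>2) / 2"
      unfolding T_def using prob_space by (simp add: numeral_2_eq_2 power2_eq_square) (simp add: complex_eq_iff)
    have "of_nat n * (char (D n) t - 1) - A n = of_nat n * (char (D n) t - T) +
       (\<i> * expectation (\<lambda>x. x) * (of_real (real n * t) - of_real (sqrt (real n))) - (of_real (real n * t\<^sup>2) - 1) * expectation (\<lambda>x. x\<^sup>2) / 2)"
      by (simp add: A_def T algebra_simps diff_divide_distrib)
    also have "\<dots> = of_nat n * (char (D n) t - T)"
      unfolding t(2,3) by simp
    finally have "norm (of_nat n * (char (D n) t - 1) - A n) \<le> real n * (t\<^sup>2 * (t * B' ^ 3))"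
      using * by (simp add: norm_mult mult_left_mono T_def)
    also have "\<dots> = (real n * t\<^sup>2) * (t * B' ^ 3)" by simp
    also have "\<dots> = B' ^ 3 * inverse (sqrt (real n))"
      unfolding t(2) by (simp add: t_def inverse_eq_divide)
    finally show ?case by (simp add: t_def)
  qed
  from Lim_null_comparison[OF this bound0]
  have 1: "(\<lambda>n. of_nat n * (char (D n) (1 / sqrt (real n)) - 1) - A n) \<longlonglongrightarrow> 0" .
  have "A \<longlonglongrightarrow> \<i> * of_real m - of_real v / 2"
    unfolding A_def by (intro tendsto_intros m1 m2) auto
  from tendsto_add[OF 1 this] show "(\<lambda>n. of_nat n * (char (D n) (1 / sqrt (real n)) - 1)) \<longlonglongrightarrow> \<i> * of_real m - of_real v / 2"
    by simp
qed

text \<open>A continuous step function of \<open>x \<ge> 0\<close> is a continuous function of \<open>exp (- x) \<in> {0..1}\<close>, hence a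
  uniform limit of polynomials in \<open>exp (- x)\<close>.\<close>

lemma laplace_imp_weak_conv:
  fixes D :: "nat \<Rightarrow> real measure" and L :: "real measure"
  assumes D: "\<forall>\<^sub>F n in sequentially. real_distribution (D n) \<and> (AE x in D n. 0 \<le> x)"
    and L: "real_distribution L" "AE x in L. 0 \<le> x"
    and lap: "\<And>s. s \<ge> 0 \<Longrightarrow> (\<lambda>n. LINT x|D n. exp (- (s * x))) \<longlonglongrightarrow> (LINT x|L. exp (- (s * x)))"
  shows "weak_conv_m D L"
proof -
  \<comment> \<open>The exceptional \<open>n\<close> are filled with \<open>L\<close>, so that the
    criterion for weak convergence applies to a sequence consisting of distributions.\<close>
  define D' where "D' n = (if real_distribution (D n) \<and> (AE x in D n. 0 \<le> x) then D n else L)" for n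
  have D': "real_distribution (D' n)" "AE x in D' n. 0 \<le> x" for n
    using L by (cases "real_distribution (D n) \<and> (AE x in D n. 0 \<le> x)"; simp only: D'_def if_True if_False simp_thms)+
  have D'_eq: "\<forall>\<^sub>F n in sequentially. D' n = D n"
    using D by eventually_elim (simp add: D'_def)
  have lap': "(\<lambda>n. LINT x|D' n. exp (- x) ^ k) \<longlonglongrightarrow> (LINT x|L. exp (- x) ^ k)" for k
  proof -
    have "exp (- x) ^ k = exp (- (real k * x))" for x :: real
      by (simp add: exp_of_nat_mult[symmetric])
    then show ?thesis
      using lap[of "real k"] by (auto elim!: Lim_transform_eventually intro: eventually_mono[OF D'_eq])
  qed
  have "weak_conv_m D' L"
  proof (rule integral_cts_step_conv_imp_weak_conv[OF D'(1) L(1)])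
    fix a b :: real assume ab: "a < b"
    \<comment> \<open>The maximum keeps the logarithm away from 0. It does not change the step
      function, which is constant beyond \<open>b\<close>.\<close>
    define h where "h y = cts_step a b (- ln (max y (exp (- b))))" for y
    have h_exp: "h (exp (- x)) = cts_step a b x" for x
    proof -
      have "max (exp (- x)) (exp (- b)) = exp (- min x b)" by (simp add: max_def min_def)
      then show ?thesis using ab by (auto simp: h_def cts_step_def)
    qed
    have "continuous_on UNIV (cts_step a b)"
      using cts_step_uniformly_continuous[OF ab] by (rule uniformly_continuous_imp_continuous)
    then have cont: "continuous_on {0..1} h"
      unfolding h_def by (rule continuous_on_compose2)
        (auto intro!: continuous_intros less_imp_neq[symmetric] simp: less_max_iff_disj)
    show "(\<lambda>n. integral\<^sup>L (D' n) (cts_step a b)) \<longlonglongrightarrow> integral\<^sup>L L (cts_step a b)"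
    proof (rule LIMSEQ_I)
      fix e :: real assume e: "e > 0"
      obtain g where g: "real_polynomial_function g" "\<And>x. x \<in> {0..1} \<Longrightarrow> \<bar>h x - g x\<bar> < e / 3"
        using Stone_Weierstrass_real_polynomial_function[OF compact_Icc cont, of "e / 3"] e by auto
      obtain c N where gs: "g = (\<lambda>x. \<Sum>i\<le>N. c i * x ^ i)"
        using g(1) unfolding real_polynomial_function_iff_sum by blast
      have close: "\<bar>integral\<^sup>L R (cts_step a b) - (\<Sum>i\<le>N. c i * (LINT x|R. exp (- x) ^ i))\<bar> \<le> e / 3"
        if R: "real_distribution R" "AE x in R. 0 \<le> x" for R
      proof -
        interpret R: real_distribution R by (rule R(1))
        have int: "integrable R (\<lambda>x. exp (- x) ^ i)" for i
        proof (rule R.integrable_const_bound)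
          show "AE x in R. norm (exp (- x) ^ i) \<le> 1"
            using R(2) by eventually_elim (simp add: power_le_one)
        qed simp
        have gi: "integrable R (\<lambda>x. g (exp (- x)))"
          unfolding gs by (intro Bochner_Integration.integrable_sum integrable_mult_right int)
        have "(\<Sum>i\<le>N. c i * (LINT x|R. exp (- x) ^ i)) = (LINT x|R. g (exp (- x)))"
          unfolding gs using int by (simp add: Bochner_Integration.integral_sum)
        then have "integral\<^sup>L R (cts_step a b) - (\<Sum>i\<le>N. c i * (LINT x|R. exp (- x) ^ i)) =
          (LINT x|R. cts_step a b x - g (exp (- x)))"
          using gi R.integrable_cts_step[OF ab] by simp
        also have "\<bar>\<dots>\<bar> \<le> (LINT x|R. \<bar>cts_step a b x - g (exp (- x))\<bar>)"
          using integral_norm_bound[of R "\<lambda>x. cts_step a b x - g (exp (- x))"] by simp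
        also have "\<dots> \<le> (LINT x|R. e / 3)"
        proof (rule integral_mono_AE)
          show "integrable R (\<lambda>x. \<bar>cts_step a b x - g (exp (- x))\<bar>)"
            using gi R.integrable_cts_step[OF ab] by auto
          show "AE x in R. \<bar>cts_step a b x - g (exp (- x))\<bar> \<le> e / 3"
            using R(2)
          proof eventually_elim
            case (elim x)
            then show ?case using g(2)[of "exp (- x)"] by (simp add: h_exp)
          qed
        qed simp
        also have "\<dots> = e / 3" using R.prob_space by simp
        finally show ?thesis .
      qed
      have "(\<lambda>n. \<Sum>i\<le>N. c i * (LINT x|D' n. exp (- x) ^ i)) \<longlonglongrightarrow> (\<Sum>i\<le>N. c i * (LINT x|L. exp (- x) ^ i))"
        by (intro tendsto_intros lap')
      from LIMSEQ_D[OF this, of "e / 3"] e obtain n0 where n0: "\<And>n. n \<ge> n0 \<Longrightarrow>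
          norm ((\<Sum>i\<le>N. c i * (LINT x|D' n. exp (- x) ^ i)) - (\<Sum>i\<le>N. c i * (LINT x|L. exp (- x) ^ i))) < e / 3"
        by auto
      show "\<exists>n0. \<forall>n\<ge>n0. norm (integral\<^sup>L (D' n) (cts_step a b) - integral\<^sup>L L (cts_step a b)) < e"
      proof (intro exI[of _ n0] allI impI)
        fix n assume "n \<ge> n0"
        from n0[OF this] close[OF L] close[OF D', of n]
        show "norm (integral\<^sup>L (D' n) (cts_step a b) - integral\<^sup>L L (cts_step a b)) < e"
          unfolding real_norm_def by linarith
      qed
    qed
  qed
  moreover have "\<forall>\<^sub>F n in sequentially. cdf (D' n) x = cdf (D n) x" for x
    using D'_eq by eventually_elim simp
  ultimately show ?thesis
    unfolding weak_conv_m_def weak_conv_def by (blast intro: Lim_transform_eventually)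
qed

section \<open>Laplace transforms of sums of squares\<close>

abbreviation "normal_dist \<mu> \<equiv> density lborel (\<lambda>x. ennreal (normal_density \<mu> 1 x))"

lemma prob_space_normal_dist: "prob_space (normal_dist \<mu>)"
  by (rule prob_space_normal_density) simp

lemma char_normal_dist: "char (normal_dist \<mu>) t = iexp (t * \<mu>) * of_real (exp (- (t\<^sup>2) / 2))"
proof -
  have "char (normal_dist \<mu>) t = (LINT x|lborel. normal_density \<mu> 1 x *\<^sub>R iexp (t * x))"
    unfolding char_def by (rule integral_density) auto
  also have "\<dots> = (LINT x|lborel. normal_density \<mu> 1 (\<mu> + 1 * x) *\<^sub>R iexp (t * (\<mu> + 1 * x)))"
    by (subst lborel_integral_real_affine[where c = 1 and t = \<mu>]) simp_all
  also have "\<dots> = (LINT x|lborel. iexp (t * \<mu>) * (std_normal_density x *\<^sub>R iexp (t * x)))"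
    by (rule Bochner_Integration.integral_cong)
      (auto simp: normal_density_def exp_add[symmetric] algebra_simps scaleR_conv_of_real)
  also have "\<dots> = iexp (t * \<mu>) * (LINT x|lborel. std_normal_density x *\<^sub>R iexp (t * x))"
    by (rule integral_mult_right_zero)
  also have "(LINT x|lborel. std_normal_density x *\<^sub>R iexp (t * x)) = char std_normal_distribution t"
    unfolding char_def by (rule integral_density[symmetric]) auto
  finally show ?thesis by (simp add: char_std_normal_distribution)
qed

lemma integral_iexp_normal_product:
  assumes "finite I"
  shows "(LINT z|Pi\<^sub>M I (\<lambda>i. normal_dist (\<mu> i)). iexp (\<Sum>i\<in>I. a i * z i)) =
    iexp (\<Sum>i\<in>I. a i * \<mu> i) * of_real (exp (- (\<Sum>i\<in>I. (a i)\<^sup>2) / 2))"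
proof -
  interpret product_prob_space "\<lambda>i. normal_dist (\<mu> i)" I
    by (rule product_prob_spaceI) (rule prob_space_normal_dist)
  have int: "integrable (normal_dist (\<mu> i)) (\<lambda>x. iexp (a i * x))" for i
    by (rule finite_measure.integrable_const_bound[where B = 1])
      (auto intro: prob_space.finite_measure prob_space_normal_dist)
  have "(LINT z|Pi\<^sub>M I (\<lambda>i. normal_dist (\<mu> i)). iexp (\<Sum>i\<in>I. a i * z i)) =
    (LINT z|Pi\<^sub>M I (\<lambda>i. normal_dist (\<mu> i)). (\<Prod>i\<in>I. iexp (a i * z i)))"
    using assms by (simp add: exp_sum sum_distrib_left)
  also have "\<dots> = (\<Prod>i\<in>I. LINT x|normal_dist (\<mu> i). iexp (a i * x))"
    by (rule product_integral_prod[OF assms int])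
  also have "\<dots> = (\<Prod>i\<in>I. iexp (a i * \<mu> i) * of_real (exp (- ((a i)\<^sup>2) / 2)))"
    using char_normal_dist by (simp add: char_def)
  also have "\<dots> = (\<Prod>i\<in>I. iexp (a i * \<mu> i)) * of_real (\<Prod>i\<in>I. exp (- ((a i)\<^sup>2) / 2))"
    by (simp add: prod.distrib)
  also have "\<dots> = iexp (\<Sum>i\<in>I. a i * \<mu> i) * of_real (exp (- (\<Sum>i\<in>I. (a i)\<^sup>2) / 2))"
    using assms by (simp add: exp_sum[symmetric] sum_distrib_left sum_negf sum_divide_distrib)
  finally show ?thesis .
qed

lemma PiM_component_borel:
  assumes "i \<in> I" "sets (L i) = sets borel"
  shows "(\<lambda>z. z i) \<in> borel_measurable (Pi\<^sub>M I L)"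
  using measurable_component_singleton[OF assms(1), of L] by (simp add: measurable_cong_sets[OF refl assms(2)])

lemma borel_measurable_iexp_sum:
  fixes X :: "'i \<Rightarrow> 'a \<Rightarrow> real" and L :: "'i \<Rightarrow> real measure"
  assumes X: "\<And>i. i \<in> I \<Longrightarrow> X i \<in> borel_measurable M"
    and L: "\<And>i. i \<in> I \<Longrightarrow> sets (L i) = sets borel"
  shows "(\<lambda>(z, w). iexp (\<Sum>i\<in>I. z i * X i w)) \<in> borel_measurable (Pi\<^sub>M I L \<Otimes>\<^sub>M M)"
proof -
  have "(\<lambda>x. \<Sum>i\<in>I. fst x i * X i (snd x)) \<in> borel_measurable (Pi\<^sub>M I L \<Otimes>\<^sub>M M)"
  proof (rule borel_measurable_sum)
    fix i assume i: "i \<in> I"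
    have [measurable]: "(\<lambda>x. X i (snd x)) \<in> borel_measurable (Pi\<^sub>M I L \<Otimes>\<^sub>M M)"
      by (rule measurable_compose[OF measurable_snd X[OF i]])
    have [measurable]: "(\<lambda>x. fst x i) \<in> borel_measurable (Pi\<^sub>M I L \<Otimes>\<^sub>M M)"
      by (rule measurable_compose[OF measurable_fst PiM_component_borel[where L = L, OF i L[OF i]]])
    show "(\<lambda>x. fst x i * X i (snd x)) \<in> borel_measurable (Pi\<^sub>M I L \<Otimes>\<^sub>M M)"
      by measurable
  qed
  then show ?thesis unfolding split_beta' by measurable
qed

text \<open>Each square is linearised by \<open>exp (- x\<^sup>2 / 2) = E exp (\<i> z x)\<close> with \<open>z\<close> standard normal.\<close>

lemma laplace_sum_squares:
  fixes X :: "'i \<Rightarrow> 'a \<Rightarrow> real"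
  assumes M: "prob_space M" and I: "finite I" and X: "\<And>i. i \<in> I \<Longrightarrow> X i \<in> borel_measurable M"
  shows "complex_of_real (LINT w|M. exp (- (\<Sum>i\<in>I. (X i w)\<^sup>2) / 2)) =
    (LINT z|Pi\<^sub>M I (\<lambda>_. normal_dist 0). LINT w|M. iexp (\<Sum>i\<in>I. z i * X i w))"
proof -
  interpret M: prob_space M by (rule M)
  interpret G: product_prob_space "\<lambda>_. normal_dist 0" I
    by (rule product_prob_spaceI) (rule prob_space_normal_dist)
  interpret pair: pair_prob_space "Pi\<^sub>M I (\<lambda>_. normal_dist 0)" M
    by unfold_locales
  have int: "integrable (Pi\<^sub>M I (\<lambda>_. normal_dist 0) \<Otimes>\<^sub>M M) (\<lambda>(z, w). iexp (\<Sum>i\<in>I. z i * X i w))"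
  proof (rule pair.integrable_const_bound[where B = 1])
    show "(\<lambda>(z, w). iexp (\<Sum>i\<in>I. z i * X i w)) \<in> borel_measurable (Pi\<^sub>M I (\<lambda>_. normal_dist 0) \<Otimes>\<^sub>M M)"
      by (rule borel_measurable_iexp_sum[OF X]) simp_all
  qed (simp add: split_beta')
  have "complex_of_real (LINT w|M. exp (- (\<Sum>i\<in>I. (X i w)\<^sup>2) / 2)) =
     (LINT w|M. complex_of_real (exp (- (\<Sum>i\<in>I. (X i w)\<^sup>2) / 2)))"
    by (rule integral_complex_of_real[symmetric])
  also have "\<dots> = (LINT w|M. LINT z|Pi\<^sub>M I (\<lambda>_. normal_dist 0). iexp (\<Sum>i\<in>I. z i * X i w))"
  proof (rule Bochner_Integration.integral_cong[OF refl])
    fix w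
    have "(\<Sum>i\<in>I. z i * X i w) = (\<Sum>i\<in>I. X i w * z i)" for z
      by (intro sum.cong mult.commute refl)
    then show "complex_of_real (exp (- (\<Sum>i\<in>I. (X i w)\<^sup>2) / 2)) =
        (LINT z|Pi\<^sub>M I (\<lambda>_. normal_dist 0). iexp (\<Sum>i\<in>I. z i * X i w))"
      using integral_iexp_normal_product[OF I, where a = "\<lambda>i. X i w" and \<mu> = "\<lambda>_. 0"]
      by (simp del: of_real_sum)
  qed
  also have "\<dots> = (LINT z|Pi\<^sub>M I (\<lambda>_. normal_dist 0). LINT w|M. iexp (\<Sum>i\<in>I. z i * X i w))"
    by (rule pair.Fubini_integral[OF int])
  finally show ?thesis .
qed

text \<open>By \<open>laplace_sum_squares\<close> both transforms are averages of characteristic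
  functions over the same auxiliary Gaussian vector. The integrands converge pointwise and are
  bounded by 1, so dominated convergence applies. The factors \<open>c i\<close> are absorbed into
  the argument of the characteristic function.\<close>

lemma laplace_sum_squares_tendsto:
  fixes X :: "nat \<Rightarrow> 'i \<Rightarrow> 'a \<Rightarrow> real"
  assumes I: "finite I"
    and M: "\<forall>\<^sub>F n in sequentially. prob_space (M n) \<and> (\<forall>i\<in>I. X n i \<in> borel_measurable (M n))"
    and char: "\<And>a. (\<lambda>n. LINT w|M n. iexp (\<Sum>i\<in>I. a i * X n i w)) \<longlonglongrightarrow>
      iexp (\<Sum>i\<in>I. a i * \<mu> i) * of_real (exp (- (\<Sum>i\<in>I. (a i)\<^sup>2) / 2))"
  shows "(\<lambda>n. LINT w|M n. exp (- (\<Sum>i\<in>I. (c i * X n i w)\<^sup>2) / 2)) \<longlonglongrightarrow>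
    (LINT z|Pi\<^sub>M I (\<lambda>i. normal_dist (\<mu> i)). exp (- (\<Sum>i\<in>I. (c i * z i)\<^sup>2) / 2))"
proof -
  let ?G = "Pi\<^sub>M I (\<lambda>_. normal_dist 0)" and ?N = "Pi\<^sub>M I (\<lambda>i. normal_dist (\<mu> i))"
  interpret G: product_prob_space "\<lambda>_. normal_dist 0" I
    by (rule product_prob_spaceI) (rule prob_space_normal_dist)
  interpret N: product_prob_space "\<lambda>i. normal_dist (\<mu> i)" I
    by (rule product_prob_spaceI) (rule prob_space_normal_dist)
  \<comment> \<open>For the exceptional \<open>n\<close> a point mass on a discrete space makes
    every function measurable.\<close>
  define M' where "M' n = (if prob_space (M n) \<and> (\<forall>i\<in>I. X n i \<in> borel_measurable (M n)) then M n
     else return (count_space UNIV) undefined)" for n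
  have M': "prob_space (M' n)" "\<And>i. i \<in> I \<Longrightarrow> X n i \<in> borel_measurable (M' n)" for n
    by (auto simp: M'_def intro!: prob_space_return)
  have M'_eq: "\<forall>\<^sub>F n in sequentially. M' n = M n"
    using M by eventually_elim (simp add: M'_def)
  define F where "F n z = (LINT w|M' n. iexp (\<Sum>i\<in>I. z i * (c i * X n i w)))" for n z
  define F0 where "F0 z = iexp (\<Sum>i\<in>I. (z i * c i) * \<mu> i) * of_real (exp (- (\<Sum>i\<in>I. (z i * c i)\<^sup>2) / 2))" for z
  have F: "complex_of_real (LINT w|M' n. exp (- (\<Sum>i\<in>I. (c i * X n i w)\<^sup>2) / 2)) = (LINT z|?G. F n z)" for n
    unfolding F_def by (rule laplace_sum_squares) (use M' I in auto)
  have comp: "(\<lambda>z. z i) \<in> borel_measurable ?N" "(\<lambda>z. z i) \<in> borel_measurable ?G" if "i \<in> I" for i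
    by (rule PiM_component_borel[OF that]; simp)+
  have N0: "complex_of_real (LINT z|?N. exp (- (\<Sum>i\<in>I. (c i * z i)\<^sup>2) / 2)) = (LINT z|?G. F0 z)"
  proof -
    have "complex_of_real (LINT z|?N. exp (- (\<Sum>i\<in>I. (c i * z i)\<^sup>2) / 2)) =
      (LINT z|?G. LINT w|?N. iexp (\<Sum>i\<in>I. z i * (c i * w i)))"
      by (rule laplace_sum_squares[OF _ I]) (auto intro: N.prob_space_axioms comp(1))
    also have "\<dots> = (LINT z|?G. F0 z)"
      unfolding F0_def integral_iexp_normal_product[OF I, symmetric] by (simp only: mult.assoc)
    finally show ?thesis .
  qed
  have "(\<lambda>n. LINT z|?G. F n z) \<longlonglongrightarrow> (LINT z|?G. F0 z)"
  proof (rule integral_dominated_convergence[where w = "\<lambda>_. 1"])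
    show "F0 \<in> borel_measurable ?G"
    proof -
      have "(\<lambda>z. \<Sum>i\<in>I. (z i * c i) * \<mu> i) \<in> borel_measurable ?G" "(\<lambda>z. \<Sum>i\<in>I. (z i * c i)\<^sup>2) \<in> borel_measurable ?G"
        using comp(2) by (auto intro!: borel_measurable_sum borel_measurable_times borel_measurable_power)
      then show ?thesis unfolding F0_def by measurable
    qed
    show "F n \<in> borel_measurable ?G" for n
    proof -
      interpret Mn: prob_space "M' n" by (rule M'(1))
      have "(\<lambda>(z, w). iexp (\<Sum>i\<in>I. z i * (c i * X n i w))) \<in> borel_measurable (?G \<Otimes>\<^sub>M M' n)"
        by (rule borel_measurable_iexp_sum) (simp_all add: M'(2) borel_measurable_times)
      then show ?thesis unfolding F_def by (rule Mn.borel_measurable_lebesgue_integral)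
    qed
    show "AE z in ?G. (\<lambda>n. F n z) \<longlonglongrightarrow> F0 z"
    proof (rule AE_I2)
      fix z
      have "(\<lambda>n. LINT w|M n. iexp (\<Sum>i\<in>I. z i * c i * X n i w)) \<longlonglongrightarrow> F0 z"
        unfolding F0_def by (rule char)
      then show "(\<lambda>n. F n z) \<longlonglongrightarrow> F0 z"
        by (rule Lim_transform_eventually)
          (use M'_eq in eventually_elim, simp add: F_def mult.assoc)
    qed
    show "AE z in ?G. norm (F n z) \<le> 1" for n
    proof (rule AE_I2)
      fix z
      interpret Mn: prob_space "M' n" by (rule M'(1))
      have "norm (F n z) \<le> (LINT w|M' n. norm (iexp (\<Sum>i\<in>I. z i * (c i * X n i w))))"
        unfolding F_def by (rule integral_norm_bound)
      then show "norm (F n z) \<le> 1" by (simp add: Mn.prob_space)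
    qed
  qed simp
  then have "(\<lambda>n. complex_of_real (LINT w|M' n. exp (- (\<Sum>i\<in>I. (c i * X n i w)\<^sup>2) / 2))) \<longlonglongrightarrow>
     complex_of_real (LINT z|?N. exp (- (\<Sum>i\<in>I. (c i * z i)\<^sup>2) / 2))"
    by (simp only: F N0)
  then have "(\<lambda>n. LINT w|M' n. exp (- (\<Sum>i\<in>I. (c i * X n i w)\<^sup>2) / 2)) \<longlonglongrightarrow>
     (LINT z|?N. exp (- (\<Sum>i\<in>I. (c i * z i)\<^sup>2) / 2))"
    by (simp only: tendsto_of_real_iff)
  then show ?thesis
    by (rule Lim_transform_eventually) (use M'_eq in eventually_elim, simp)
qed

text \<open>Completing the square turns the integrand into a constant times the normal density with
  mean \<open>\<mu> / (1 + 2 * s)\<close> and variance \<open>1 / (1 + 2 * s)\<close>.\<close>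

lemma laplace_normal_square:
  assumes s: "s \<ge> 0"
  shows "(LINT x|normal_dist \<mu>. exp (- (s * x\<^sup>2))) = exp (- (s * \<mu>\<^sup>2) / (1 + 2 * s)) / sqrt (1 + 2 * s)"
proof -
  define r where "r = 1 / sqrt (1 + 2 * s)"
  have r: "r > 0" "r\<^sup>2 = 1 / (1 + 2 * s)" using s by (auto simp: r_def power_divide)
  have "(LINT x|normal_dist \<mu>. exp (- (s * x\<^sup>2))) = (LINT x|lborel. normal_density \<mu> 1 x * exp (- (s * x\<^sup>2)))"
    by (subst integral_density) auto
  also have "\<dots> = (LINT x|lborel. exp (- (s * \<mu>\<^sup>2) / (1 + 2 * s)) * r * normal_density (\<mu> / (1 + 2 * s)) r x)"
  proof (rule Bochner_Integration.integral_cong[OF refl])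
    fix x :: real
    have ex: "- (x - \<mu>)\<^sup>2 / 2 - s * x\<^sup>2 = - (s * \<mu>\<^sup>2) / (1 + 2 * s) - (x - \<mu> / (1 + 2 * s))\<^sup>2 / (2 * r\<^sup>2)"
      unfolding r(2) using s by (simp add: divide_simps power2_eq_square) (simp add: algebra_simps)
    have sq: "r / sqrt (2 * pi * r\<^sup>2) = 1 / sqrt (2 * pi)"
      using r(1) by (simp add: real_sqrt_mult)
    have "normal_density \<mu> 1 x * exp (- (s * x\<^sup>2)) = 1 / sqrt (2 * pi) * exp (- (x - \<mu>)\<^sup>2 / 2 - s * x\<^sup>2)"
      by (simp add: normal_density_def exp_add[symmetric])
    also have "\<dots> = r / sqrt (2 * pi * r\<^sup>2) * (exp (- (s * \<mu>\<^sup>2) / (1 + 2 * s)) * exp (- (x - \<mu> / (1 + 2 * s))\<^sup>2 / (2 * r\<^sup>2)))"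
      unfolding ex sq by (simp add: exp_add[symmetric])
    also have "\<dots> = exp (- (s * \<mu>\<^sup>2) / (1 + 2 * s)) * r * normal_density (\<mu> / (1 + 2 * s)) r x"
      by (simp add: normal_density_def)
    finally show "normal_density \<mu> 1 x * exp (- (s * x\<^sup>2)) = exp (- (s * \<mu>\<^sup>2) / (1 + 2 * s)) * r * normal_density (\<mu> / (1 + 2 * s)) r x" .
  qed
  also have "\<dots> = exp (- (s * \<mu>\<^sup>2) / (1 + 2 * s)) * r"
    using r(1) by simp
  finally show ?thesis by (simp add: r_def)
qed

section \<open>The one-dimensional moments\<close>

definition zonal_weight :: "nat \<Rightarrow> real \<Rightarrow> real" where
  "zonal_weight p s = (1 - s\<^sup>2) powr ((real p - 3) / 2)"

lemma one_minus_sq_pos: "-1 < s \<Longrightarrow> s < (1::real) \<Longrightarrow> 0 < 1 - s\<^sup>2"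
  using abs_square_less_1[of s] by (simp add: abs_less_iff)

lemma tendsto_real_of_ereal_unit:
  "((F \<circ> real_of_ereal) \<longlongrightarrow> y) (at_right (-1)) \<longleftrightarrow> (F \<longlongrightarrow> y) (at_right (-1))"
  "((F \<circ> real_of_ereal) \<longlongrightarrow> y) (at_left 1) \<longleftrightarrow> (F \<longlongrightarrow> y) (at_left 1)"
  using ereal_tendsto_simps1(2)[of F y "-1"] ereal_tendsto_simps1(1)[of F y 1]
  by (simp_all add: one_ereal_def)

text \<open>This is the weight for \<open>p = 2\<close>, singular at both ends, with primitive
  \<open>arcsin\<close>. It dominates the weights for all \<open>p \<ge> 2\<close>, whose exponents
  are at least \<open>- 1 / 2\<close>.\<close>

lemma set_integrable_arcsin: "set_integrable lborel (einterval (-1) 1) (\<lambda>s::real. inverse (sqrt (1 - s\<^sup>2)))"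
proof (rule interval_integral_FTC_nonneg(1)[where F = arcsin and A = "- (pi / 2)" and B = "pi / 2"])
  fix x :: real assume "-1 < ereal x" "ereal x < 1"
  then have x: "-1 < x" "x < 1" by (simp_all add: one_ereal_def)
  then show "(arcsin has_real_derivative inverse (sqrt (1 - x\<^sup>2))) (at x)"
    by (rule DERIV_arcsin)
  show "isCont (\<lambda>s. inverse (sqrt (1 - s\<^sup>2))) x"
    using one_minus_sq_pos[OF x] by (intro continuous_intros) auto
next
  show "AE x in lborel. -1 < ereal x \<longrightarrow> ereal x < 1 \<longrightarrow> 0 \<le> inverse (sqrt (1 - x\<^sup>2))"
    by (rule AE_I2) (auto simp: one_ereal_def dest: one_minus_sq_pos intro: less_imp_le)
  have "continuous (at (-1) within {-1..1}) arcsin" "continuous (at 1 within {-1..1}) arcsin"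
    using continuous_on_arcsin' by (auto simp: continuous_on_eq_continuous_within)
  then have "(arcsin \<longlongrightarrow> - (pi / 2)) (at_right (-1))" "(arcsin \<longlongrightarrow> pi / 2) (at_left 1)"
    by (simp_all add: continuous_within at_within_Icc_at_right at_within_Icc_at_left)
  then show "((arcsin \<circ> real_of_ereal) \<longlongrightarrow> - (pi / 2)) (at_right (-1))"
     "((arcsin \<circ> real_of_ereal) \<longlongrightarrow> pi / 2) (at_left 1)"
    by (simp_all only: tendsto_real_of_ereal_unit)
qed (simp_all add: one_ereal_def)

lemma zonal_weight_measurable [measurable]: "zonal_weight p \<in> borel_measurable borel"
  unfolding zonal_weight_def by measurable

lemma zonal_weight_le:
  assumes "p \<ge> 2" "-1 < s" "s < 1"
  shows "zonal_weight p s \<le> inverse (sqrt (1 - s\<^sup>2))"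
proof -
  have "0 < 1 - s\<^sup>2" "1 - s\<^sup>2 \<le> 1" using one_minus_sq_pos assms by auto
  moreover have "- (1 / 2) \<le> (real p - 3) / 2" using assms by simp
  ultimately have "(1 - s\<^sup>2) powr ((real p - 3) / 2) \<le> (1 - s\<^sup>2) powr - (1 / 2)"
    by (intro powr_mono') auto
  then show ?thesis
    using \<open>0 < 1 - s\<^sup>2\<close> by (simp add: zonal_weight_def powr_minus powr_half_sqrt)
qed

lemma set_integrable_zonal_weight:
  assumes "p \<ge> 2"
  shows "set_integrable lborel (einterval (-1) 1) (\<lambda>s. s ^ m * zonal_weight p s)"
  unfolding set_integrable_def
proof (rule Bochner_Integration.integrable_bound[OF set_integrable_arcsin[unfolded set_integrable_def]])
  show "AE s in lborel. norm (indicat_real (einterval (-1) 1) s *\<^sub>R (s ^ m * zonal_weight p s)) \<le>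
      norm (indicat_real (einterval (-1) 1) s *\<^sub>R inverse (sqrt (1 - s\<^sup>2)))"
  proof (rule AE_I2)
    fix s :: real
    have "\<bar>s ^ m * zonal_weight p s\<bar> \<le> \<bar>inverse (sqrt (1 - s\<^sup>2))\<bar>" if s: "-1 < s" "s < 1"
    proof -
      have "\<bar>s\<bar> ^ m \<le> 1" using s by (intro power_le_one) auto
      then have "\<bar>s ^ m * zonal_weight p s\<bar> \<le> 1 * zonal_weight p s"
        unfolding abs_mult power_abs by (intro mult_mono) (auto simp: zonal_weight_def)
      also have "\<dots> \<le> inverse (sqrt (1 - s\<^sup>2))" using zonal_weight_le[OF assms s] by simp
      finally show ?thesis by linarith
    qed
    then show "norm (indicat_real (einterval (-1) 1) s *\<^sub>R (s ^ m * zonal_weight p s)) \<le>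
        norm (indicat_real (einterval (-1) 1) s *\<^sub>R inverse (sqrt (1 - s\<^sup>2)))"
      by (auto simp: indicator_def einterval_def one_ereal_def)
  qed
qed measurable

definition weight_moment :: "nat \<Rightarrow> nat \<Rightarrow> real" where
  "weight_moment p m = (LBINT s=-1..1. s ^ m * zonal_weight p s)"

text \<open>The integrand is the derivative of \<open>s ^ k * (1 - s^2) powr ((p - 1) / 2)\<close>,
  which vanishes at both ends. The case \<open>k = 0\<close>, where the factor \<open>real k\<close>
  neutralises the truncated exponent, gives the first moment; \<open>k = m + 1\<close> gives the
  recursion.\<close>

lemma weight_moment_derivative:
  assumes p: "p \<ge> 2"
  shows "(LBINT s=-1..1. (real k * s ^ (k - 1) * (1 - s\<^sup>2) - (real p - 1) * s ^ (k + 1)) * zonal_weight p s) = 0"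
proof -
  define q where "q = (real p - 1) / 2"
  have q: "q > 0" "2 * q = real p - 1" "q - 1 = (real p - 3) / 2" using p by (auto simp: q_def field_simps)
  define F where "F s = s ^ k * (1 - s\<^sup>2) powr q" for s
  have "(LBINT s=-1..1. (real k * s ^ (k - 1) * (1 - s\<^sup>2) - (real p - 1) * s ^ (k + 1)) * zonal_weight p s) = 0 - (0::real)"
  proof (rule interval_integral_FTC_integrable[where F = F])
    fix x :: real assume "-1 < ereal x" "ereal x < 1"
    then have x: "-1 < x" "x < 1" by (simp_all add: one_ereal_def)
    from one_minus_sq_pos[OF x] have pos: "1 - x\<^sup>2 > 0" .
    have "(F has_real_derivative (real k * x ^ (k - 1) * (1 - x\<^sup>2) powr q + x ^ k * (q * (1 - x\<^sup>2) powr (q - 1) * (- 2 * x)))) (at x)"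
      unfolding F_def using pos by (auto intro!: derivative_eq_intros simp: powr_diff)
    also have "(1 - x\<^sup>2) powr q = (1 - x\<^sup>2) * zonal_weight p x"
      using pos powr_add[of "1 - x\<^sup>2" 1 "q - 1"] by (simp add: zonal_weight_def flip: q(3))
    also have "(1 - x\<^sup>2) powr (q - 1) = zonal_weight p x"
      by (simp add: zonal_weight_def q)
    also have "real k * x ^ (k - 1) * ((1 - x\<^sup>2) * zonal_weight p x) + x ^ k * (q * zonal_weight p x * (- 2 * x)) =
       (real k * x ^ (k - 1) * (1 - x\<^sup>2) - (2 * q) * x ^ (k + 1)) * zonal_weight p x"
      by (simp add: algebra_simps)
    finally show "(F has_vector_derivative (real k * x ^ (k - 1) * (1 - x\<^sup>2) - (real p - 1) * x ^ (k + 1)) * zonal_weight p x) (at x)"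
      by (simp add: q(2) has_real_derivative_iff_has_vector_derivative)
    show "isCont (\<lambda>s. (real k * s ^ (k - 1) * (1 - s\<^sup>2) - (real p - 1) * s ^ (k + 1)) * zonal_weight p s) x"
      unfolding zonal_weight_def using pos by (intro continuous_intros) auto
  next
    have "set_integrable lborel (einterval (-1) 1) (\<lambda>s. (real k * (s ^ (k - 1) * zonal_weight p s) - real k * (s ^ (k - 1 + 2) * zonal_weight p s))
       - (real p - 1) * (s ^ (k + 1) * zonal_weight p s))"
      by (intro set_integral_diff set_integrable_mult_right set_integrable_zonal_weight[OF p])
    then show "set_integrable lborel (einterval (-1) 1) (\<lambda>s. (real k * s ^ (k - 1) * (1 - s\<^sup>2) - (real p - 1) * s ^ (k + 1)) * zonal_weight p s)"
      by (rule back_subst[of "set_integrable lborel (einterval (-1) 1)"])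
        (auto simp: fun_eq_iff algebra_simps power2_eq_square)
    have cont: "continuous_on {-1..1} F"
      unfolding F_def using q(1)
      by (intro continuous_intros continuous_on_powr') (auto simp: abs_le_iff intro: abs_square_le_1[THEN iffD2])
    have "continuous (at (-1) within {-1..1}) F" "continuous (at 1 within {-1..1}) F"
      using cont by (auto simp: continuous_on_eq_continuous_within)
    moreover have "F (-1) = 0" "F 1 = 0" using q by (auto simp: F_def)
    ultimately have "(F \<longlongrightarrow> 0) (at_right (-1))" "(F \<longlongrightarrow> 0) (at_left 1)"
      by (simp_all add: continuous_within at_within_Icc_at_right at_within_Icc_at_left)
    then show "((F \<circ> real_of_ereal) \<longlongrightarrow> 0) (at_right (-1))" "((F \<circ> real_of_ereal) \<longlongrightarrow> 0) (at_left 1)"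
      by (simp_all only: tendsto_real_of_ereal_unit)
  qed (simp_all add: one_ereal_def)
  then show ?thesis by simp
qed

lemma weight_moment_1: 
  assumes p: "p \<ge> 2" shows "weight_moment p 1 = 0"
proof -
  have "0 = (LBINT s=-1..1. (1 - real p) * (s ^ 1 * zonal_weight p s))"
    using weight_moment_derivative[OF p, of 0] by (simp add: algebra_simps)
  also have "\<dots> = (1 - real p) * weight_moment p 1"
    unfolding weight_moment_def by (rule interval_lebesgue_integral_mult_right)
  finally show ?thesis using p by simp
qed

lemma weight_moment_Suc_Suc:
  assumes p: "p \<ge> 2" shows "(real m + real p) * weight_moment p (Suc (Suc m)) = (real m + 1) * weight_moment p m"
proof -
  have int: "interval_lebesgue_integrable lborel (-1) 1 (\<lambda>s. s ^ k * zonal_weight p s)" for k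
    using set_integrable_zonal_weight[OF p, of k] by (simp add: interval_lebesgue_integrable_def one_ereal_def)
  have "0 = (LBINT s=-1..1. (real m + 1) * (s ^ m * zonal_weight p s) - (real m + real p) * (s ^ Suc (Suc m) * zonal_weight p s))"
    unfolding weight_moment_derivative[OF p, of "Suc m", symmetric]
    by (rule arg_cong[of _ _ "interval_lebesgue_integral lborel (-1) 1"]) (auto simp: fun_eq_iff algebra_simps power2_eq_square)
  also have "\<dots> = (real m + 1) * weight_moment p m - (real m + real p) * weight_moment p (Suc (Suc m))"
    unfolding weight_moment_def using int
    by (subst interval_lebesgue_integral_diff(2))
      (auto intro!: interval_lebesgue_integrable_mult_right simp del: power_Suc)
  finally show ?thesis by simp
qed

lemma weight_moment_0_pos:
  assumes p: "p \<ge> 2" shows "weight_moment p 0 > 0"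
proof -
  \<comment> \<open>On \<open>{0..1/2}\<close> the base \<open>1 - s^2\<close> lies between
    \<open>3 / 4\<close> and 1, and raising the exponent to \<open>p\<close> only decreases the
    power; hence \<open>c\<close> bounds the weight from below there.\<close>
  define c where "c = (3 / 4 :: real) powr real p"
  have int: "integrable lborel (\<lambda>s. indicat_real (einterval (-1) 1) s *\<^sub>R zonal_weight p s)"
    using set_integrable_zonal_weight[OF p, of 0] by (simp add: set_integrable_def)
  have "c * (1 / 2) = (LINT s|lborel. c * indicat_real {0..1/2 :: real} s)" by simp
  also have "\<dots> \<le> (LINT s|lborel. indicat_real (einterval (-1) 1) s *\<^sub>R zonal_weight p s)"
  proof (rule integral_mono[OF _ int])
    fix s :: real
    show "c * indicat_real {0..1/2} s \<le> indicat_real (einterval (-1) 1) s *\<^sub>R zonal_weight p s"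
    proof (cases "s \<in> {0..1/2}")
      case True
      then have "s\<^sup>2 \<le> (1/2)\<^sup>2" by (intro power_mono) auto
      then have s: "3 / 4 \<le> 1 - s\<^sup>2" by (simp add: power2_eq_square)
      have "c \<le> (1 - s\<^sup>2) powr real p" unfolding c_def using s by (intro powr_mono2) auto
      also have "\<dots> \<le> zonal_weight p s" unfolding zonal_weight_def using s p by (intro powr_mono') auto
      finally show ?thesis using True by (auto simp: einterval_def one_ereal_def indicator_def)
    next
      case False
      then show ?thesis by (simp add: zonal_weight_def)
    qed
  qed (auto intro!: integrable_mult_right integrable_real_indicator simp: emeasure_lborel_Icc_eq top.not_eq_extremum[symmetric])
  also have "\<dots> = weight_moment p 0"
    by (simp add: weight_moment_def interval_lebesgue_integral_def set_lebesgue_integral_def one_ereal_def)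
  finally have "c * (1 / 2) \<le> weight_moment p 0" .
  moreover have "c > 0" by (simp add: c_def)
  ultimately show ?thesis by linarith
qed

lemma weight_moment_eq_zmom:
  assumes p: "p \<ge> 2" shows "weight_moment p m = weight_moment p 0 * zmom p m"
  using p
proof (induction p m rule: zmom.induct)
  case (2 p)
  then show ?case using weight_moment_1 by simp
next
  case (3 p m)
  then have "real m + real p \<noteq> 0" by simp
  then show ?case using 3 weight_moment_Suc_Suc[of p m] by (simp add: field_simps)
qed simp

lemma moment_eq_zmom:
  assumes p: "p \<ge> 2" shows "moment p m = zmom p m"
proof -
  have Icc: "(LINT s:{-1..1}|lborel. s ^ m * (1 - s\<^sup>2) powr ((real p - 3) / 2)) = weight_moment p m" for m
    unfolding weight_moment_def zonal_weight_def one_ereal_def uminus_ereal.simps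
    by (rule interval_integral_Icc[symmetric]) simp
  have "moment_norm p = 1 / weight_moment p 0"
    unfolding moment_norm_def Icc[of 0, symmetric] by simp
  then show ?thesis
    unfolding moment_def Icc using weight_moment_0_pos[OF p] weight_moment_eq_zmom[OF p, of m] by simp
qed

section \<open>Laplace transforms of weighted chi-square laws\<close>

text \<open>The hypotheses make the choice in the definition meaningful: a vector whose only
  non-zero entry is \<open>sqrt \<xi>\<close> is a witness, and it needs at least one
  coordinate.\<close>

lemma noncentral_chi_square_cases:
  assumes "d \<ge> 1" "\<xi> \<ge> 0"
  obtains \<mu> where "(\<Sum>i<d. (\<mu> i)\<^sup>2) = \<xi>"
    "noncentral_chi_square d \<xi> = distr (\<Pi>\<^sub>M i\<in>{..<d}. normal_dist (\<mu> i)) borel (\<lambda>z. \<Sum>i<d. (z i)\<^sup>2)"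
proof -
  have "(\<Sum>i<d. (if i = 0 then sqrt \<xi> else 0)\<^sup>2) = (\<Sum>i<d. if i = 0 then \<xi> else 0)"
    using assms(2) by (intro sum.cong) auto
  also have "\<dots> = \<xi>" using assms(1) by simp
  finally have "\<exists>\<mu> :: nat \<Rightarrow> real. (\<Sum>i<d. (\<mu> i)\<^sup>2) = \<xi>"
    by (intro exI[of _ "\<lambda>i. if i = 0 then sqrt \<xi> else 0"])
  from someI_ex[OF this] show thesis
    by (rule that) (simp add: noncentral_chi_square_def Let_def)
qed

lemma prob_space_PiM_normal: "prob_space (Pi\<^sub>M I (\<lambda>i. normal_dist (\<mu> i)))"
  by (intro prob_space_PiM prob_space_normal_dist)

lemma noncentral_chi_square_props:
  "real_distribution (noncentral_chi_square d \<xi>)" "AE x in noncentral_chi_square d \<xi>. 0 \<le> x"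
proof -
  define \<mu> where "\<mu> = (SOME \<mu> :: nat \<Rightarrow> real. (\<Sum>i<d. (\<mu> i)\<^sup>2) = \<xi>)"
  have eq: "noncentral_chi_square d \<xi> = distr (\<Pi>\<^sub>M i\<in>{..<d}. normal_dist (\<mu> i)) borel (\<lambda>z. \<Sum>i<d. (z i)\<^sup>2)"
    by (simp add: noncentral_chi_square_def Let_def \<mu>_def)
  interpret N: prob_space "\<Pi>\<^sub>M i\<in>{..<d}. normal_dist (\<mu> i)" by (rule prob_space_PiM_normal)
  have meas: "(\<lambda>z. \<Sum>i<d. (z i)\<^sup>2) \<in> borel_measurable (\<Pi>\<^sub>M i\<in>{..<d}. normal_dist (\<mu> i))"
    by (intro borel_measurable_sum borel_measurable_power PiM_component_borel) auto
  show "real_distribution (noncentral_chi_square d \<xi>)"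
    unfolding eq by (rule N.real_distribution_distr[OF meas])
  show "AE x in noncentral_chi_square d \<xi>. 0 \<le> x"
    unfolding eq by (subst AE_distr_iff[OF meas]) (auto intro!: sum_nonneg)
qed

lemma laplace_normal_squares:
  assumes I: "finite I"
  shows "(LINT z|Pi\<^sub>M I (\<lambda>i. normal_dist (\<mu> i)). exp (- (\<Sum>i\<in>I. (c i * z i)\<^sup>2) / 2)) =
    (\<Prod>i\<in>I. exp (- ((c i)\<^sup>2 / 2 * (\<mu> i)\<^sup>2) / (1 + (c i)\<^sup>2)) / sqrt (1 + (c i)\<^sup>2))"
proof -
  interpret N: product_prob_space "\<lambda>i. normal_dist (\<mu> i)" I
    by (rule product_prob_spaceI) (rule prob_space_normal_dist)
  have "(LINT z|Pi\<^sub>M I (\<lambda>i. normal_dist (\<mu> i)). exp (- (\<Sum>i\<in>I. (c i * z i)\<^sup>2) / 2)) =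
    (LINT z|Pi\<^sub>M I (\<lambda>i. normal_dist (\<mu> i)). (\<Prod>i\<in>I. exp (- ((c i)\<^sup>2 / 2 * (z i)\<^sup>2))))"
    using I by (simp add: exp_sum[symmetric] sum_negf sum_divide_distrib power_mult_distrib)
  also have "\<dots> = (\<Prod>i\<in>I. LINT x|normal_dist (\<mu> i). exp (- ((c i)\<^sup>2 / 2 * x\<^sup>2)))"
  proof (rule N.product_integral_prod[OF I])
    show "integrable (normal_dist (\<mu> i)) (\<lambda>x. exp (- ((c i)\<^sup>2 / 2 * x\<^sup>2)))" for i
      by (rule finite_measure.integrable_const_bound[where B = 1])
        (auto intro: prob_space.finite_measure prob_space_normal_dist)
  qed
  also have "\<dots> = (\<Prod>i\<in>I. exp (- ((c i)\<^sup>2 / 2 * (\<mu> i)\<^sup>2) / (1 + (c i)\<^sup>2)) / sqrt (1 + (c i)\<^sup>2))"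
    by (subst laplace_normal_square) auto
  finally show ?thesis .
qed

text \<open>The means of the coordinates enter only through the sum of their squares, so the
  arbitrary choice in the definition does not affect the transform.\<close>

lemma laplace_noncentral_chi_square:
  assumes "d \<ge> 1" "\<xi> \<ge> 0" "s \<ge> 0"
  shows "(LINT x|noncentral_chi_square d \<xi>. exp (- (s * x))) =
    exp (- (s * \<xi>) / (1 + 2 * s)) / sqrt (1 + 2 * s) ^ d"
proof -
  obtain \<mu> where \<mu>: "(\<Sum>i<d. (\<mu> i)\<^sup>2) = \<xi>"
    and eq: "noncentral_chi_square d \<xi> = distr (\<Pi>\<^sub>M i\<in>{..<d}. normal_dist (\<mu> i)) borel (\<lambda>z. \<Sum>i<d. (z i)\<^sup>2)"
    by (rule noncentral_chi_square_cases[OF assms(1,2)])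
  define c where "c = sqrt (2 * s)"
  have c: "c\<^sup>2 = 2 * s" using assms by (simp add: c_def)
  have meas: "(\<lambda>z. \<Sum>i<d. (z i)\<^sup>2) \<in> borel_measurable (\<Pi>\<^sub>M i\<in>{..<d}. normal_dist (\<mu> i))"
    by (intro borel_measurable_sum borel_measurable_power PiM_component_borel) auto
  have "(LINT x|noncentral_chi_square d \<xi>. exp (- (s * x))) =
    (LINT z|Pi\<^sub>M {..<d} (\<lambda>i. normal_dist (\<mu> i)). exp (- (\<Sum>i<d. (c * z i)\<^sup>2) / 2))"
    unfolding eq by (subst integral_distr[OF meas])
      (auto simp: power_mult_distrib c sum_distrib_left sum_divide_distrib)
  also have "\<dots> = (\<Prod>i<d. exp (- (s * (\<mu> i)\<^sup>2) / (1 + 2 * s)) / sqrt (1 + 2 * s))"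
    by (subst laplace_normal_squares) (auto simp: c)
  also have "\<dots> = exp (\<Sum>i<d. - (s * (\<mu> i)\<^sup>2) / (1 + 2 * s)) / sqrt (1 + 2 * s) ^ d"
    by (simp add: prod_dividef exp_sum)
  also have "(\<Sum>i<d. - (s * (\<mu> i)\<^sup>2) / (1 + 2 * s)) = - (s * \<xi>) / (1 + 2 * s)"
    by (simp add: \<mu>[symmetric] sum_distrib_left sum_divide_distrib sum_negf)
  finally show ?thesis .
qed

lemma weighted_sum_law_props:
  assumes "\<And>k. k \<in> {1..K} \<Longrightarrow> 0 \<le> w k"
    and L: "\<And>k. real_distribution (L k)" "\<And>k. AE x in L k. 0 \<le> x"
  shows "real_distribution (weighted_sum_law K w L)" "AE x in weighted_sum_law K w L. 0 \<le> x"
    "s \<ge> 0 \<Longrightarrow> (LINT x|weighted_sum_law K w L. exp (- (s * x))) = (\<Prod>k\<in>{1..K}. LINT x|L k. exp (- (s * w k * x)))"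
proof -
  have prob: "prob_space (L k)" for k using L(1) by (rule real_distribution.axioms)
  have sets: "sets (L k) = sets borel" for k using L(1) by (rule real_distribution.events_eq_borel)
  interpret N: product_prob_space L "{1..K}"
    by (rule product_prob_spaceI) (rule prob)
  have meas: "(\<lambda>x. \<Sum>k = 1..K. w k * x k) \<in> borel_measurable (\<Pi>\<^sub>M k\<in>{1..K}. L k)"
    by (intro borel_measurable_sum borel_measurable_times borel_measurable_const PiM_component_borel sets)
  show "real_distribution (weighted_sum_law K w L)"
    unfolding weighted_sum_law_def by (rule N.real_distribution_distr[OF meas])
  have "AE x in \<Pi>\<^sub>M k\<in>{1..K}. L k. \<forall>k\<in>{1..K}. 0 \<le> x k"
    by (intro AE_finite_allI N.AE_component L) auto
  then have "AE x in \<Pi>\<^sub>M k\<in>{1..K}. L k. 0 \<le> (\<Sum>k = 1..K. w k * x k)"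
    by eventually_elim (auto intro!: sum_nonneg mult_nonneg_nonneg assms)
  then show "AE x in weighted_sum_law K w L. 0 \<le> x"
    unfolding weighted_sum_law_def by (subst AE_distr_iff[OF meas]) auto
  assume s: "s \<ge> 0"
  have "(LINT x|weighted_sum_law K w L. exp (- (s * x))) =
    (LINT x|Pi\<^sub>M {1..K} L. (\<Prod>k\<in>{1..K}. exp (- (s * w k * x k))))"
    unfolding weighted_sum_law_def by (subst integral_distr[OF meas])
      (auto simp: exp_sum[symmetric] sum_distrib_left sum_negf mult.assoc)
  also have "\<dots> = (\<Prod>k\<in>{1..K}. LINT x|L k. exp (- (s * w k * x)))"
  proof (rule N.product_integral_prod)
    fix k assume k: "k \<in> {1..K}"
    show "integrable (L k) (\<lambda>x. exp (- (s * w k * x)))"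
    proof (rule finite_measure.integrable_const_bound[OF prob_space.finite_measure[OF prob]])
      show "AE x in L k. norm (exp (- (s * w k * x))) \<le> 1"
        using L(2)[of k] by eventually_elim (use assms(1)[OF k] s in auto)
      have "(\<lambda>x. exp (- (s * w k * x))) \<in> borel_measurable borel" by measurable
      then show "(\<lambda>x. exp (- (s * w k * x))) \<in> borel_measurable (L k)"
        by (simp add: measurable_cong_sets[OF sets refl])
    qed
  qed simp
  finally show "(LINT x|weighted_sum_law K w L. exp (- (s * x))) = (\<Prod>k\<in>{1..K}. LINT x|L k. exp (- (s * w k * x)))" .
qed

text \<open>Independence factorises both transforms. An order of weight 0 contributes the factor 1,
  so the Gaussian side ranges over the orders of non-zero weight, and only there is
  \<open>\<mu>\<close> tied to \<open>\<xi>\<close>.\<close>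

lemma laplace_weighted_chi_square:
  assumes d: "\<And>k. k \<in> {1..K} \<Longrightarrow> d k \<ge> 1" and w: "\<And>k. k \<in> {1..K} \<Longrightarrow> 0 \<le> w k"
    and \<xi>: "\<And>k. k \<in> {1..K} \<Longrightarrow> 0 \<le> \<xi> k"
    and \<mu>: "\<And>k. k \<in> {1..K} \<Longrightarrow> w k \<noteq> 0 \<Longrightarrow> (\<Sum>r<d k. (\<mu> (k, r))\<^sup>2) = \<xi> k"
    and s: "s \<ge> 0"
  shows "(LINT x|weighted_sum_law K w (\<lambda>k. noncentral_chi_square (d k) (\<xi> k)). exp (- (s * x))) =
    (LINT z|Pi\<^sub>M (SIGMA k:{k \<in> {1..K}. w k \<noteq> 0}. {..<d k}) (\<lambda>i. normal_dist (\<mu> i)).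
      exp (- (\<Sum>i\<in>(SIGMA k:{k \<in> {1..K}. w k \<noteq> 0}. {..<d k}). (sqrt (2 * s * w (fst i)) * z i)\<^sup>2) / 2))"
proof -
  define I where "I = (SIGMA k:{k \<in> {1..K}. w k \<noteq> 0}. {..<d k})"
  have fin: "finite I" by (simp add: I_def)
  have "(LINT z|Pi\<^sub>M I (\<lambda>i. normal_dist (\<mu> i)). exp (- (\<Sum>i\<in>I. (sqrt (2 * s * w (fst i)) * z i)\<^sup>2) / 2)) =
    (\<Prod>i\<in>I. exp (- (s * w (fst i) * (\<mu> i)\<^sup>2) / (1 + 2 * (s * w (fst i)))) / sqrt (1 + 2 * (s * w (fst i))))"
    unfolding laplace_normal_squares[OF fin]
  proof (rule prod.cong[OF refl])
    fix i assume "i \<in> I"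
    then have "(sqrt (2 * s * w (fst i)))\<^sup>2 = 2 * (s * w (fst i))"
      using w s by (auto simp: I_def)
    then show "exp (- ((sqrt (2 * s * w (fst i)))\<^sup>2 / 2 * (\<mu> i)\<^sup>2) / (1 + (sqrt (2 * s * w (fst i)))\<^sup>2)) /
        sqrt (1 + (sqrt (2 * s * w (fst i)))\<^sup>2) =
      exp (- (s * w (fst i) * (\<mu> i)\<^sup>2) / (1 + 2 * (s * w (fst i)))) / sqrt (1 + 2 * (s * w (fst i)))"
      by simp
  qed
  also have "\<dots> = (\<Prod>k | k \<in> {1..K} \<and> w k \<noteq> 0. \<Prod>r<d k. exp (- (s * w k * (\<mu> (k, r))\<^sup>2) / (1 + 2 * (s * w k))) / sqrt (1 + 2 * (s * w k)))"
    unfolding I_def by (subst prod.Sigma) (auto simp: split_beta)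
  also have "\<dots> = (\<Prod>k | k \<in> {1..K} \<and> w k \<noteq> 0. exp (- (s * w k * \<xi> k) / (1 + 2 * (s * w k))) / sqrt (1 + 2 * (s * w k)) ^ d k)"
  proof (rule prod.cong[OF refl])
    fix k assume "k \<in> {k \<in> {1..K}. w k \<noteq> 0}"
    then have k: "k \<in> {1..K}" by simp
    have "(\<Prod>r<d k. exp (- (s * w k * (\<mu> (k, r))\<^sup>2) / (1 + 2 * (s * w k))) / sqrt (1 + 2 * (s * w k))) =
      exp (\<Sum>r<d k. - (s * w k * (\<mu> (k, r))\<^sup>2) / (1 + 2 * (s * w k))) / sqrt (1 + 2 * (s * w k)) ^ d k"
      by (simp add: prod_dividef exp_sum)
    also have "(\<Sum>r<d k. - (s * w k * (\<mu> (k, r))\<^sup>2) / (1 + 2 * (s * w k))) =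
        - (s * w k * (\<Sum>r<d k. (\<mu> (k, r))\<^sup>2)) / (1 + 2 * (s * w k))"
      by (simp add: sum_distrib_left sum_divide_distrib sum_negf)
    also have "s * w k * (\<Sum>r<d k. (\<mu> (k, r))\<^sup>2) = s * w k * \<xi> k"
      using \<mu>[OF k] by (cases "w k = 0") auto
    finally show "(\<Prod>r<d k. exp (- (s * w k * (\<mu> (k, r))\<^sup>2) / (1 + 2 * (s * w k))) / sqrt (1 + 2 * (s * w k))) =
      exp (- (s * w k * \<xi> k) / (1 + 2 * (s * w k))) / sqrt (1 + 2 * (s * w k)) ^ d k" .
  qed
  also have "\<dots> = (\<Prod>k\<in>{1..K}. exp (- (s * w k * \<xi> k) / (1 + 2 * (s * w k))) / sqrt (1 + 2 * (s * w k)) ^ d k)"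
    by (rule prod.mono_neutral_left) auto
  also have "\<dots> = (\<Prod>k\<in>{1..K}. LINT x|noncentral_chi_square (d k) (\<xi> k). exp (- (s * w k * x)))"
    by (intro prod.cong refl laplace_noncentral_chi_square[symmetric]) (use d \<xi> w s in auto)
  also have "\<dots> = (LINT x|weighted_sum_law K w (\<lambda>k. noncentral_chi_square (d k) (\<xi> k)). exp (- (s * x)))"
    by (rule weighted_sum_law_props(3)[symmetric]) (use w s noncentral_chi_square_props in auto)
  finally show ?thesis by (simp add: I_def)
qed

section \<open>Spherical harmonics\<close>

text \<open>Convolving \<open>leg\<close> with itself multiplies it by the inverse of the dimension,
  so the kernel with the dimension as prefactor reproduces itself. Its trace is the dimension
  because \<open>leg\<close> is 1 at 1.\<close>

lemma spherical_features_exist: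
  assumes p: "CARD('n::finite) \<ge> 2" and k: "k \<ge> 1"
  shows "\<exists>g. kernel_features (usphere :: (real ^ 'n) measure) (harm_dim CARD('n) k)
    (\<lambda>x y. real (harm_dim CARD('n) k) * poly (leg CARD('n) k) (x \<bullet> y)) g"
proof -
  define d where "d = harm_dim CARD('n) k"
  define P where "P = leg CARD('n) k"
  have d: "d > 0" unfolding d_def by (rule harm_dim_pos[OF p k])
  obtain j where "k = Suc j" using k by (cases k) auto
  then have N: "zmean CARD('n) (P * P) = 1 / real d"
    using zmean_leg_square[OF p, of j] by (simp only: P_def d_def)
  obtain C where C: "\<And>s. \<bar>s\<bar> \<le> 1 \<Longrightarrow> \<bar>poly P s\<bar> \<le> C"
    by (rule poly_bounded_interval[of P]) blast
  have "\<exists>g. kernel_features (usphere :: (real ^ 'n) measure) d (\<lambda>x y. real d * poly P (x \<bullet> y)) g"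
  proof (rule usphere.reproducing_kernel_decomposition[where B = "real d * C"])
    show "(\<lambda>(x, y). real d * poly P (x \<bullet> y)) \<in> borel_measurable (usphere \<Otimes>\<^sub>M (usphere :: (real ^ 'n) measure))"
      unfolding split_beta' by measurable
    fix x y :: "real ^ 'n" assume "x \<in> space usphere" "y \<in> space usphere"
    then have xy: "norm x = 1" "norm y = 1" by auto
    show "\<bar>real d * poly P (x \<bullet> y)\<bar> \<le> real d * C"
      using C[OF abs_inner_unit_le[OF xy]] by (simp add: abs_mult mult_left_mono)
    show "real d * poly P (x \<bullet> y) = real d * poly P (y \<bullet> x)" by (simp add: inner_commute)
    have "(LINT z|usphere. real d * poly P (x \<bullet> z) * (real d * poly P (z \<bullet> y))) =
      (LINT z|usphere. (real d * real d) * (poly P (z \<bullet> x) * poly P (z \<bullet> y)))"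
      by (rule Bochner_Integration.integral_cong) (auto simp: inner_commute)
    also have "\<dots> = (real d * real d) * (1 / real d * poly P (x \<bullet> y))"
      using zonal_convolution_leg[OF p xy, of k k] by (simp add: P_def[symmetric] N)
    also have "\<dots> = real d * poly P (x \<bullet> y)" using d by simp
    finally show "(LINT z|usphere. real d * poly P (x \<bullet> z) * (real d * poly P (z \<bullet> y))) = real d * poly P (x \<bullet> y)" .
  next
    have "(LINT x|usphere. real d * poly P (x \<bullet> (x :: real ^ 'n))) = (LINT x|(usphere :: (real ^ 'n) measure). real d)"
      using poly_leg_1[OF p, of k] by (intro Bochner_Integration.integral_cong) (auto simp: P_def dot_square_norm)
    also have "\<dots> = real d" using usphere.prob_space[where 'n = 'n] by simp
    finally show "(LINT x|usphere. real d * poly P (x \<bullet> (x :: real ^ 'n))) = real d" .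
  qed
  then show ?thesis unfolding d_def P_def .
qed

text \<open>The functions \<open>Y k r\<close> are spherical harmonics of degree \<open>k\<close>:
  the second clause is the addition theorem, the fourth is the Funk-Hecke formula for monomials.
  Orthogonality between degrees is passed on from the kernels to the features by the range
  clause.\<close>

lemma spherical_features:
  assumes p: "CARD('n::finite) \<ge> 2"
  obtains Y :: "nat \<Rightarrow> nat \<Rightarrow> real ^ 'n \<Rightarrow> real" where
    "\<And>k r. k \<ge> 1 \<Longrightarrow> r < harm_dim CARD('n) k \<Longrightarrow> bdd_meas usphere (Y k r)"
    "\<And>k x y. k \<ge> 1 \<Longrightarrow> norm x = 1 \<Longrightarrow> norm y = 1 \<Longrightarrow>
       real (harm_dim CARD('n) k) * poly (leg CARD('n) k) (x \<bullet> y) = (\<Sum>r<harm_dim CARD('n) k. Y k r x * Y k r y)"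
    "\<And>k r l s. k \<ge> 1 \<Longrightarrow> l \<ge> 1 \<Longrightarrow> r < harm_dim CARD('n) k \<Longrightarrow> s < harm_dim CARD('n) l \<Longrightarrow>
       (LINT w|usphere. Y k r w * Y l s w) = of_bool (k = l \<and> r = s)"
    "\<And>k r e m. k \<ge> 1 \<Longrightarrow> r < harm_dim CARD('n) k \<Longrightarrow> norm e = 1 \<Longrightarrow>
       (LINT w|usphere. Y k r w * (w \<bullet> e) ^ m) = zmean CARD('n) (monom 1 m * leg CARD('n) k) * Y k r e"
proof -
  let ?p = "CARD('n)"
  define good where "good k = kernel_features (usphere :: (real ^ 'n) measure) (harm_dim ?p k)
    (\<lambda>x y. real (harm_dim ?p k) * poly (leg ?p k) (x \<bullet> y))" for k
  define Y where "Y k = (SOME g. good k g)" for k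
  have good: "good k (Y k)" if "k \<ge> 1" for k
    unfolding Y_def good_def using spherical_features_exist[OF p that] by (rule someI_ex)
  note good_unfold = good_def kernel_features_def space_usphere
  have Y1: "bdd_meas usphere (Y k r)" if "k \<ge> 1" "r < harm_dim ?p k" for k r
    using good[OF that(1)] that(2) by (auto simp only: good_unfold)
  have Y2: "(LINT x|usphere. Y k r x * Y k s x) = of_bool (r = s)"
    if "k \<ge> 1" "r < harm_dim ?p k" "s < harm_dim ?p k" for k r s
    using good[OF that(1)] that(2,3) by (simp only: good_unfold)
  have Y3: "real (harm_dim ?p k) * poly (leg ?p k) (x \<bullet> y) = (\<Sum>r<harm_dim ?p k. Y k r x * Y k r y)"
    if "k \<ge> 1" "norm x = 1" "norm y = 1" for k x y
  proof -
    have "x \<in> sphere 0 1" "y \<in> sphere 0 1" using that by auto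
    then show ?thesis using good[OF that(1)] by (simp only: good_unfold)
  qed
  have Y4: "(LINT z|usphere. Y k r z * \<phi> z) = 0"
    if "k \<ge> 1" "r < harm_dim ?p k" "bdd_meas usphere \<phi>"
      "\<And>x. norm x = 1 \<Longrightarrow> (LINT z|usphere. poly (leg ?p k) (z \<bullet> x) * \<phi> z) = 0" for k r \<phi>
  proof -
    have z: "\<forall>x\<in>sphere 0 1. (LINT z|usphere. real (harm_dim ?p k) * poly (leg ?p k) (x \<bullet> z) * \<phi> z) = 0"
      using that(4) by (simp add: inner_commute mult.assoc)
    have "\<forall>\<phi>. bdd_meas usphere \<phi> \<and> (\<forall>x\<in>sphere 0 1. (LINT z|usphere. real (harm_dim ?p k) * poly (leg ?p k) (x \<bullet> z) * \<phi> z) = 0) \<longrightarrow>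
       (\<forall>r<harm_dim ?p k. (LINT z|usphere. Y k r z * \<phi> z) = 0)"
      using good[OF that(1)] unfolding good_unfold by (elim conjE)
    then show ?thesis using z that(2,3) by blast
  qed
  \<comment> \<open>The Funk-Hecke formula for \<open>leg\<close> itself: within one degree by the
    addition theorem and orthonormality, between degrees by the range clause.\<close>
  have Yleg: "(LINT w|usphere. Y k r w * poly (leg ?p l) (w \<bullet> e)) = of_bool (k = l) * Y k r e / real (harm_dim ?p k)"
    if "k \<ge> 1" "r < harm_dim ?p k" "norm e = 1" for k r l e
  proof (cases "k = l")
    case False
    then show ?thesis
      using zonal_convolution_leg[OF p _ that(3), of _ k l] Y4[OF that(1,2), of "\<lambda>w. poly (leg ?p l) (w \<bullet> e)"]
        bdd_meas_poly_inner[OF that(3)] by auto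
  next
    case True
    have "real (harm_dim ?p k) * (LINT w|usphere. Y k r w * poly (leg ?p k) (w \<bullet> e)) =
      (LINT w|usphere. Y k r w * (real (harm_dim ?p k) * poly (leg ?p k) (w \<bullet> e)))"
      unfolding integral_mult_right_zero[symmetric] by (simp only: mult.left_commute)
    also have "\<dots> = (LINT w|usphere. (\<Sum>s<harm_dim ?p k. Y k s e * (Y k r w * Y k s w)))"
      by (rule Bochner_Integration.integral_cong)
        (use that in \<open>auto simp: Y3 sum_distrib_left mult_ac\<close>)
    also have "\<dots> = (\<Sum>s<harm_dim ?p k. Y k s e * of_bool (r = s))"
      using that Y1 by (subst Bochner_Integration.integral_sum)
        (auto simp: Y2 intro!: usphere.integrable_bdd_meas bdd_meas_mult)
    also have "\<dots> = Y k r e" using that by (simp add: of_bool_def if_distrib cong: if_cong)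
    finally show ?thesis using harm_dim_pos[OF p that(1)] True by (simp add: field_simps)
  qed
  show thesis
  proof (rule that[of Y, OF Y1 Y3])
    fix k r l s assume kr: "k \<ge> 1" "l \<ge> 1" "r < harm_dim ?p k" "s < harm_dim ?p l"
    show "(LINT w|usphere. Y k r w * Y l s w) = of_bool (k = l \<and> r = s)"
    proof (cases "k = l")
      case True
      then show ?thesis using Y2 kr by simp
    next
      case False
      have "(LINT z|usphere. poly (leg ?p k) (z \<bullet> x) * Y l s z) = 0" if "norm x = 1" for x
        using Yleg[OF kr(2,4) that, of k] False by (simp add: mult.commute)
      then have "(LINT z|usphere. Y k r z * Y l s z) = 0"
        using kr by (intro Y4 Y1) auto
      then show ?thesis using False by simp
    qed
  next
    fix k r m and e :: "real ^ 'n" assume k: "k \<ge> 1" "r < harm_dim ?p k" and e: "norm e = 1"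
    define N where "N l = zmean ?p (leg ?p l * leg ?p l)" for l
    \<comment> \<open>The expansion is taken far enough to contain the index \<open>k\<close> even
      when \<open>m < k\<close>; its coefficient is then zero.\<close>
    define h where "h = max m k"
    have "degree (monom (1::real) m) \<le> h"
      using degree_monom_le[of "1 :: real" m] by (simp add: h_def)
    then obtain c where c: "monom 1 m = (\<Sum>l\<le>h. smult (c l) (leg ?p l))"
      using poly_eq_sum_leg[OF p] by blast
    have "zmean ?p (monom 1 m * leg ?p k) = (\<Sum>l\<le>h. c l * zmean ?p (leg ?p l * leg ?p k))"
      unfolding c by (simp add: sum_distrib_right zmean_sum zmean_smult)
    also have "\<dots> = (\<Sum>l\<le>h. if l = k then c k * N k else 0)"
      by (rule sum.cong) (use zmean_leg_leg[OF p] in \<open>auto simp: N_def\<close>)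
    also have "\<dots> = c k * N k" by (simp add: h_def)
    finally have ck: "zmean ?p (monom 1 m * leg ?p k) = c k * N k" .
    obtain j where "k = Suc j" using k by (cases k) auto
    then have N: "N k = 1 / real (harm_dim ?p k)"
      using zmean_leg_square[OF p, of j] by (simp only: N_def)
    have "(LINT w|usphere. Y k r w * (w \<bullet> e) ^ m) = (LINT w|usphere. (\<Sum>l\<le>h. c l * (Y k r w * poly (leg ?p l) (w \<bullet> e))))"
    proof (rule Bochner_Integration.integral_cong[OF refl])
      fix w :: "real ^ 'n"
      have "(w \<bullet> e) ^ m = (\<Sum>l\<le>h. c l * poly (leg ?p l) (w \<bullet> e))"
        using arg_cong[OF c, of "\<lambda>P. poly P (w \<bullet> e)"] by (simp add: poly_monom poly_sum)
      then show "Y k r w * (w \<bullet> e) ^ m = (\<Sum>l\<le>h. c l * (Y k r w * poly (leg ?p l) (w \<bullet> e)))"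
        by (simp add: sum_distrib_left mult_ac)
    qed
    also have "\<dots> = (\<Sum>l\<le>h. c l * (of_bool (k = l) * Y k r e / real (harm_dim ?p k)))"
      using Y1[OF k] bdd_meas_poly_inner[OF e]
      by (subst Bochner_Integration.integral_sum) (auto simp: Yleg[OF k e] intro!: usphere.integrable_bdd_meas bdd_meas_mult)
    also have "\<dots> = (\<Sum>l\<le>h. if l = k then c k * Y k r e / real (harm_dim ?p k) else 0)"
      by (rule sum.cong) auto
    also have "\<dots> = c k * N k * Y k r e" by (simp add: h_def N)
    finally show "(LINT w|usphere. Y k r w * (w \<bullet> e) ^ m) = zmean ?p (monom 1 m * leg ?p k) * Y k r e"
      by (simp add: ck)
  qed
qed

section \<open>Asymptotics of the tilted integrals\<close>

lemma norm_theta0 [simp]: "norm (theta0 :: real ^ 'n::{finite,linorder}) = 1"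
  by (simp add: theta0_def)

lemma borel_measurable_sphere_measure_iff:
  "f \<in> borel_measurable (sphere_measure :: (real ^ 'n::finite) measure) \<longleftrightarrow> f \<in> borel_measurable usphere"
  by (simp add: measurable_cong_sets[OF sets_sphere_measure refl] measurable_cong_sets[OF sets_usphere refl])

abbreviation rotsym_law :: "real \<Rightarrow> (real \<Rightarrow> real) \<Rightarrow> (real ^ 'n::{finite,linorder}) measure" where
  "rotsym_law \<kappa> f \<equiv> density sphere_measure (\<lambda>u. ennreal (rotsym_density \<kappa> f u))"

text \<open>Passing to the uniform law is harmless because the area of the sphere cancels between
  numerator and normaliser.\<close>

lemma integral_rotsym_density:
  fixes g :: "real ^ 'n::{finite,linorder} \<Rightarrow> real"
  assumes f: "angular_function f" and g: "bdd_meas usphere g"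
  shows "(LINT u|rotsym_law \<kappa> f. g u) =
    (LINT w|usphere. g w * f (\<kappa> * (w \<bullet> theta0))) / (LINT w|(usphere :: (real, 'n) vec measure). f (\<kappa> * (w \<bullet> theta0)))"
proof -
  have [measurable]: "f \<in> borel_measurable borel" and f0: "\<And>x. 0 \<le> f x"
    using f by (auto simp: angular_function_def)
  define F where "F w = f (\<kappa> * (w \<bullet> theta0))" for w :: "(real, 'n) vec"
  define c where "c = measure sphere_measure (sphere 0 1 :: (real, 'n) vec set)"
  have c: "c > 0" using measure_sphere_pos by (simp add: c_def)
  have Fm [measurable]: "F \<in> borel_measurable usphere"
    unfolding F_def by measurable
  have gm [measurable]: "g \<in> borel_measurable usphere" using g by (rule bdd_meas_measurable)
  have m: "F \<in> borel_measurable sphere_measure" "(\<lambda>w. g w * F w) \<in> borel_measurable sphere_measure"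
    "g \<in> borel_measurable sphere_measure" "(\<lambda>w. F w / C) \<in> borel_measurable sphere_measure" for C
    unfolding borel_measurable_sphere_measure_iff by measurable
  have F0: "0 \<le> F w" for w by (simp add: F_def f0)
  have dens: "rotsym_density \<kappa> f = (\<lambda>w. F w / integral\<^sup>L sphere_measure F)"
    by (simp add: fun_eq_iff rotsym_density_def F_def[abs_def])
  have "(LINT u|rotsym_law \<kappa> f. g u) =
    (LINT w|sphere_measure. (F w / integral\<^sup>L sphere_measure F) *\<^sub>R g w)"
    unfolding dens by (rule integral_density) (use m F0 in \<open>auto intro!: AE_I2 divide_nonneg_nonneg integral_nonneg_AE\<close>)
  also have "\<dots> = (LINT w|sphere_measure. (g w * F w) / integral\<^sup>L sphere_measure F)"
    by (rule Bochner_Integration.integral_cong) auto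
  also have "\<dots> = (LINT w|sphere_measure. g w * F w) / integral\<^sup>L sphere_measure F"
    by simp
  also have "\<dots> = (LINT w|usphere. g w * F w) / integral\<^sup>L usphere F"
    using c by (simp add: integral_usphere m(1,2) c_def[symmetric])
  finally show ?thesis by (simp add: F_def[abs_def])
qed

lemma (in prob_space) integral_mult_tendsto_0:
  fixes g :: "'a \<Rightarrow> real" and h :: "nat \<Rightarrow> 'a \<Rightarrow> real"
  assumes g: "bdd_meas M g"
    and h: "\<And>e. e > 0 \<Longrightarrow> \<forall>\<^sub>F n in sequentially. \<forall>x\<in>space M. \<bar>h n x\<bar> \<le> e"
  shows "(\<lambda>n. LINT x|M. g x * h n x) \<longlonglongrightarrow> 0"
proof (rule tendstoI)
  fix e :: real assume e: "e > 0"
  obtain C where "\<And>x. x \<in> space M \<Longrightarrow> \<bar>g x\<bar> \<le> C" using g unfolding bdd_meas_def by blast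
  then have C: "\<And>x. x \<in> space M \<Longrightarrow> \<bar>g x\<bar> \<le> max C 1" by fastforce
  define e' where "e' = e / (2 * max C 1)"
  have e': "e' > 0" "max C 1 * e' = e / 2" using e by (auto simp: e'_def)
  show "\<forall>\<^sub>F n in sequentially. dist (LINT x|M. g x * h n x) 0 < e"
    using h[OF e'(1)]
  proof eventually_elim
    case (elim n)
    have *: "\<bar>g x * h n x\<bar> \<le> e / 2" if "x \<in> space M" for x
      unfolding abs_mult e'(2)[symmetric] using C[OF that] elim that by (intro mult_mono) auto
    have "norm (LINT x|M. g x * h n x) \<le> e / 2"
    proof (cases "integrable M (\<lambda>x. g x * h n x)")
      case True
      have "norm (LINT x|M. g x * h n x) \<le> (LINT x|M. norm (g x * h n x))"
        by (rule integral_norm_bound)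
      also have "\<dots> \<le> e / 2"
        by (rule integral_le_const) (use True * in auto)
      finally show ?thesis .
    \<comment> \<open>A product that is not integrable has integral 0 by convention.\<close>
    qed (use e in \<open>simp add: not_integrable_integral_eq\<close>)
    then show ?case using e by simp
  qed
qed

text \<open>The arguments of \<open>f\<close> shrink uniformly to 0, where \<open>f\<close> is
  continuous with value 1; this gives the first two claims. For the third the Taylor expansion is
  multiplied by \<open>sqrt n\<close>: the term of order \<open>i\<close> becomes constant in
  \<open>n\<close>, the remainder tends to 0 uniformly, and the lower terms, whose factors diverge,
  vanish by assumption.\<close>

lemma tilted_integral_asymptotics:
  fixes f :: "real \<Rightarrow> real" and e :: "real ^ 'n::finite"
  assumes f: "angular_function f" and diff: "times_differentiable_at i f 0" and i: "i \<ge> 1"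
    and e: "norm e = 1" and \<tau>: "\<tau> > 0"
  defines "\<kappa> \<equiv> \<lambda>n. real n powr (- 1 / (2 * real i)) * \<tau>"
  shows "\<forall>\<^sub>F n in sequentially. bdd_meas usphere (\<lambda>w. f (\<kappa> n * (w \<bullet> e)))"
    and "\<And>g. bdd_meas usphere g \<Longrightarrow>
      (\<lambda>n. LINT w|usphere. g w * f (\<kappa> n * (w \<bullet> e))) \<longlonglongrightarrow> (LINT w|usphere. g w)"
    and "\<And>g. bdd_meas usphere g \<Longrightarrow>
      (\<And>j. j < i \<Longrightarrow> nth_deriv j f 0 * (LINT w|usphere. g w * (w \<bullet> e) ^ j) = 0) \<Longrightarrow>
      (\<lambda>n. sqrt (real n) * (LINT w|usphere. g w * f (\<kappa> n * (w \<bullet> e)))) \<longlonglongrightarrow>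
        \<tau> ^ i * (nth_deriv i f 0 / fact i) * (LINT w|usphere. g w * (w \<bullet> e) ^ i)"
proof -
  have [measurable]: "f \<in> borel_measurable borel" and f1: "f 0 = 1"
    using f by (auto simp: angular_function_def)
  have meas: "(\<lambda>w. f (\<kappa> n * (w \<bullet> e))) \<in> borel_measurable usphere" for n by measurable
  have \<kappa>0: "\<kappa> \<longlonglongrightarrow> 0"
  proof -
    have "(\<lambda>n. real n powr (- 1 / (2 * real i))) \<longlonglongrightarrow> 0"
      using i by (intro tendsto_neg_powr filterlim_real_sequentially) auto
    from tendsto_mult_right[OF this, of \<tau>] show ?thesis by (simp add: \<kappa>_def)
  qed
  have \<kappa>i: "sqrt (real n) * \<kappa> n ^ i = \<tau> ^ i" if "n > 0" for n
  proof -
    have "(real n powr (- 1 / (2 * real i))) ^ i = real n powr (- (1 / 2))"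
      using that i by (simp add: powr_realpow[symmetric] powr_powr)
    then show ?thesis
      using that by (simp add: \<kappa>_def power_mult_distrib powr_minus powr_half_sqrt field_simps)
  qed
  have \<kappa>_nonneg: "\<kappa> n \<ge> 0" for n using \<tau> by (simp add: \<kappa>_def)
  have inner: "\<bar>w \<bullet> e\<bar> \<le> 1" if "w \<in> space usphere" for w
    using abs_inner_unit_le[of w e] that e by simp
  have small: "\<forall>\<^sub>F n in sequentially. \<forall>w\<in>space usphere. P (\<kappa> n * (w \<bullet> e))"
    if P: "\<forall>\<^sub>F x in nhds 0. P x" for P
  proof -
    obtain d where d: "d > 0" "\<And>x. \<bar>x\<bar> < d \<Longrightarrow> P x"
      using P unfolding eventually_nhds_metric by (auto simp: dist_real_def)
    have "\<forall>\<^sub>F n in sequentially. \<kappa> n < d" using order_tendstoD(2)[OF \<kappa>0 d(1)] .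
    then show ?thesis
    proof eventually_elim
      case (elim n)
      show ?case
      proof
        fix w :: "real ^ 'n" assume "w \<in> space usphere"
        from inner[OF this] have "\<bar>\<kappa> n * (w \<bullet> e)\<bar> \<le> \<kappa> n * 1"
          unfolding abs_mult using \<kappa>_nonneg[of n] by (intro mult_mono) auto
        then show "P (\<kappa> n * (w \<bullet> e))" using elim by (intro d(2)) simp
      qed
    qed
  qed
  have cont: "isCont f 0"
  proof -
    have "times_differentiable_at 1 f 0" by (rule times_differentiable_at_mono[OF diff i])
    then have "f differentiable (at 0)" by simp
    then show ?thesis by (rule differentiable_imp_continuous_within)
  qed
  have near1: "\<forall>\<^sub>F n in sequentially. \<forall>w\<in>space usphere. \<bar>f (\<kappa> n * (w \<bullet> e)) - 1\<bar> \<le> r" if "r > 0" for r :: real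
  proof (rule small)
    have "(f \<longlongrightarrow> f 0) (nhds 0)" using cont by (simp add: isCont_def tendsto_nhds_iff)
    from tendstoD[OF this that] show "\<forall>\<^sub>F x in nhds 0. \<bar>f x - 1\<bar> \<le> r"
      by eventually_elim (simp add: f1 dist_real_def)
  qed
  have bdd: "\<forall>\<^sub>F n in sequentially. bdd_meas usphere (\<lambda>w. f (\<kappa> n * (w \<bullet> e)))"
    using near1[OF zero_less_one]
  proof eventually_elim
    case (elim n)
    show ?case
    proof (rule bdd_measI[where C = 2])
      fix w :: "real ^ 'n" assume "w \<in> space usphere"
      with elim have "\<bar>f (\<kappa> n * (w \<bullet> e)) - 1\<bar> \<le> 1" by blast
      then show "\<bar>f (\<kappa> n * (w \<bullet> e))\<bar> \<le> 2" by linarith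
    qed (rule meas)
  qed
  then show "\<forall>\<^sub>F n in sequentially. bdd_meas usphere (\<lambda>w. f (\<kappa> n * (w \<bullet> e)))" .
  show "(\<lambda>n. LINT w|usphere. g w * f (\<kappa> n * (w \<bullet> e))) \<longlonglongrightarrow> (LINT w|usphere. g w)"
    if g: "bdd_meas usphere g" for g
  proof -
    have "(\<lambda>n. LINT w|usphere. g w * (f (\<kappa> n * (w \<bullet> e)) - 1)) \<longlonglongrightarrow> 0"
      using near1 by (intro usphere.integral_mult_tendsto_0[OF g])
    from tendsto_add[OF this tendsto_const[of "LINT w|usphere. g w"]]
    have "(\<lambda>n. (LINT w|usphere. g w * (f (\<kappa> n * (w \<bullet> e)) - 1)) + (LINT w|usphere. g w)) \<longlonglongrightarrow> (LINT w|usphere. g w)"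
      by simp
    moreover have "\<forall>\<^sub>F n in sequentially. (LINT w|usphere. g w * (f (\<kappa> n * (w \<bullet> e)) - 1)) + (LINT w|usphere. g w) =
      (LINT w|usphere. g w * f (\<kappa> n * (w \<bullet> e)))"
      using bdd
    proof eventually_elim
      case (elim n)
      then have "integrable usphere (\<lambda>w. g w * f (\<kappa> n * (w \<bullet> e)))" "integrable usphere g"
        using g by (auto intro!: usphere.integrable_bdd_meas)
      then show ?case by (simp add: right_diff_distrib)
    qed
    ultimately show ?thesis by (rule Lim_transform_eventually)
  qed
  show "(\<lambda>n. sqrt (real n) * (LINT w|usphere. g w * f (\<kappa> n * (w \<bullet> e)))) \<longlonglongrightarrow>
      \<tau> ^ i * (nth_deriv i f 0 / fact i) * (LINT w|usphere. g w * (w \<bullet> e) ^ i)"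
    if g: "bdd_meas usphere g"
      and zero: "\<And>j. j < i \<Longrightarrow> nth_deriv j f 0 * (LINT w|usphere. g w * (w \<bullet> e) ^ j) = 0" for g
  proof -
    define c where "c j = nth_deriv j f 0 / fact j" for j
    define T where "T x = (\<Sum>j\<le>i. c j * x ^ j)" for x
    define h where "h n w = sqrt (real n) * (f (\<kappa> n * (w \<bullet> e)) - T (\<kappa> n * (w \<bullet> e)))" for n and w :: "real ^ 'n"
    have "(\<lambda>n. LINT w|usphere. g w * h n w) \<longlonglongrightarrow> 0"
    proof (rule usphere.integral_mult_tendsto_0[OF g])
      fix r :: real assume "r > 0"
      define r' where "r' = r / \<tau> ^ i"
      have r': "r' > 0" "r' * \<tau> ^ i = r" using \<open>r > 0\<close> \<tau> by (auto simp: r'_def)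
      have "\<forall>\<^sub>F x in nhds 0. \<bar>f x - T x\<bar> \<le> r' * \<bar>x\<bar> ^ i"
        unfolding T_def c_def by (rule taylor_peano[OF diff i r'(1)])
      from small[OF this] show "\<forall>\<^sub>F n in sequentially. \<forall>w\<in>space usphere. \<bar>h n w\<bar> \<le> r"
        using eventually_gt_at_top[of 0]
      proof eventually_elim
        case (elim n)
        show ?case
        proof
          fix w :: "real ^ 'n" assume w: "w \<in> space usphere"
          have "\<bar>\<kappa> n * (w \<bullet> e)\<bar> ^ i \<le> \<kappa> n ^ i"
            unfolding abs_mult using \<kappa>_nonneg[of n] inner[OF w]
            by (intro power_mono) (auto intro: mult_left_le)
          then have "\<bar>f (\<kappa> n * (w \<bullet> e)) - T (\<kappa> n * (w \<bullet> e))\<bar> \<le> r' * \<kappa> n ^ i"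
            using elim(1) w r'(1) by (meson mult_left_mono order.trans less_imp_le)
          then have "\<bar>h n w\<bar> \<le> sqrt (real n) * (r' * \<kappa> n ^ i)"
            by (simp add: h_def abs_mult mult_left_mono)
          also have "\<dots> = r' * (sqrt (real n) * \<kappa> n ^ i)" by simp
          also have "\<dots> = r" using \<kappa>i[OF elim(2)] r'(2) by simp
          finally show "\<bar>h n w\<bar> \<le> r" .
        qed
      qed
    qed
    from tendsto_add[OF this tendsto_const[of "\<tau> ^ i * c i * (LINT w|usphere. g w * (w \<bullet> e) ^ i)"]]
    have lim: "(\<lambda>n. (LINT w|usphere. g w * h n w) + \<tau> ^ i * c i * (LINT w|usphere. g w * (w \<bullet> e) ^ i)) \<longlonglongrightarrow>
        \<tau> ^ i * c i * (LINT w|usphere. g w * (w \<bullet> e) ^ i)" by simp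
    have "\<forall>\<^sub>F n in sequentially. (LINT w|usphere. g w * h n w) + \<tau> ^ i * c i * (LINT w|usphere. g w * (w \<bullet> e) ^ i) =
       sqrt (real n) * (LINT w|usphere. g w * f (\<kappa> n * (w \<bullet> e)))"
      using bdd eventually_gt_at_top[of 0]
    proof eventually_elim
      case (elim n)
      have bT: "bdd_meas usphere (\<lambda>w. c j * \<kappa> n ^ j * (g w * (w \<bullet> e) ^ j))" for j
        using g by (intro bdd_meas_mult bdd_meas_const bdd_meas_power bdd_meas_inner)
      have gT: "(\<lambda>w. g w * T (\<kappa> n * (w \<bullet> e))) = (\<lambda>w. \<Sum>j\<le>i. c j * \<kappa> n ^ j * (g w * (w \<bullet> e) ^ j))"
        by (simp add: fun_eq_iff T_def sum_distrib_left power_mult_distrib mult_ac)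
      have iT: "integrable usphere (\<lambda>w. g w * T (\<kappa> n * (w \<bullet> e)))"
        unfolding gT by (intro usphere.integrable_bdd_meas bdd_meas_sum bT)
      have iF: "integrable usphere (\<lambda>w. g w * f (\<kappa> n * (w \<bullet> e)))"
        using elim g by (auto intro!: usphere.integrable_bdd_meas)
      have "(LINT w|usphere. g w * T (\<kappa> n * (w \<bullet> e))) = (\<Sum>j\<le>i. c j * \<kappa> n ^ j * (LINT w|usphere. g w * (w \<bullet> e) ^ j))"
        unfolding gT by (subst Bochner_Integration.integral_sum) (rule usphere.integrable_bdd_meas[OF bT], simp)
      also have "\<dots> = (\<Sum>j\<le>i. if j = i then c i * \<kappa> n ^ i * (LINT w|usphere. g w * (w \<bullet> e) ^ i) else 0)"
      proof (rule sum.cong[OF refl])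
        fix j assume "j \<in> {..i}"
        then show "c j * \<kappa> n ^ j * (LINT w|usphere. g w * (w \<bullet> e) ^ j) =
            (if j = i then c i * \<kappa> n ^ i * (LINT w|usphere. g w * (w \<bullet> e) ^ i) else 0)"
          using zero[of j] by (auto simp: c_def)
      qed
      also have "\<dots> = c i * \<kappa> n ^ i * (LINT w|usphere. g w * (w \<bullet> e) ^ i)" by simp
      finally have T: "(LINT w|usphere. g w * T (\<kappa> n * (w \<bullet> e))) =
          c i * \<kappa> n ^ i * (LINT w|usphere. g w * (w \<bullet> e) ^ i)" .
      have "(LINT w|usphere. g w * h n w) =
         (LINT w|usphere. sqrt (real n) * (g w * f (\<kappa> n * (w \<bullet> e)) - g w * T (\<kappa> n * (w \<bullet> e))))"
        by (rule Bochner_Integration.integral_cong) (auto simp: h_def algebra_simps)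
      also have "\<dots> = sqrt (real n) * ((LINT w|usphere. g w * f (\<kappa> n * (w \<bullet> e))) - (LINT w|usphere. g w * T (\<kappa> n * (w \<bullet> e))))"
        using iT iF by simp
      also have "\<dots> = sqrt (real n) * (LINT w|usphere. g w * f (\<kappa> n * (w \<bullet> e))) -
          (sqrt (real n) * \<kappa> n ^ i) * c i * (LINT w|usphere. g w * (w \<bullet> e) ^ i)"
        unfolding T by (simp add: algebra_simps)
      finally show ?case unfolding \<kappa>i[OF elim(2)] by simp
    qed
    from Lim_transform_eventually[OF lim this] show ?thesis by (simp add: c_def)
  qed
qed

section \<open>The weak limit of the Sobolev statistic\<close>

lemma sum_swap_last:
  "(\<Sum>i\<in>A. \<Sum>j\<in>B. \<Sum>k\<in>C. F i j k) = (\<Sum>k\<in>C. \<Sum>i\<in>A. \<Sum>j\<in>B. F i j k)"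
proof -
  have "(\<Sum>j\<in>B. \<Sum>k\<in>C. F i j k) = (\<Sum>k\<in>C. \<Sum>j\<in>B. F i j k)" for i
    by (rule sum.swap)
  then show ?thesis by (simp only:) (rule sum.swap)
qed

text \<open>By the addition theorem each kernel is a sum of products of a function of
  \<open>u i\<close> and the same function of \<open>u j\<close>, so the double sum over the sample
  collapses to squares of single sums.\<close>

lemma sobolev_stat_eq_squares:
  fixes u :: "nat \<Rightarrow> real ^ 'n::finite" and Y :: "nat \<Rightarrow> nat \<Rightarrow> real ^ 'n \<Rightarrow> real"
  assumes p: "CARD('n) \<ge> 2" and v: "finite (weight_support v)" "weight_support v \<noteq> {}"
    and Y: "\<And>k x y. k \<ge> 1 \<Longrightarrow> norm x = 1 \<Longrightarrow> norm y = 1 \<Longrightarrow>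
       real (harm_dim CARD('n) k) * poly (leg CARD('n) k) (x \<bullet> y) = (\<Sum>r<harm_dim CARD('n) k. Y k r x * Y k r y)"
    and u: "\<And>j. j \<in> {1..n} \<Longrightarrow> norm (u j) = 1"
  shows "sobolev_stat v n u =
    (\<Sum>i\<in>(SIGMA k:{k \<in> {1..max_order v}. (v k)\<^sup>2 \<noteq> 0}. {..<harm_dim CARD('n) k}).
      (v (fst i))\<^sup>2 * ((\<Sum>j = 1..n. Y (fst i) (snd i) (u j)) / sqrt (real n))\<^sup>2)"
proof -
  define A where "A = {k \<in> {1..max_order v}. (v k)\<^sup>2 \<noteq> 0}"
  have A: "A = weight_support v"
    using Max_ge[OF v(1)] by (auto simp: A_def weight_support_def)
  have suminf: "(\<Sum>k. (v (Suc k))\<^sup>2 * sobolev_kernel CARD('n) (Suc k) s) = (\<Sum>k\<in>A. (v k)\<^sup>2 * sobolev_kernel CARD('n) k s)" for s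
  proof -
    \<comment> \<open>The series is indexed from 0 but uses the weight of index
      \<open>Suc k\<close>, so its support is that of the weights shifted down by one.\<close>
    define B where "B = (\<lambda>k. k - 1) ` A"
    have SucB: "Suc ` B = A" by (force simp: B_def A_def image_iff)
    have "finite B" by (simp add: B_def A_def)
    then have "(\<Sum>k. (v (Suc k))\<^sup>2 * sobolev_kernel CARD('n) (Suc k) s) = (\<Sum>k\<in>B. (v (Suc k))\<^sup>2 * sobolev_kernel CARD('n) (Suc k) s)"
    proof (rule suminf_finite)
      fix k assume "k \<notin> B"
      then have "Suc k \<notin> A" unfolding SucB[symmetric] by auto
      then show "(v (Suc k))\<^sup>2 * sobolev_kernel CARD('n) (Suc k) s = 0"
        unfolding A by (auto simp: weight_support_def)
    qed
    also have "\<dots> = (\<Sum>k\<in>Suc ` B. (v k)\<^sup>2 * sobolev_kernel CARD('n) k s)"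
      by (subst sum.reindex) auto
    finally show ?thesis unfolding SucB .
  qed
  have "sobolev_stat v n u = 1 / real n * (\<Sum>i = 1..n. \<Sum>j = 1..n. \<Sum>k\<in>A. (v k)\<^sup>2 * (\<Sum>r<harm_dim CARD('n) k. Y k r (u i) * Y k r (u j)))"
    unfolding sobolev_stat_def suminf
  proof (intro arg_cong2[of _ _ _ _ "(*)"] sum.cong refl)
    fix i j k assume ij: "i \<in> {1..n}" "j \<in> {1..n}" and k: "k \<in> A"
    then have "k \<ge> 1" by (simp add: A_def)
    then show "sobolev_kernel CARD('n) k (u i \<bullet> u j) = (\<Sum>r<harm_dim CARD('n) k. Y k r (u i) * Y k r (u j))"
      using sobolev_kernel_eq_leg[OF p] Y u ij by simp
  qed
  also have "(\<Sum>i = 1..n. \<Sum>j = 1..n. \<Sum>k\<in>A. (v k)\<^sup>2 * (\<Sum>r<harm_dim CARD('n) k. Y k r (u i) * Y k r (u j))) =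
      (\<Sum>k\<in>A. \<Sum>i = 1..n. \<Sum>j = 1..n. (v k)\<^sup>2 * (\<Sum>r<harm_dim CARD('n) k. Y k r (u i) * Y k r (u j)))"
    by (rule sum_swap_last)
  also have "\<dots> = (\<Sum>k\<in>A. \<Sum>r<harm_dim CARD('n) k. \<Sum>i = 1..n. \<Sum>j = 1..n. (v k)\<^sup>2 * (Y k r (u i) * Y k r (u j)))"
    by (rule sum.cong[OF refl]) (simp only: sum_distrib_left, rule sum_swap_last)
  also have "\<dots> = (\<Sum>k\<in>A. \<Sum>r<harm_dim CARD('n) k. (v k)\<^sup>2 * (\<Sum>j = 1..n. Y k r (u j))\<^sup>2)"
    unfolding power2_eq_square[of "sum _ _"] unfolding sum_product unfolding sum_distrib_left ..
  also have "1 / real n * \<dots> = (\<Sum>k\<in>A. \<Sum>r<harm_dim CARD('n) k. (v k)\<^sup>2 * ((\<Sum>j = 1..n. Y k r (u j)) / sqrt (real n))\<^sup>2)"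
    by (simp add: sum_distrib_left power_divide)
  also have "\<dots> = (\<Sum>i\<in>Sigma A (\<lambda>k. {..<harm_dim CARD('n) k}). (v (fst i))\<^sup>2 * ((\<Sum>j = 1..n. Y (fst i) (snd i) (u j)) / sqrt (real n))\<^sup>2)"
    by (subst sum.Sigma) (auto simp: A_def split_beta)
  finally show ?thesis by (simp only: A_def)
qed

lemma rotsym_sample_char:
  fixes U :: "nat \<Rightarrow> 'w \<Rightarrow> real ^ 'n::{finite,linorder}" and g :: "real ^ 'n::{finite,linorder} \<Rightarrow> real"
  assumes s: "rotsym_sample n \<kappa> f M U" and g: "bdd_meas usphere g"
  shows "(LINT w|M. iexp (t * (\<Sum>j = 1..n. g (U j w)))) =
    char (distr (rotsym_law \<kappa> f) borel g) t ^ n"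
proof -
  interpret prob_space M using s by (simp add: rotsym_sample_def)
  have ind: "indep_vars (\<lambda>_. restrict_space borel (sphere 0 1)) U {1..n}"
    and dist: "\<And>j. j \<in> {1..n} \<Longrightarrow> distributed M sphere_measure (U j) (\<lambda>u. ennreal (rotsym_density \<kappa> f u))"
    using s by (auto simp: rotsym_sample_def)
  have gm: "g \<in> borel_measurable (restrict_space borel (sphere 0 1))"
    using bdd_meas_measurable[OF g] by (simp add: measurable_cong_sets[OF sets_usphere refl])
  then have gs: "g \<in> borel_measurable sphere_measure"
    by (simp add: measurable_cong_sets[OF sets_sphere_measure refl])
  have ind': "indep_vars (\<lambda>_. borel) (\<lambda>j w. g (U j w)) {1..n}"
    by (rule indep_vars_compose2[OF ind gm])
  have Um: "U j \<in> M \<rightarrow>\<^sub>M sphere_measure" if "j \<in> {1..n}" for j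
    using dist[OF that] by (rule distributed_measurable)
  have gU: "(\<lambda>w. g (U j w)) \<in> borel_measurable M" if "j \<in> {1..n}" for j
    using measurable_compose[OF Um[OF that] gs] .
  have distr_eq: "distr M borel (\<lambda>w. g (U j w)) =
      distr (rotsym_law \<kappa> f) borel g" if "j \<in> {1..n}" for j
    unfolding distributed_distr_eq_density[OF dist[OF that], symmetric]
    by (subst distr_distr[OF gs Um[OF that]]) (simp add: comp_def)
  have meas: "(\<lambda>w. \<Sum>j = 1..n. g (U j w)) \<in> borel_measurable M"
    by (intro borel_measurable_sum gU)
  have "(LINT w|M. iexp (t * (\<Sum>j = 1..n. g (U j w)))) = char (distr M borel (\<lambda>w. \<Sum>j = 1..n. g (U j w))) t"
    unfolding char_def by (subst integral_distr[OF meas]) auto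
  also have "\<dots> = (\<Prod>j = 1..n. char (distr M borel (\<lambda>w. g (U j w))) t)"
    by (rule char_distr_sum[OF ind'])
  also have "\<dots> = (\<Prod>j = 1..n. char (distr (rotsym_law \<kappa> f) borel g) t)"
    by (rule prod.cong) (simp_all only: distr_eq)
  finally show ?thesis by simp
qed

text \<open>That the total mass is one cannot be seen from the density, whose normaliser may
  degenerate. It holds because this is the law of an actual observation, which is where
  \<open>n \<ge> 1\<close> enters.\<close>

lemma rotsym_law_bounded:
  fixes U :: "nat \<Rightarrow> 'w \<Rightarrow> real ^ 'n::{finite,linorder}" and g :: "real ^ 'n::{finite,linorder} \<Rightarrow> real"
  assumes s: "rotsym_sample n \<kappa> f M U" and n: "n \<ge> 1" and g: "bdd_meas usphere g"
    and B: "\<And>x. norm x = 1 \<Longrightarrow> \<bar>g x\<bar> \<le> B"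
  defines "D \<equiv> distr (rotsym_law \<kappa> f) borel g"
  shows "real_distribution D" "AE x in D. \<bar>x\<bar> \<le> B"
    "\<And>m. (LINT x|D. x ^ m) = (LINT u|rotsym_law \<kappa> f. g u ^ m)"
proof -
  interpret prob_space M using s by (simp add: rotsym_sample_def)
  have "1 \<in> {1..n}" using n by simp
  then have dist: "distributed M sphere_measure (U 1) (\<lambda>u. ennreal (rotsym_density \<kappa> f u))"
    using s by (auto simp: rotsym_sample_def)
  define L where "L = (rotsym_law \<kappa> f :: (real, 'n) vec measure)"
  have L: "L = distr M sphere_measure (U 1)"
    unfolding L_def using distributed_distr_eq_density[OF dist] by simp
  interpret L: prob_space L
    unfolding L by (rule prob_space_distr[OF distributed_measurable[OF dist]])
  have gs: "g \<in> borel_measurable L"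
    using bdd_meas_measurable[OF g] unfolding borel_measurable_sphere_measure_iff[symmetric] by (simp add: L_def)
  have D: "D = distr L borel g" by (simp add: D_def L_def)
  show "real_distribution D" unfolding D by (rule L.real_distribution_distr[OF gs])
  show "AE x in D. \<bar>x\<bar> \<le> B"
    unfolding D by (subst AE_distr_iff[OF gs]) (auto intro!: AE_I2 B simp: L_def)
  show "(LINT x|D. x ^ m) = (LINT u|rotsym_law \<kappa> f. g u ^ m)" for m
    unfolding D L_def[symmetric] by (rule integral_distr[OF gs]) simp
qed

text \<open>The common core of both parts, for an order \<open>i\<close> below which all Taylor
  terms vanish against the harmonics of active degrees. \<open>\<xi> k\<close> is the squared length
  of the limiting mean vector in degree \<open>k\<close>.\<close>

lemma sobolev_stat_weak_limit:
  fixes v :: "nat \<Rightarrow> real" and f :: "real \<Rightarrow> real" and \<xi> :: "nat \<Rightarrow> real"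
    and M :: "nat \<Rightarrow> 'w measure" and U :: "nat \<Rightarrow> nat \<Rightarrow> 'w \<Rightarrow> real ^ 'n::{finite,linorder}"
  assumes p: "CARD('n) \<ge> 2"
    and v: "finite (weight_support v)" "weight_support v \<noteq> {}"
    and f: "angular_function f" and diff: "times_differentiable_at i f 0" and i: "i \<ge> 1" and \<tau>: "\<tau> > 0"
    and zero: "\<And>k j. k \<ge> 1 \<Longrightarrow> v k \<noteq> 0 \<Longrightarrow> j < i \<Longrightarrow>
       nth_deriv j f 0 * zmean CARD('n) (monom 1 j * leg CARD('n) k) = 0"
    and \<xi>0: "\<And>k. \<xi> k \<ge> 0"
    and \<xi>: "\<And>k. k \<ge> 1 \<Longrightarrow> v k \<noteq> 0 \<Longrightarrow> \<xi> k = real (harm_dim CARD('n) k) *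
       (zmean CARD('n) (monom 1 i * leg CARD('n) k))\<^sup>2 * (nth_deriv i f 0 / fact i)\<^sup>2 * \<tau> ^ (2 * i)"
    and sample: "\<forall>\<^sub>F n in sequentially.
       rotsym_sample n (real n powr (- 1 / (2 * real i)) * \<tau>) f (M n) (U n)"
  shows "weak_conv_m (\<lambda>n. distr (M n) borel (\<lambda>\<omega>. sobolev_stat v n (\<lambda>j. U n j \<omega>)))
    (weighted_sum_law (max_order v) (\<lambda>k. (v k)\<^sup>2) (\<lambda>k. noncentral_chi_square (harm_dim CARD('n) k) (\<xi> k)))"
proof -
  let ?p = "CARD('n)" and ?e = "theta0 :: (real, 'n) vec"
  define \<kappa> where "\<kappa> n = real n powr (- 1 / (2 * real i)) * \<tau>" for n
  define K where "K = max_order v"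
  define I where "I = (SIGMA k:{k \<in> {1..K}. (v k)\<^sup>2 \<noteq> 0}. {..<harm_dim ?p k})"
  have I: "finite I" by (simp add: I_def)
  have I_mem: "fst x \<ge> 1" "v (fst x) \<noteq> 0" "snd x < harm_dim ?p (fst x)" if "x \<in> I" for x
    using that by (auto simp: I_def)
  obtain Y :: "nat \<Rightarrow> nat \<Rightarrow> (real, 'n) vec \<Rightarrow> real" where
    Y_bdd: "\<And>k r. k \<ge> 1 \<Longrightarrow> r < harm_dim ?p k \<Longrightarrow> bdd_meas usphere (Y k r)" and
    Y_kernel: "\<And>k x y. k \<ge> 1 \<Longrightarrow> norm x = 1 \<Longrightarrow> norm y = 1 \<Longrightarrow>
       real (harm_dim ?p k) * poly (leg ?p k) (x \<bullet> y) = (\<Sum>r<harm_dim ?p k. Y k r x * Y k r y)" and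
    Y_orth: "\<And>k r l s. k \<ge> 1 \<Longrightarrow> l \<ge> 1 \<Longrightarrow> r < harm_dim ?p k \<Longrightarrow> s < harm_dim ?p l \<Longrightarrow>
       (LINT w|usphere. Y k r w * Y l s w) = of_bool (k = l \<and> r = s)" and
    Y_zonal: "\<And>k r e m. k \<ge> 1 \<Longrightarrow> r < harm_dim ?p k \<Longrightarrow> norm e = 1 \<Longrightarrow>
       (LINT w|usphere. Y k r w * (w \<bullet> e) ^ m) = zmean ?p (monom 1 m * leg ?p k) * Y k r e"
    by (rule spherical_features[OF p]) (rule that)
  note asym = tilted_integral_asymptotics[OF f diff i norm_theta0[where 'n = 'n] \<tau>, folded \<kappa>_def]
  \<comment> \<open>The limit of the mean of \<open>Z n x\<close>: the Taylor term of order
    \<open>i\<close>, integrated against the harmonic by the Funk-Hecke formula.\<close>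
  define \<mu> where "\<mu> x = \<tau> ^ i * (nth_deriv i f 0 / fact i) *
      (zmean ?p (monom 1 i * leg ?p (fst x)) * Y (fst x) (snd x) ?e)" for x
  define Z where "Z n x \<omega> = (\<Sum>j = 1..n. Y (fst x) (snd x) (U n j \<omega>)) / sqrt (real n)" for n x \<omega>
  define L where "L = weighted_sum_law K (\<lambda>k. (v k)\<^sup>2) (\<lambda>k. noncentral_chi_square (harm_dim ?p k) (\<xi> k))"
  define S where "S n \<omega> = (\<Sum>x\<in>I. (v (fst x))\<^sup>2 * (Z n x \<omega>)\<^sup>2)" for n \<omega>
  define T where "T n \<omega> = sobolev_stat v n (\<lambda>j. U n j \<omega>)" for n \<omega>
  have good: "\<forall>\<^sub>F n in sequentially. n \<ge> 1 \<and> rotsym_sample n (\<kappa> n) f (M n) (U n)"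
    using sample eventually_ge_at_top[of 1] by eventually_elim (simp add: \<kappa>_def)
  have U_sphere: "norm (U n j \<omega>) = 1"
    if "rotsym_sample n (\<kappa> n) f (M n) (U n)" "j \<in> {1..n}" "\<omega> \<in> space (M n)" for n j \<omega>
  proof -
    have "distributed (M n) sphere_measure (U n j) (\<lambda>u. ennreal (rotsym_density (\<kappa> n) f u))"
      using that by (simp add: rotsym_sample_def)
    from measurable_space[OF distributed_measurable[OF this] that(3)] show ?thesis by simp
  qed
  have Z_meas: "Z n x \<in> borel_measurable (M n)"
    if s: "rotsym_sample n (\<kappa> n) f (M n) (U n)" and x: "x \<in> I" for n x
  proof -
    have "Y (fst x) (snd x) \<in> borel_measurable sphere_measure"
      unfolding borel_measurable_sphere_measure_iff
      by (rule bdd_meas_measurable[OF Y_bdd]) (use I_mem[OF x] in auto)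
    moreover have "U n j \<in> M n \<rightarrow>\<^sub>M sphere_measure" if "j \<in> {1..n}" for j
      using s that by (auto simp: rotsym_sample_def intro: distributed_measurable)
    ultimately have "(\<lambda>\<omega>. Y (fst x) (snd x) (U n j \<omega>)) \<in> borel_measurable (M n)" if "j \<in> {1..n}" for j
      using that by (auto intro: measurable_compose)
    then show ?thesis unfolding Z_def by (intro borel_measurable_divide borel_measurable_sum) auto
  qed
  have S_eq: "T n \<omega> = S n \<omega>"
    if "rotsym_sample n (\<kappa> n) f (M n) (U n)" "\<omega> \<in> space (M n)" for n \<omega>
    unfolding T_def S_def I_def K_def Z_def
    by (rule sobolev_stat_eq_squares[OF p v Y_kernel]) (use U_sphere that in auto)
  have S_meas: "T n \<in> borel_measurable (M n)"
    if s: "rotsym_sample n (\<kappa> n) f (M n) (U n)" for n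
  proof -
    have "S n \<in> borel_measurable (M n)"
      unfolding S_def using Z_meas[OF s]
      by (intro borel_measurable_sum borel_measurable_times borel_measurable_power borel_measurable_const)
    then show ?thesis by (rule measurable_cong[THEN iffD2, rotated]) (rule S_eq[OF s])
  qed
  have char: "(\<lambda>n. LINT \<omega>|M n. iexp (\<Sum>x\<in>I. a x * Z n x \<omega>)) \<longlonglongrightarrow>
      iexp (\<Sum>x\<in>I. a x * \<mu> x) * of_real (exp (- (\<Sum>x\<in>I. (a x)\<^sup>2) / 2))" for a
  proof -
    define g where "g u = (\<Sum>x\<in>I. a x * Y (fst x) (snd x) u)" for u
    define Lw where "Lw n = (rotsym_law (\<kappa> n) f :: (real, 'n) vec measure)" for n
    define D where "D n = distr (Lw n) borel g" for n
    define C where "C n = (LINT w|usphere. f (\<kappa> n * (w \<bullet> ?e)))" for n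
    have YI: "bdd_meas usphere (Y (fst x) (snd x))" if "x \<in> I" for x
      using I_mem[OF that] by (intro Y_bdd)
    have g: "bdd_meas usphere g" unfolding g_def by (intro bdd_meas_sum bdd_meas_mult bdd_meas_const YI)
    from g obtain B where "\<forall>x\<in>space usphere. \<bar>g x\<bar> \<le> B"
      unfolding bdd_meas_def by blast
    then have B: "\<And>x. norm x = 1 \<Longrightarrow> \<bar>g x\<bar> \<le> B" by simp
    \<comment> \<open>The normaliser tends to 1, so limits of unnormalised integrals carry over to
      the tilted law.\<close>
    have C1: "C \<longlonglongrightarrow> 1"
      using asym(2)[OF bdd_meas_const[of usphere 1]] usphere.prob_space[where 'n = 'n] by (simp add: C_def[abs_def])
    have Lw: "(LINT u|Lw n. h u) = (LINT w|usphere. h w * f (\<kappa> n * (w \<bullet> ?e))) / C n" if "bdd_meas usphere h" for h n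
      unfolding Lw_def C_def by (rule integral_rotsym_density[OF f that])
    have D: "real_distribution (D n)" "AE x in D n. \<bar>x\<bar> \<le> B" "\<And>m. (LINT x|D n. x ^ m) = (LINT u|Lw n. g u ^ m)"
      if "n \<ge> 1" "rotsym_sample n (\<kappa> n) f (M n) (U n)" for n
      unfolding D_def Lw_def by (rule rotsym_law_bounded[OF that(2,1) g B]; assumption)+
    have gY: "(LINT w|usphere. g w * (w \<bullet> ?e) ^ m) = (\<Sum>x\<in>I. a x * (zmean ?p (monom 1 m * leg ?p (fst x)) * Y (fst x) (snd x) ?e))" for m
    proof -
      have "(LINT w|usphere. g w * (w \<bullet> ?e) ^ m) = (LINT w|usphere. (\<Sum>x\<in>I. a x * (Y (fst x) (snd x) w * (w \<bullet> ?e) ^ m)))"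
        by (simp add: g_def sum_distrib_right mult.assoc)
      also have "\<dots> = (\<Sum>x\<in>I. LINT w|usphere. a x * (Y (fst x) (snd x) w * (w \<bullet> ?e) ^ m))"
        by (intro Bochner_Integration.integral_sum usphere.integrable_bdd_meas bdd_meas_mult bdd_meas_const YI bdd_meas_power bdd_meas_inner)
      also have "\<dots> = (\<Sum>x\<in>I. a x * (zmean ?p (monom 1 m * leg ?p (fst x)) * Y (fst x) (snd x) ?e))"
      proof (rule sum.cong[OF refl])
        fix x assume "x \<in> I"
        from Y_zonal[OF I_mem(1,3)[OF this] norm_theta0, of m]
        show "(LINT w|usphere. a x * (Y (fst x) (snd x) w * (w \<bullet> ?e) ^ m)) =
            a x * (zmean ?p (monom 1 m * leg ?p (fst x)) * Y (fst x) (snd x) ?e)" by simp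
      qed
      finally show ?thesis .
    qed
    have "(\<lambda>n. sqrt (real n) * (LINT w|usphere. g w * f (\<kappa> n * (w \<bullet> ?e)))) \<longlonglongrightarrow>
        \<tau> ^ i * (nth_deriv i f 0 / fact i) * (LINT w|usphere. g w * (w \<bullet> ?e) ^ i)"
    proof (rule asym(3)[OF g])
      fix j assume j: "j < i"
      show "nth_deriv j f 0 * (LINT w|usphere. g w * (w \<bullet> ?e) ^ j) = 0"
        unfolding gY sum_distrib_left
      proof (rule sum.neutral, rule ballI)
        fix x assume "x \<in> I"
        from zero[OF I_mem(1,2)[OF this] j]
        show "nth_deriv j f 0 * (a x * (zmean ?p (monom 1 j * leg ?p (fst x)) * Y (fst x) (snd x) ?e)) = 0"
          by auto
      qed
    qed
    also have "\<tau> ^ i * (nth_deriv i f 0 / fact i) * (LINT w|usphere. g w * (w \<bullet> ?e) ^ i) = (\<Sum>x\<in>I. a x * \<mu> x)"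
      unfolding gY sum_distrib_left by (rule sum.cong) (simp_all add: \<mu>_def)
    finally have "(\<lambda>n. sqrt (real n) * (LINT w|usphere. g w * f (\<kappa> n * (w \<bullet> ?e)))) \<longlonglongrightarrow> (\<Sum>x\<in>I. a x * \<mu> x)" .
    from tendsto_divide[OF this C1]
    have m1': "(\<lambda>n. sqrt (real n) * (LINT u|Lw n. g u)) \<longlonglongrightarrow> (\<Sum>x\<in>I. a x * \<mu> x)"
      by (simp add: Lw[OF g])
    have m1: "(\<lambda>n. sqrt (real n) * (LINT x|D n. x)) \<longlonglongrightarrow> (\<Sum>x\<in>I. a x * \<mu> x)"
      by (rule Lim_transform_eventually[OF m1']) (use good in eventually_elim, use D(3)[where m = 1] in simp)
    have g2: "bdd_meas usphere (\<lambda>w. g w ^ 2)" using g by (rule bdd_meas_power)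
    have "(LINT w|usphere. g w ^ 2) = (LINT w|usphere. (\<Sum>x\<in>I. \<Sum>y\<in>I. (a x * a y) * (Y (fst x) (snd x) w * Y (fst y) (snd y) w)))"
      by (simp add: g_def power2_eq_square sum_product mult_ac)
    also have "\<dots> = (\<Sum>x\<in>I. LINT w|usphere. (\<Sum>y\<in>I. (a x * a y) * (Y (fst x) (snd x) w * Y (fst y) (snd y) w)))"
      by (intro Bochner_Integration.integral_sum usphere.integrable_bdd_meas bdd_meas_sum bdd_meas_mult bdd_meas_const YI)
    also have "\<dots> = (\<Sum>x\<in>I. \<Sum>y\<in>I. LINT w|usphere. (a x * a y) * (Y (fst x) (snd x) w * Y (fst y) (snd y) w))"
      by (intro sum.cong refl Bochner_Integration.integral_sum usphere.integrable_bdd_meas bdd_meas_mult bdd_meas_const YI)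
    also have "\<dots> = (\<Sum>x\<in>I. \<Sum>y\<in>I. if y = x then a x * a x else 0)"
    proof (intro sum.cong refl)
      fix x y assume "x \<in> I" "y \<in> I"
      from Y_orth[OF I_mem(1)[OF this(1)] I_mem(1)[OF this(2)] I_mem(3)[OF this(1)] I_mem(3)[OF this(2)]]
      have "(LINT w|usphere. Y (fst x) (snd x) w * Y (fst y) (snd y) w) = of_bool (x = y)"
        by (simp only: prod_eq_iff)
      then show "(LINT w|usphere. (a x * a y) * (Y (fst x) (snd x) w * Y (fst y) (snd y) w)) =
          (if y = x then a x * a x else 0)" by auto
    qed
    also have "\<dots> = (\<Sum>x\<in>I. (a x)\<^sup>2)" using I by (simp add: power2_eq_square)
    finally have g2_int: "(LINT w|usphere. g w ^ 2) = (\<Sum>x\<in>I. (a x)\<^sup>2)" .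
    from tendsto_divide[OF asym(2)[OF g2] C1]
    have m2': "(\<lambda>n. LINT u|Lw n. (g u)\<^sup>2) \<longlonglongrightarrow> (\<Sum>x\<in>I. (a x)\<^sup>2)"
      by (simp add: Lw[OF g2] g2_int)
    have m2: "(\<lambda>n. LINT x|D n. x\<^sup>2) \<longlonglongrightarrow> (\<Sum>x\<in>I. (a x)\<^sup>2)"
      by (rule Lim_transform_eventually[OF m2']) (use good in eventually_elim, use D(3)[where m = 2] in simp)
    have "\<forall>\<^sub>F n in sequentially. real_distribution (D n) \<and> (AE x in D n. \<bar>x\<bar> \<le> B)"
      using good by eventually_elim (use D(1,2) in blast)
    from char_triangular_tendsto[OF this m1 m2]
    have lim: "(\<lambda>n. char (D n) (1 / sqrt (real n)) ^ n) \<longlonglongrightarrow>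
      exp (\<i> * of_real (\<Sum>x\<in>I. a x * \<mu> x) - of_real (\<Sum>x\<in>I. (a x)\<^sup>2) / 2)" .
    have "\<forall>\<^sub>F n in sequentially. char (D n) (1 / sqrt (real n)) ^ n = (LINT \<omega>|M n. iexp (\<Sum>x\<in>I. a x * Z n x \<omega>))"
      using good
    proof eventually_elim
      case (elim n)
      have "(\<Sum>x\<in>I. a x * Z n x \<omega>) = 1 / sqrt (real n) * (\<Sum>j = 1..n. g (U n j \<omega>))" for \<omega>
      proof -
        have "(\<Sum>j = 1..n. g (U n j \<omega>)) = (\<Sum>x\<in>I. a x * (\<Sum>j = 1..n. Y (fst x) (snd x) (U n j \<omega>)))"
          unfolding g_def sum_distrib_left by (rule sum.swap)
        then show ?thesis by (simp add: Z_def sum_distrib_left sum_divide_distrib)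
      qed
      then show ?case
        using rotsym_sample_char[OF conjunct2[OF elim] g, of "1 / sqrt (real n)"] by (simp only: D_def Lw_def)
    qed
    from Lim_transform_eventually[OF lim this]
    have "(\<lambda>n. LINT \<omega>|M n. iexp (\<Sum>x\<in>I. a x * Z n x \<omega>)) \<longlonglongrightarrow>
      exp (\<i> * of_real (\<Sum>x\<in>I. a x * \<mu> x) - of_real (\<Sum>x\<in>I. (a x)\<^sup>2) / 2)" .
    moreover have "exp (\<i> * of_real r - of_real s / 2) = iexp r * of_real (exp (- s / 2))" for r s :: real
      by (simp add: exp_add[symmetric] flip: exp_of_real)
    ultimately show ?thesis by (simp only:)
  qed
  \<comment> \<open>The addition theorem on the diagonal at \<open>theta0\<close> gives the sum of
    the squared harmonics, whatever basis was chosen.\<close>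
  have \<mu>_sq: "(\<Sum>r<harm_dim ?p k. (\<mu> (k, r))\<^sup>2) = \<xi> k" if "k \<in> {1..K}" "(v k)\<^sup>2 \<noteq> 0" for k
  proof -
    define c where "c = \<tau> ^ i * (nth_deriv i f 0 / fact i) * zmean ?p (monom 1 i * leg ?p k)"
    have k: "k \<ge> 1" "v k \<noteq> 0" using that by auto
    have "(\<Sum>r<harm_dim ?p k. (\<mu> (k, r))\<^sup>2) = c\<^sup>2 * (\<Sum>r<harm_dim ?p k. Y k r ?e * Y k r ?e)"
      unfolding sum_distrib_left by (rule sum.cong) (simp_all add: \<mu>_def c_def power2_eq_square mult_ac)
    also have "(\<Sum>r<harm_dim ?p k. Y k r ?e * Y k r ?e) = real (harm_dim ?p k)"
      using Y_kernel[OF k(1) norm_theta0 norm_theta0] poly_leg_1[OF p, of k] by (simp add: dot_square_norm)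
    also have "c\<^sup>2 * real (harm_dim ?p k) = \<xi> k"
      unfolding \<xi>[OF k] c_def power_mult_distrib power_mult[symmetric] by (simp add: mult_ac)
    finally show ?thesis .
  qed
  have L_props: "real_distribution L" "AE x in L. 0 \<le> x"
    unfolding L_def by (rule weighted_sum_law_props; simp add: noncentral_chi_square_props)+
  have "weak_conv_m (\<lambda>n. distr (M n) borel (T n)) L"
  proof (rule laplace_imp_weak_conv[OF _ L_props])
    show "\<forall>\<^sub>F n in sequentially. real_distribution (distr (M n) borel (T n)) \<and>
       (AE x in distr (M n) borel (T n). 0 \<le> x)"
      using good
    proof eventually_elim
      case (elim n)
      then have s: "rotsym_sample n (\<kappa> n) f (M n) (U n)" by simp
      then have "prob_space (M n)" by (simp add: rotsym_sample_def)
      moreover have "AE x in distr (M n) borel (T n). 0 \<le> x"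
        by (subst AE_distr_iff[OF S_meas[OF s]]) (auto intro!: AE_I2 sum_nonneg simp: S_eq[OF s] S_def)
      ultimately show ?case
        using prob_space.real_distribution_distr[OF _ S_meas[OF s]] by simp
    qed
    fix s :: real assume s: "s \<ge> 0"
    \<comment> \<open>Chosen so that half the sum of the squares of \<open>c x * Z n x\<close> is
      \<open>s\<close> times the statistic.\<close>
    define c where "c x = sqrt (2 * s * (v (fst x))\<^sup>2)" for x :: "nat \<times> nat"
    have "(\<lambda>n. LINT \<omega>|M n. exp (- (\<Sum>x\<in>I. (c x * Z n x \<omega>)\<^sup>2) / 2)) \<longlonglongrightarrow>
      (LINT z|Pi\<^sub>M I (\<lambda>x. normal_dist (\<mu> x)). exp (- (\<Sum>x\<in>I. (c x * z x)\<^sup>2) / 2))"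
    proof (rule laplace_sum_squares_tendsto[OF I _ char])
      show "\<forall>\<^sub>F n in sequentially. prob_space (M n) \<and> (\<forall>x\<in>I. Z n x \<in> borel_measurable (M n))"
        using good
      proof eventually_elim
        case (elim n)
        then show ?case using Z_meas[of n] by (auto simp: rotsym_sample_def)
      qed
    qed
    also have "(LINT z|Pi\<^sub>M I (\<lambda>x. normal_dist (\<mu> x)). exp (- (\<Sum>x\<in>I. (c x * z x)\<^sup>2) / 2)) = (LINT x|L. exp (- (s * x)))"
      unfolding L_def I_def c_def
      by (rule laplace_weighted_chi_square[symmetric]) (use s \<xi>0 \<mu>_sq harm_dim_pos[OF p] in \<open>auto simp: Suc_le_eq\<close>)
    finally have lim: "(\<lambda>n. LINT \<omega>|M n. exp (- (\<Sum>x\<in>I. (c x * Z n x \<omega>)\<^sup>2) / 2)) \<longlonglongrightarrow> (LINT x|L. exp (- (s * x)))" .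
    show "(\<lambda>n. LINT x|distr (M n) borel (T n). exp (- (s * x))) \<longlonglongrightarrow> (LINT x|L. exp (- (s * x)))"
    proof (rule Lim_transform_eventually[OF lim])
      show "\<forall>\<^sub>F n in sequentially. (LINT \<omega>|M n. exp (- (\<Sum>x\<in>I. (c x * Z n x \<omega>)\<^sup>2) / 2)) =
         (LINT x|distr (M n) borel (T n). exp (- (s * x)))"
        using good
      proof eventually_elim
        case (elim n)
        then have sm: "rotsym_sample n (\<kappa> n) f (M n) (U n)" by simp
        have "(LINT x|distr (M n) borel (T n). exp (- (s * x))) =
          (LINT \<omega>|M n. exp (- (s * T n \<omega>)))"
          by (rule integral_distr[OF S_meas[OF sm]]) simp
        also have "\<dots> = (LINT \<omega>|M n. exp (- (\<Sum>x\<in>I. (c x * Z n x \<omega>)\<^sup>2) / 2))"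
        proof (rule Bochner_Integration.integral_cong[OF refl])
          fix \<omega> assume "\<omega> \<in> space (M n)"
          then have "s * T n \<omega> = (\<Sum>x\<in>I. (c x * Z n x \<omega>)\<^sup>2) / 2"
            using s by (simp add: S_eq[OF sm] S_def sum_distrib_left sum_divide_distrib c_def power_mult_distrib)
          then show "exp (- (s * T n \<omega>)) = exp (- (\<Sum>x\<in>I. (c x * Z n x \<omega>)\<^sup>2) / 2)"
            by simp
        qed
        finally show ?case ..
      qed
    qed
  qed
  then show ?thesis by (simp add: L_def K_def T_def[abs_def])
qed

section \<open>Vanishing of the low orders and assembly of the theorem\<close>

lemma zmean_monom_leg_odd:
  assumes p: "p \<ge> 2" and "odd (j + k)"
  shows "zmean p (monom 1 j * leg p k) = 0"
proof -
  have zmom_odd: "zmom p m = 0" if "odd m" for m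
    using that by (induction p m rule: zmom.induct) auto
  have "coeff (leg p k) i = 0" if "odd (i + k)" for i
    using that
  proof (induction p k arbitrary: i rule: leg.induct)
    case (1 p)
    then have "i \<noteq> 0" by (cases i) auto
    then show ?case by simp
  next
    case (2 p)
    then show ?case by (auto simp: coeff_pCons split: nat.splits)
  next
    case (3 p k)
    then show ?case by (cases i) (auto simp del: leg.simps simp: leg.simps(3))
  qed
  then have "coeff (monom 1 j * leg p k) i * zmom p i = 0" for i
    using zmom_odd[of i] assms(2) by (cases "odd i") (auto simp: coeff_monom_mult)
  then show ?thesis unfolding zmean_def by (rule sum.neutral[OF ballI])
qed

text \<open>A non-zero mean forces \<open>k \<le> j\<close> with equal parity, so that
  \<open>k\<close> itself lies in \<open>parity_orders v j\<close>. A non-zero product would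
  therefore make \<open>j\<close> a detecting order.\<close>

lemma zmean_monom_leg_eq_0:
  assumes p: "p \<ge> 2" and k: "k \<ge> 1" "v k \<noteq> 0" and v: "finite (weight_support v)"
    and j: "nth_deriv j f 0 = 0 \<or> parity_orders v j = {}"
  shows "nth_deriv j f 0 * zmean p (monom 1 j * leg p k) = 0"
proof (rule ccontr)
  assume *: "\<not> ?thesis"
  then have "\<not> j < k" "even (j + k)"
    using zmean_monom_leg[OF p, of j k] zmean_monom_leg_odd[OF p, of j k] by auto
  moreover have "min_order v \<le> k"
    using k by (intro Min_le v) (simp add: weight_support_def)
  ultimately have "k \<in> parity_orders v j"
    using k(2) by (auto simp: parity_orders_def same_parity_def)
  with j * show False by auto
qed

theorem theorem3:
  fixes v :: "nat \<Rightarrow> real" and f :: "real \<Rightarrow> real" and q :: nat and \<tau> :: real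
    and p :: nat
  assumes p_def: "p = CARD('n :: {finite, linorder})"
    and p_ge_2: "p \<ge> 2"
    and v_fin: "finite (weight_support v)"
    and v_nz: "weight_support v \<noteq> {}"
    and f_ang: "angular_function f"
    and f_diff: "times_differentiable_at q f 0"
    and q_ge: "q \<ge> max_order v"
    and tau_pos: "\<tau> > 0"
  shows
    "((\<exists>k \<in> {min_order v..q}. detecting_order v f k) \<longrightarrow>
       (let ks = (LEAST k. k \<in> {min_order v..q} \<and> detecting_order v f k);
            kd = Min (parity_orders v ks)
        in (\<forall>k \<in> {1..ks}.
              noncentrality p f k ks \<tau> =
                1 / (fact ks)\<^sup>2 * (t_const p k)\<^sup>2 * (nth_deriv ks f 0)\<^sup>2 * \<tau> ^ (2 * ks) *
                (\<Sum>j = 0..k div 2.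
                   (-1) ^ j * gegen_coeff (gegen_index p) k j * moment p (k + ks - 2 * j))\<^sup>2) \<and>
           (\<forall>(M :: nat \<Rightarrow> 'w measure) (U :: nat \<Rightarrow> nat \<Rightarrow> 'w \<Rightarrow> real ^ ('n :: {finite, linorder})).
              (\<forall>\<^sub>F n in sequentially.
                 rotsym_sample n (real n powr (- 1 / (2 * real ks)) * \<tau>) f (M n) (U n)) \<longrightarrow>
              weak_conv_m
                (\<lambda>n. distr (M n) borel (\<lambda>\<omega>. sobolev_stat v n (\<lambda>i. U n i \<omega>)))
                (weighted_sum_law (max_order v) (\<lambda>k. (v k)\<^sup>2)
                   (\<lambda>k. noncentral_chi_square (harm_dim p k)
                      (of_bool (kd \<le> k \<and> k \<le> ks \<and> same_parity k ks)
                         * noncentrality p f k ks \<tau>)))))) \<and>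
     ((\<not> (\<exists>k \<in> {1..q}. detecting_order v f k)) \<longrightarrow>
       (\<forall>(M :: nat \<Rightarrow> 'w measure) (U :: nat \<Rightarrow> nat \<Rightarrow> 'w \<Rightarrow> real ^ ('n :: {finite, linorder})).
          (\<forall>\<^sub>F n in sequentially.
             rotsym_sample n (real n powr (- 1 / (2 * real q)) * \<tau>) f (M n) (U n)) \<longrightarrow>
          weak_conv_m
            (\<lambda>n. distr (M n) borel (\<lambda>\<omega>. sobolev_stat v n (\<lambda>i. U n i \<omega>)))
            (weighted_sum_law (max_order v) (\<lambda>k. (v k)\<^sup>2)
               (\<lambda>k. chi_square (harm_dim p k)))))"
proof -
  have p2: "CARD('n) \<ge> 2" using p_ge_2 p_def by simp
  have min_pos: "min_order v \<ge> 1"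
    using Min_in[OF v_fin v_nz] by (simp add: weight_support_def)
  have part1: "(\<forall>k \<in> {1..ks}. noncentrality p f k ks \<tau> =
                1 / (fact ks)\<^sup>2 * (t_const p k)\<^sup>2 * (nth_deriv ks f 0)\<^sup>2 * \<tau> ^ (2 * ks) *
                (\<Sum>j = 0..k div 2.
                   (-1) ^ j * gegen_coeff (gegen_index p) k j * moment p (k + ks - 2 * j))\<^sup>2)" for ks
    using noncentrality_eq_moments[OF p_ge_2] by (simp add: moment_eq_zmom[OF p_ge_2])
  have part2: "weak_conv_m
                (\<lambda>n. distr (M n) borel (\<lambda>\<omega>. sobolev_stat v n (\<lambda>i. U n i \<omega>)))
                (weighted_sum_law (max_order v) (\<lambda>k. (v k)\<^sup>2)
                   (\<lambda>k. noncentral_chi_square (harm_dim p k)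
                      (of_bool (kd \<le> k \<and> k \<le> ks \<and> same_parity k ks)
                         * noncentrality p f k ks \<tau>)))"
    if ks: "ks = (LEAST k. k \<in> {min_order v..q} \<and> detecting_order v f k)"
      and kd: "kd = Min (parity_orders v ks)"
      and ex: "\<exists>k \<in> {min_order v..q}. detecting_order v f k"
      and sample: "\<forall>\<^sub>F n in sequentially.
                 rotsym_sample n (real n powr (- 1 / (2 * real ks)) * \<tau>) f (M n) (U n)"
    for ks kd and M :: "nat \<Rightarrow> 'w measure" and U :: "nat \<Rightarrow> nat \<Rightarrow> 'w \<Rightarrow> real ^ ('n :: {finite, linorder})"
  proof -
    have ks_in: "ks \<in> {min_order v..q}" "detecting_order v f ks"
      using LeastI_ex[OF ex[unfolded Bex_def]] unfolding ks by auto
    have ks_least: "\<not> detecting_order v f j" if "j < ks" "min_order v \<le> j" for j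
    proof
      assume "detecting_order v f j"
      with that ks_in(1) have "ks \<le> j" unfolding ks by (intro Least_le) auto
      with that show False by simp
    qed
    have ks1: "ks \<ge> 1" using ks_in(1) min_pos by simp
    have fin: "finite (parity_orders v ks)" by (simp add: parity_orders_def)
    show ?thesis
      unfolding p_def
    proof (rule sobolev_stat_weak_limit[OF p2 v_fin v_nz f_ang _ ks1 tau_pos _ _ _ sample])
      show "times_differentiable_at ks f 0"
        using times_differentiable_at_mono[OF f_diff] ks_in(1) by simp
      show "nth_deriv j f 0 * zmean CARD('n) (monom 1 j * leg CARD('n) k) = 0"
        if "k \<ge> 1" "v k \<noteq> 0" "j < ks" for k j
      proof (rule zmean_monom_leg_eq_0[OF p2 that(1,2) v_fin])
        \<comment> \<open>Orders below \<open>min_order v\<close> have an empty parity set; from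
          there on the minimality of \<open>ks\<close> applies.\<close>
        show "nth_deriv j f 0 = 0 \<or> parity_orders v j = {}"
        proof (cases "min_order v \<le> j")
          case True
          then show ?thesis using ks_least[OF that(3)] by (auto simp: detecting_order_def)
        next
          case False
          then show ?thesis by (simp add: parity_orders_def)
        qed
      qed
      show "0 \<le> of_bool (kd \<le> k \<and> k \<le> ks \<and> same_parity k ks) * noncentrality CARD('n) f k ks \<tau>" for k
        unfolding noncentrality_def by (intro mult_nonneg_nonneg divide_nonneg_nonneg zero_le_power2) (use tau_pos in auto)
      fix k assume k: "k \<ge> 1" "v k \<noteq> 0"
      show "of_bool (kd \<le> k \<and> k \<le> ks \<and> same_parity k ks) * noncentrality CARD('n) f k ks \<tau> =
        real (harm_dim CARD('n) k) * (zmean CARD('n) (monom 1 ks * leg CARD('n) k))\<^sup>2 *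
          (nth_deriv ks f 0 / fact ks)\<^sup>2 * \<tau> ^ (2 * ks)"
      \<comment> \<open>For an active order of the right parity \<open>kd \<le> k\<close> is
        automatic, by minimality of \<open>kd\<close>. In the remaining cases the mean itself
        vanishes, by degree or by parity.\<close>
      proof (cases "k \<le> ks \<and> same_parity k ks")
        case True
        moreover have "min_order v \<le> k" using k by (intro Min_le v_fin) (simp add: weight_support_def)
        ultimately have "k \<in> parity_orders v ks" using k(2) by (auto simp: parity_orders_def)
        then have "kd \<le> k" unfolding kd by (rule Min_le[OF fin])
        then show ?thesis using True noncentrality_eq[OF p2 k(1)] by simp
      next
        case False
        then have "zmean CARD('n) (monom 1 ks * leg CARD('n) k) = 0"
          using zmean_monom_leg[OF p2, of ks k] zmean_monom_leg_odd[OF p2, of ks k]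
          by (auto simp: same_parity_def not_le)
        then show ?thesis using False by auto
      qed
    qed
  qed
  have part3: "weak_conv_m
            (\<lambda>n. distr (M n) borel (\<lambda>\<omega>. sobolev_stat v n (\<lambda>i. U n i \<omega>)))
            (weighted_sum_law (max_order v) (\<lambda>k. (v k)\<^sup>2)
               (\<lambda>k. chi_square (harm_dim p k)))"
    if none: "\<not> (\<exists>k \<in> {1..q}. detecting_order v f k)"
      and sample: "\<forall>\<^sub>F n in sequentially.
             rotsym_sample n (real n powr (- 1 / (2 * real q)) * \<tau>) f (M n) (U n)"
    for M :: "nat \<Rightarrow> 'w measure" and U :: "nat \<Rightarrow> nat \<Rightarrow> 'w \<Rightarrow> real ^ ('n :: {finite, linorder})"
  proof -
    have "max_order v \<ge> 1" using Max_in[OF v_fin v_nz] by (simp add: weight_support_def)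
    then have q1: "q \<ge> 1" using q_ge by simp
    \<comment> \<open>The bound includes \<open>j = q\<close>: this makes the limiting means vanish
      too, so the limit is central.\<close>
    have zero: "nth_deriv j f 0 * zmean CARD('n) (monom 1 j * leg CARD('n) k) = 0"
      if "k \<ge> 1" "v k \<noteq> 0" "j \<le> q" for k j
    proof (rule zmean_monom_leg_eq_0[OF p2 that(1,2) v_fin])
      show "nth_deriv j f 0 = 0 \<or> parity_orders v j = {}"
      \<comment> \<open>Order 0 lies outside the assumption \<open>none\<close>, and
        \<open>f 0 = 1\<close> does not vanish; but all active orders are at least 1, so the parity
        set is empty.\<close>
      proof (cases "j = 0")
        case True
        then show ?thesis using min_pos by (simp add: parity_orders_def)
      next
        case False
        then show ?thesis using none that(3) by (auto simp: detecting_order_def)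
      qed
    qed
    show ?thesis
      unfolding p_def
    proof (rule sobolev_stat_weak_limit[OF p2 v_fin v_nz f_ang f_diff q1 tau_pos _ _ _ sample])
      fix k assume k: "k \<ge> 1" "v k \<noteq> 0"
      show "0 = real (harm_dim CARD('n) k) * (zmean CARD('n) (monom 1 q * leg CARD('n) k))\<^sup>2 *
          (nth_deriv q f 0 / fact q)\<^sup>2 * \<tau> ^ (2 * q)"
        using zero[OF k, of q] by auto
    qed (use zero in auto)
  qed
  show ?thesis
    unfolding Let_def using part1 part2[OF refl refl] part3 by blast
qed

end
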